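(* The Max Weight Independent Set problem is solvable in time $\mathcal{O}(n^{5})$ on $n$-vertex $1$-perfectly orientable graphs.
   Context: All graphs are finite, simple and undirected. A graph $G$ is $1$-perfectly orientable if its edges can be oriented (each edge in one direction) so that no vertex has a pair of non-adjacent out-neighbors. Max Weight Independent Set: given a graph $G$ and a weight function $w:V(G)\to\mathbb{Q}_+$ (nonnegative rationals), find an independent set $I$ in $G$ maximizing $\sum_{x\in I}w(x)$. *)

theory Defs
  imports Complex_Main "HOL-Library.Landau_Symbols" "Graph_Theory.Pair_Digraph"
begin

section \<open>1-perfectly orientable graphs and independent sets\<close>

text \<open>
  A finite simple undirected graph is a \<^locale>\<open>pair_graph\<close>: a finite loopless symmetric
  digraph in which the edge \<open>uv\<close> is represented by the two pairs \<open>(u, v)\<close> and \<open>(v, u)\<close>.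
  An orientation keeps exactly one of the two pairs of every edge.
\<close>

definition orientation_of :: "'a pair_pre_digraph \<Rightarrow> 'a rel \<Rightarrow> bool" where
  "orientation_of G D \<longleftrightarrow>
     D \<subseteq> parcs G \<and> (\<forall>u v. (u, v) \<in> parcs G \<longrightarrow> ((u, v) \<in> D) \<noteq> ((v, u) \<in> D))"

definition one_perfectly_orientable :: "'a pair_pre_digraph \<Rightarrow> bool" where
  "one_perfectly_orientable G \<longleftrightarrow>
     pair_graph G \<and>
     (\<exists>D. orientation_of G D \<and>
        \<not> (\<exists>u v w. (u, v) \<in> D \<and> (u, w) \<in> D \<and> v \<noteq> w \<and> (v, w) \<notin> parcs G))"

definition independent_set :: "'a pair_pre_digraph \<Rightarrow> 'a set \<Rightarrow> bool" where
  "independent_set G I \<longleftrightarrow> I \<subseteq> pverts G \<and> (\<forall>u\<in>I. \<forall>v\<in>I. (u, v) \<notin> parcs G)"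

definition max_weight_independent_set ::
  "'a pair_pre_digraph \<Rightarrow> ('a \<Rightarrow> rat) \<Rightarrow> 'a set \<Rightarrow> bool" where
  "max_weight_independent_set G w I \<longleftrightarrow>
     independent_set G I \<and> (\<forall>J. independent_set G J \<longrightarrow> sum w J \<le> sum w I)"


section \<open>Random access machine programs and their running time\<close>

text \<open>
  The model of computation is a unit-cost random access machine, presented as a structured
  imperative language. The memory consists of named arrays of natural numbers, used for indices
  and control, and named arrays of rational numbers, used for weights; a scalar variable is
  an array used at index \<open>0\<close> only. A program mentions only finitely many names and constants.
  Both kinds of numbers can be added, subtracted and compared, but neither multiplied nor
  divided, and a rational number is never converted to a natural number or used as an index.
  Every node of an expression and every command costs one step each time it is executed.
\<close>

datatype nexp =
    NConst nat
  | NGet string nexp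
  | NPlus nexp nexp
  | NMinus nexp nexp

datatype qexp =
    QConst rat
  | QGet string nexp
  | QPlus qexp qexp
  | QMinus qexp qexp

datatype bexp =
    NLess nexp nexp
  | QLess qexp qexp
  | BNot bexp
  | BAnd bexp bexp

datatype com =
    Skip
  | NSet string nexp nexp
  | QSet string nexp qexp
  | Seq com com
  | Cond bexp com com
  | While bexp com

record memory =
  nmem :: "string \<Rightarrow> nat \<Rightarrow> nat"
  qmem :: "string \<Rightarrow> nat \<Rightarrow> rat"

primrec nval :: "nexp \<Rightarrow> memory \<Rightarrow> nat" where
  "nval (NConst k) s = k"
| "nval (NGet x i) s = nmem s x (nval i s)"
| "nval (NPlus a b) s = nval a s + nval b s"
| "nval (NMinus a b) s = nval a s - nval b s"

primrec qval :: "qexp \<Rightarrow> memory \<Rightarrow> rat" where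
  "qval (QConst q) s = q"
| "qval (QGet x i) s = qmem s x (nval i s)"
| "qval (QPlus a b) s = qval a s + qval b s"
| "qval (QMinus a b) s = qval a s - qval b s"

primrec bval :: "bexp \<Rightarrow> memory \<Rightarrow> bool" where
  "bval (NLess a b) s = (nval a s < nval b s)"
| "bval (QLess a b) s = (qval a s < qval b s)"
| "bval (BNot b) s = (\<not> bval b s)"
| "bval (BAnd a b) s = (bval a s \<and> bval b s)"

primrec ncost :: "nexp \<Rightarrow> nat" where
  "ncost (NConst k) = 1"
| "ncost (NGet x i) = 1 + ncost i"
| "ncost (NPlus a b) = 1 + ncost a + ncost b"
| "ncost (NMinus a b) = 1 + ncost a + ncost b"

primrec qcost :: "qexp \<Rightarrow> nat" where
  "qcost (QConst q) = 1"
| "qcost (QGet x i) = 1 + ncost i"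
| "qcost (QPlus a b) = 1 + qcost a + qcost b"
| "qcost (QMinus a b) = 1 + qcost a + qcost b"

primrec bcost :: "bexp \<Rightarrow> nat" where
  "bcost (NLess a b) = 1 + ncost a + ncost b"
| "bcost (QLess a b) = 1 + qcost a + qcost b"
| "bcost (BNot b) = 1 + bcost b"
| "bcost (BAnd a b) = 1 + bcost a + bcost b"

definition nstore :: "string \<Rightarrow> nat \<Rightarrow> nat \<Rightarrow> memory \<Rightarrow> memory" where
  "nstore x i k s = s\<lparr>nmem := (nmem s)(x := (nmem s x)(i := k))\<rparr>"

definition qstore :: "string \<Rightarrow> nat \<Rightarrow> rat \<Rightarrow> memory \<Rightarrow> memory" where
  "qstore x i q s = s\<lparr>qmem := (qmem s)(x := (qmem s x)(i := q))\<rparr>"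

text \<open>
  \<open>exec c s t s'\<close>: started in memory \<open>s\<close>, the program \<open>c\<close> halts after exactly \<open>t\<close> steps in
  memory \<open>s'\<close>.
\<close>

inductive exec :: "com \<Rightarrow> memory \<Rightarrow> nat \<Rightarrow> memory \<Rightarrow> bool" where
  Skip: "exec Skip s 1 s"
| NSet: "exec (NSet x i a) s (1 + ncost i + ncost a) (nstore x (nval i s) (nval a s) s)"
| QSet: "exec (QSet x i a) s (1 + ncost i + qcost a) (qstore x (nval i s) (qval a s) s)"
| Seq: "exec c s t s' \<Longrightarrow> exec d s' t' s'' \<Longrightarrow> exec (Seq c d) s (1 + t + t') s''"
| CondT: "bval b s \<Longrightarrow> exec c s t s' \<Longrightarrow> exec (Cond b c d) s (1 + bcost b + t) s'"
| CondF: "\<not> bval b s \<Longrightarrow> exec d s t s' \<Longrightarrow> exec (Cond b c d) s (1 + bcost b + t) s'"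
| WhileF: "\<not> bval b s \<Longrightarrow> exec (While b c) s (1 + bcost b) s"
| WhileT: "bval b s \<Longrightarrow> exec c s t s' \<Longrightarrow> exec (While b c) s' t' s'' \<Longrightarrow>
    exec (While b c) s (1 + bcost b + t + t') s''"

text \<open>
  Halting time and result are unique, so that the existential quantifiers over them in
  \<open>solves_MWIS\<close> below do not introduce nondeterminism.
\<close>

lemma exec_deterministic:
  "exec c s t s' \<Longrightarrow> exec c s u s'' \<Longrightarrow> u = t \<and> s'' = s'"
proof (induction arbitrary: u s'' rule: exec.induct)
  case (Skip s)
  from Skip.prems show ?case by cases auto
next
  case (NSet x i a s)
  from NSet.prems show ?case by cases auto
next
  case (QSet x i a s)
  from QSet.prems show ?case by cases auto
next
  case (Seq c s t s' d t' s1)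
  from Seq.prems show ?case by cases (use Seq.IH in blast)
next
  case (CondT b s c t s' d)
  from CondT.prems show ?case by cases (use CondT in blast)+
next
  case (CondF b s d t s' c)
  from CondF.prems show ?case by cases (use CondF in blast)+
next
  case (WhileF b s c)
  from WhileF.prems show ?case by cases (use WhileF in auto)
next
  case (WhileT b s c t s' t' s1)
  from WhileT.prems show ?case by cases (use WhileT in blast)+
qed


section \<open>Algorithms for Max Weight Independent Set\<close>

text \<open>
  An input graph on \<open>n\<close> vertices has vertex set \<open>{..<n}\<close>. It is given by \<open>n\<close>, its adjacency matrix
  stored row by row, and the vertex weights; everything else is initially \<open>0\<close>.
\<close>

definition input_memory :: "nat \<Rightarrow> nat pair_pre_digraph \<Rightarrow> (nat \<Rightarrow> rat) \<Rightarrow> memory" where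
  "input_memory n G w =
     \<lparr>nmem = (\<lambda>x k.
        if x = ''n'' \<and> k = 0 then n
        else if x = ''adj'' \<and> k < n * n \<and> (k div n, k mod n) \<in> parcs G then 1
        else 0),
      qmem = (\<lambda>x k. if x = ''w'' \<and> k < n then w k else 0)\<rparr>"

definition output_set :: "nat \<Rightarrow> memory \<Rightarrow> nat set" where
  "output_set n s = {v. v < n \<and> nmem s ''out'' v \<noteq> 0}"

text \<open>
  \<open>solves_MWIS c P T\<close>: on every weighted graph from the class \<open>P\<close>, the program \<open>c\<close> finds an
  independent set of maximum weight in at most \<open>T n\<close> steps, \<open>n\<close> being the number of vertices.
  Nothing is required of \<open>c\<close> on other inputs.
\<close>

definition solves_MWIS :: "com \<Rightarrow> (nat pair_pre_digraph \<Rightarrow> bool) \<Rightarrow> (nat \<Rightarrow> nat) \<Rightarrow> bool" where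
  "solves_MWIS c P T \<longleftrightarrow>
     (\<forall>n G w. P G \<and> pverts G = {..<n} \<and> (\<forall>v\<in>pverts G. 0 \<le> w v) \<longrightarrow>
        (\<exists>t s. exec c (input_memory n G w) t s \<and> t \<le> T n \<and>
               max_weight_independent_set G w (output_set n s)))"

end

(*
  Orient the edges so that out-neighbourhoods are cliques. If x and y are nonadjacent and both see
  a connected set D, then x or y has an out-neighbour in D, and no vertex has out-neighbours in two
  sets without an edge between them. Eliminate the vertices one at a time, always choosing a vertex
  v such that any two members of its bag B (v and the later vertices reached through earlier ones)
  are joined by a path with interior outside B; a neighbour-minimal vertex of a smallest component
  left by deleting a closed neighbourhood is of this kind. The out-arcs then show that every bag has
  independence number at most 3: among four independent vertices of B, the six pairs are joined
  through components outside B, each pair has an end with an out-arc into its component, and no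
  vertex can serve two pairs. Dynamic programming over the resulting tree decomposition with the at
  most 3 chosen vertices of a bag as state needs O(n^4) table entries, each computed from O(n) others,
  and the elimination order is found by testing each of n candidates in each of n rounds with a
  Floyd-Warshall closure.
*)
theory Submission
  imports Defs
begin

section \<open>Connections through a set of vertices\<close>

text \<open>The order matters: a star is 1-perfectly orientable (orient every edge towards the
  center), yet eliminating its center first puts all leaves into one bag. Demanding that bag members
  be joined outside the bag is what creates components into which out-arcs must point. This demand
  concerns walks in the original graph, whereas \<open>v\<close> is found in the filled graph, in
  which two remaining vertices are adjacent if eliminated ones join them. Existence is therefore
  proved for an arbitrary reflexive symmetric relation and translated back. The count over six pairs
  also needs a detour around each component: if both ends of a pair had out-arcs into it, one of
  them would have a second out-arc on the detour, to a vertex not adjacent to the first. The detour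
  passes through a bag vertex not adjacent to the component, and there is none if the component is
  adjacent to the whole bag. That case is reduced to an earlier, larger bag. The orientation serves
  only the analysis: the program works on the adjacency matrix and never computes an
  orientation.\<close>

definition conn :: "('a \<Rightarrow> 'a \<Rightarrow> bool) \<Rightarrow> 'a set \<Rightarrow> 'a \<Rightarrow> 'a \<Rightarrow> bool" where
  "conn E L x y \<longleftrightarrow> x = y \<or> (\<exists>z. (\<lambda>u v. E u v \<and> v \<in> L)\<^sup>*\<^sup>* x z \<and> E z y)"

lemma conn_refl [simp]: "conn E L x x"
  by (simp add: conn_def)

lemma conn_edge: "E x y \<Longrightarrow> conn E L x y"
  unfolding conn_def by blast

lemma conn_empty [simp]: "conn E {} x y \<longleftrightarrow> x = y \<or> E x y"
proof -
  have "(\<lambda>u v. E u v \<and> v \<in> {})\<^sup>*\<^sup>* x z \<Longrightarrow> z = x" for z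
    by (induction rule: rtranclp_induct) auto
  then show ?thesis unfolding conn_def by blast
qed

lemma conn_mono:
  assumes "conn E L x y" "L \<subseteq> M"
  shows "conn E M x y"
proof -
  have "(\<lambda>u v. E u v \<and> v \<in> M)\<^sup>*\<^sup>* x z" if "(\<lambda>u v. E u v \<and> v \<in> L)\<^sup>*\<^sup>* x z" for z
    using that by (rule rtranclp_mono[THEN predicate2D, rotated]) (use assms(2) in auto)
  then show ?thesis using assms(1) unfolding conn_def by blast
qed

lemma conn_path:
  assumes "conn E L x k" "k \<in> L"
  shows "(\<lambda>u v. E u v \<and> v \<in> L)\<^sup>*\<^sup>* x k"
  using assms unfolding conn_def by (auto intro: rtranclp.rtrancl_into_rtrancl)

lemma conn_trans:
  assumes "conn E L x k" "conn E L k y" "k \<in> L"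
  shows "conn E L x y"
proof (cases "k = y")
  case False
  then obtain z where "(\<lambda>u v. E u v \<and> v \<in> L)\<^sup>*\<^sup>* k z" "E z y"
    using assms(2) unfolding conn_def by blast
  then show ?thesis
    using conn_path[OF assms(1,3)] unfolding conn_def by (meson rtranclp_trans)
qed (use assms in simp)

lemma conn_insert:
  "conn E (insert k L) x y \<longleftrightarrow> conn E L x y \<or> conn E L x k \<and> conn E L k y"
proof
  assume "conn E (insert k L) x y"
  moreover have "(\<lambda>u v. E u v \<and> v \<in> L)\<^sup>*\<^sup>* x z \<or>
      conn E L x k \<and> (\<lambda>u v. E u v \<and> v \<in> L)\<^sup>*\<^sup>* k z"
    if "(\<lambda>u v. E u v \<and> v \<in> insert k L)\<^sup>*\<^sup>* x z" for z
    using that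
  proof (induction rule: rtranclp_induct)
    case (step z z')
    show ?case
    proof (cases "z' = k")
      case True
      then show ?thesis using step unfolding conn_def by blast
    next
      case False
      then have "E z z' \<and> z' \<in> L" using step by blast
      then show ?thesis using step.IH
        by (metis (mono_tags, lifting) rtranclp.rtrancl_into_rtrancl)
    qed
  qed simp
  ultimately show "conn E L x y \<or> conn E L x k \<and> conn E L k y"
    unfolding conn_def by blast
next
  assume "conn E L x y \<or> conn E L x k \<and> conn E L k y"
  then show "conn E (insert k L) x y"
    by (meson conn_mono conn_trans insertI1 subset_insertI)
qed

lemma conn_sym:
  assumes "symp E" "conn E L x y"
  shows "conn E L y x"
proof (cases "x = y")
  case False
  then obtain z where "(\<lambda>u v. E u v \<and> v \<in> L)\<^sup>*\<^sup>* x z" "E z y"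
    using assms(2) unfolding conn_def by blast
  then show ?thesis
  proof (induction arbitrary: y rule: rtranclp_induct)
    case base
    then show ?case using assms(1) by (auto intro: conn_edge dest: sympD)
  next
    case (step z z')
    have "conn E L y z'" using step.prems assms(1) by (auto intro: conn_edge dest: sympD)
    moreover have "conn E L z' x" using step by blast
    ultimately show ?case using step.hyps conn_trans[of E L y z' x] by blast
  qed
qed simp

text \<open>Each edge of the filled graph \<open>conn E L\<close> unfolds into a walk of
  \<open>E\<close> through \<open>L\<close>.\<close>

lemma conn_conn:
  assumes "conn (conn E L) M x y"
  shows "conn E (L \<union> M) x y"
proof (cases "x = y")
  case False
  then obtain z where z: "(\<lambda>u v. conn E L u v \<and> v \<in> M)\<^sup>*\<^sup>* x z" "conn E L z y"
    using assms unfolding conn_def[of "conn E L"] by blast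
  \<comment> \<open>The second conjunct is what permits gluing: two connections can be joined at
    \<open>z'\<close> only if \<open>z'\<close> is an allowed interior vertex, or the first one is
    trivial.\<close>
  have "conn E (L \<union> M) x z' \<and> (z' = x \<or> z' \<in> M)"
    if "(\<lambda>u v. conn E L u v \<and> v \<in> M)\<^sup>*\<^sup>* x z'" for z'
    using that
  proof (induction rule: rtranclp_induct)
    case (step u v)
    have "conn E (L \<union> M) u v" using step conn_mono[of E L u v "L \<union> M"] by blast
    then show ?case using step conn_trans[of E "L \<union> M" x u v] by blast
  qed simp
  with z(1) have "conn E (L \<union> M) x z" "z = x \<or> z \<in> M" by auto
  moreover have "conn E (L \<union> M) z y" using z(2) conn_mono[of E L z y] by blast
  ultimately show ?thesis using conn_trans[of E "L \<union> M" x z y] by blast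
qed simp

text \<open>As \<open>h\<close> is reflexive, \<open>h v\<close> is a closed neighbourhood. Among
  all components left by deleting a closed neighbourhood, \<open>K\<close> is a smallest one,
  obtained by deleting that of \<open>r\<close>, and \<open>v\<close> in \<open>K\<close> has the
  fewest neighbours. A neighbour of \<open>v\<close> that sees a non-neighbour of \<open>v\<close>
  is linked to \<open>r\<close> through non-neighbours of \<open>v\<close>; any other neighbour of
  \<open>v\<close> turns out to be adjacent to all neighbours of \<open>v\<close>. So two neighbours
  are adjacent or meet at \<open>r\<close>.\<close>

lemma ex_avoidable:
  fixes h :: "'a \<Rightarrow> 'a \<Rightarrow> bool"
  assumes fin: "finite R" and ne: "R \<noteq> {}"
    and refl: "\<And>x. h x x" and sym: "symp h"
  shows "\<exists>v\<in>R. \<forall>x\<in>R. \<forall>y\<in>R. h v x \<longrightarrow> h v y \<longrightarrow> conn h {k \<in> R. \<not> h v k} x y"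
proof (cases "\<forall>x\<in>R. \<forall>y\<in>R. h x y")
  case True
  then show ?thesis using ne conn_edge[of h] by fast
next
  case False
  have sy: "h a b \<Longrightarrow> h b a" for a b using sym by (meson sympD)
  define P where "P r = (\<lambda>u v. h u v \<and> v \<in> {k \<in> R. \<not> h r k})" for r
  define C where "C r c = {z. (P r)\<^sup>*\<^sup>* c z}" for r c
  define A where "A = {(r, c). r \<in> R \<and> c \<in> R \<and> \<not> h r c}"
  have CR: "C r c \<subseteq> {k \<in> R. \<not> h r k}" if "(r, c) \<in> A" for r c
  proof
    fix z assume "z \<in> C r c"
    then have "(P r)\<^sup>*\<^sup>* c z" by (simp add: C_def)
    then show "z \<in> {k \<in> R. \<not> h r k}"
      by (induction rule: rtranclp_induct) (use that in \<open>auto simp: A_def P_def\<close>)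
  qed
  have "A \<noteq> {}" using False by (auto simp: A_def)
  then obtain rc where rc: "rc \<in> A" "\<And>p. p \<in> A \<Longrightarrow> card (C (fst rc) (snd rc)) \<le> card (C (fst p) (snd p))"
    using ex_has_least_nat[of "\<lambda>p. p \<in> A" _ "\<lambda>p. card (C (fst p) (snd p))"] by blast
  obtain r c where [simp]: "rc = (r, c)" by (cases rc)
  have rR: "r \<in> R" and cR: "c \<in> R" and rcA: "(r, c) \<in> A" using rc(1) by (auto simp: A_def)
  define K where "K = C r c"
  have KR: "K \<subseteq> {k \<in> R. \<not> h r k}" using CR[OF rcA] by (simp add: K_def)
  have cK: "c \<in> K" by (simp add: K_def C_def)
  have finK: "finite K" using KR fin by (auto intro: finite_subset)
  have Kcl: "z \<in> K" if "y \<in> K" "h y z" "z \<in> R" "\<not> h r z" for y z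
    using that by (auto simp: K_def C_def P_def intro: rtranclp.rtrancl_into_rtrancl)
  obtain v where v: "v \<in> K" "\<And>x. x \<in> K \<Longrightarrow> card {z \<in> R. h v z} \<le> card {z \<in> R. h x z}"
    using cK ex_has_least_nat[of "\<lambda>x. x \<in> K" c "\<lambda>x. card {z \<in> R. h x z}"] by blast
  have vR: "v \<in> R" and rv: "\<not> h r v" "\<not> h v r" using v(1) KR sy by auto
  let ?M = "{k \<in> R. \<not> h v k}"
  have rM: "r \<in> ?M" using rR rv by simp
  have to_r: "conn h ?M x r" if x: "x \<in> R" "h v x" and nd: "\<not> {z \<in> R. h x z} \<subseteq> {z \<in> R. h v z}" for x
  proof (cases "h r x")
    case True
    then show ?thesis using sy conn_edge[of h] by blast
  next
    case False
    obtain z where z: "z \<in> R" "h x z" "\<not> h v z" using nd by blast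
    have "conn h ?M z r"
    proof (cases "h r z")
      case True
      then show ?thesis using sy conn_edge[of h] by blast
    next
      case nrz: False
      have xK: "x \<in> K" using Kcl v(1) x False by blast
      have zK: "z \<in> K" using Kcl xK z nrz by blast
      show ?thesis
      proof (rule ccontr)
        assume nc: "\<not> conn h ?M z r"
        have vz: "(v, z) \<in> A" using vR z by (simp add: A_def)
        \<comment> \<open>If \<open>z\<close> could not reach \<open>r\<close>, its component among
          the non-neighbours of \<open>v\<close> would never touch a neighbour of \<open>r\<close>
          and so would stay in \<open>K\<close>. It misses \<open>v\<close>, which contradicts the
          minimality of \<open>K\<close>.\<close>
        have "C v z \<subseteq> K"
        proof
          fix y assume "y \<in> C v z"
          then have "(P v)\<^sup>*\<^sup>* z y" by (simp add: C_def)
          then show "y \<in> K"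
          proof (induction rule: rtranclp_induct)
            case (step y y')
            have "\<not> h r y'"
            proof
              assume "h r y'"
              then have "h y' r" using sy by blast
              moreover have "(P v)\<^sup>*\<^sup>* z y'" using step.hyps by (meson rtranclp.rtrancl_into_rtrancl)
              ultimately show False using nc unfolding conn_def P_def by blast
            qed
            then show ?case using step Kcl by (auto simp: P_def)
          qed (use zK in simp)
        qed
        moreover have "v \<notin> C v z" using CR[OF vz] refl by blast
        ultimately have "C v z \<subset> K" using v(1) by blast
        then have "card (C v z) < card K" using finK psubset_card_mono by blast
        then show False using rc(2)[OF vz] by (simp add: K_def)
      qed
    qed
    moreover have "z \<in> ?M" "conn h ?M x z" using z conn_edge[of h] by auto
    ultimately show ?thesis using conn_trans[of h ?M x z r] by blast
  qed
  \<comment> \<open>Since \<open>r\<close> is not a neighbour of \<open>v\<close>, it is none of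
    \<open>x\<close> either, so \<open>x\<close> lies in \<open>K\<close>; the minimal degree of
    \<open>v\<close> within \<open>K\<close> turns the inclusion of neighbourhoods into an
    equality.\<close>
  have dom: "h x y" if x: "x \<in> R" "h v x" and y: "y \<in> R" "h v y"
    and d: "{z \<in> R. h x z} \<subseteq> {z \<in> R. h v z}" for x y
  proof -
    have "\<not> h r x" using d rR rv sy by blast
    then have "x \<in> K" using Kcl v(1) x by blast
    then have "{z \<in> R. h x z} = {z \<in> R. h v z}"
      using v(2) d fin by (simp add: card_seteq)
    then show ?thesis using y by blast
  qed
  show ?thesis
  proof (intro bexI[OF _ vR] ballI impI)
    fix x y assume x: "x \<in> R" "h v x" and y: "y \<in> R" "h v y"
    show "conn h ?M x y"
    proof (cases "h x y")
      case True
      then show ?thesis using conn_edge[of h] by blast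
    next
      case False
      then have "conn h ?M x r" "conn h ?M y r"
        using to_r dom x y sy by blast+
      then show ?thesis using conn_trans[of h ?M x r y] rM conn_sym[OF sym] by blast
    qed
  qed
qed

section \<open>Independent sets in the bags of an elimination order\<close>

locale one_po =
  fixes E :: "'a \<Rightarrow> 'a \<Rightarrow> bool" and D :: "'a rel"
  assumes sym: "symp E"
    and D_edge: "\<And>u v. (u, v) \<in> D \<Longrightarrow> E u v"
    and D_total: "\<And>u v. E u v \<Longrightarrow> (u, v) \<in> D \<or> (v, u) \<in> D"
    and D_out: "\<And>u v w. (u, v) \<in> D \<Longrightarrow> (u, w) \<in> D \<Longrightarrow> v \<noteq> w \<Longrightarrow> E v w"
begin

lemma E_sym: "E u v \<Longrightarrow> E v u"
  using sym by (meson sympD)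

definition walk :: "'a set \<Rightarrow> 'a \<Rightarrow> 'a \<Rightarrow> bool" where
  "walk U = (\<lambda>u v. E u v \<and> v \<in> U)\<^sup>*\<^sup>*"

lemma walk_refl [simp]: "walk U u u"
  by (simp add: walk_def)

lemma walk_step: "walk U u v \<Longrightarrow> E v w \<Longrightarrow> w \<in> U \<Longrightarrow> walk U u w"
  unfolding walk_def by (simp add: rtranclp.rtrancl_into_rtrancl)

lemma walk_trans: "walk U u v \<Longrightarrow> walk U v w \<Longrightarrow> walk U u w"
  unfolding walk_def by (rule rtranclp_trans)

lemma walk_induct [consumes 1, case_names refl step]:
  assumes "walk U u v" "P u" "\<And>v w. walk U u v \<Longrightarrow> E v w \<Longrightarrow> w \<in> U \<Longrightarrow> P v \<Longrightarrow> P w"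
  shows "P v"
  using assms(1) unfolding walk_def
  by (induction rule: rtranclp_induct) (use assms(2,3) in \<open>auto simp: walk_def\<close>)

lemma walk_in: "walk U u v \<Longrightarrow> u \<in> U \<Longrightarrow> v \<in> U"
  by (induction rule: walk_induct) auto

lemma walk_sym:
  assumes "walk U u v" "u \<in> U"
  shows "walk U v u"
  using assms(1)
proof (induction rule: walk_induct)
  case (step v w)
  have "v \<in> U" using step.hyps(1) assms(2) walk_in by blast
  then have "walk U w v" using step.hyps E_sym by (intro walk_step[of U w w v]) auto
  then show ?case using step.IH walk_trans by blast
qed simp

lemma conn_iff_walk:
  "conn E U x y \<longleftrightarrow> x = y \<or> E x y \<or> (\<exists>u\<in>U. \<exists>w. E x u \<and> walk U u w \<and> E w y)"
proof
  assume "conn E U x y"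
  then show "x = y \<or> E x y \<or> (\<exists>u\<in>U. \<exists>w. E x u \<and> walk U u w \<and> E w y)"
    unfolding conn_def walk_def by (metis (mono_tags, lifting) converse_rtranclpE)
next
  assume "x = y \<or> E x y \<or> (\<exists>u\<in>U. \<exists>w. E x u \<and> walk U u w \<and> E w y)"
  then show "conn E U x y"
    unfolding conn_def walk_def by (metis (mono_tags, lifting) converse_rtranclp_into_rtranclp rtranclp.rtrancl_refl)
qed

text \<open>
  If neither \<open>x\<close> nor \<open>y\<close> had an out-neighbour in the component, their neighbourhoods there
  would be closed under out-arcs; but a nonempty such set is reachable from the whole component.
\<close>

lemma out_arc_into_component:
  assumes xy: "x \<notin> U" "y \<notin> U" "x \<noteq> y" "\<not> E x y"
    and u: "u \<in> U" "E x u" and w: "walk U u w" "E w y"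
  shows "\<exists>z. walk U u z \<and> ((x, z) \<in> D \<or> (y, z) \<in> D)"
proof (rule ccontr)
  assume no: "\<not> ?thesis"
  define C where "C = {z. walk U u z}"
  have CU: "C \<subseteq> U" using walk_in u(1) by (auto simp: C_def)
  have Ccl: "z' \<in> C" if "z \<in> C" "E z z'" "z' \<in> U" for z z'
    using that walk_step by (auto simp: C_def)
  \<comment> \<open>The vertex \<open>q\<close> has no out-arc into \<open>C\<close>, so the edge to
    \<open>z\<close> is directed towards \<open>q\<close>. Then \<open>q\<close> and
    \<open>z'\<close> are both out-neighbours of \<open>z\<close>.\<close>
  have closed: "E q z'" if q: "q = x \<or> q = y" and "z \<in> C" "E q z" "(z, z') \<in> D" "z' \<in> U" for q z z'
  proof -
    have "(z, q) \<in> D" using D_total[OF \<open>E q z\<close>] no q \<open>z \<in> C\<close> by (auto simp: C_def)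
    moreover have "z' \<noteq> q" using q xy \<open>z' \<in> U\<close> by auto
    ultimately show ?thesis using D_out[of z q z'] \<open>(z, z') \<in> D\<close> by blast
  qed
  let ?S = "\<lambda>u v. (u, v) \<in> D \<and> v \<in> U"
  \<comment> \<open>The property of having a directed walk within \<open>U\<close> to a neighbour of
    \<open>x\<close> in \<open>C\<close>. It passes along arcs in both directions and therefore
    spreads from \<open>u\<close> over the whole component.\<close>
  define reach where "reach z \<longleftrightarrow> (\<exists>a\<in>C. E x a \<and> ?S\<^sup>*\<^sup>* z a)" for z
  \<comment> \<open>An arc that leaves the directed walk at \<open>p\<close> ends in a vertex
    \<open>q\<close> adjacent or equal to the next vertex \<open>p1\<close>. An arc from
    \<open>q\<close> to \<open>p1\<close> rejoins the walk, and an arc from \<open>p1\<close> to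
    \<open>q\<close> leaves it one step later. At the end of the walk, \<open>closed\<close> makes
    \<open>q\<close> itself a neighbour of \<open>x\<close>.\<close>
  have fwd: "reach q" if "?S\<^sup>*\<^sup>* p a" "a \<in> C" "E x a" "(p, q) \<in> D" "q \<in> U" for p q a
    using that
  proof (induction arbitrary: q rule: converse_rtranclp_induct)
    case base
    then have "E x q" "q \<in> C" using closed[of x a q] Ccl[of a q] D_edge by blast+
    then show ?case unfolding reach_def by blast
  next
    case (step p p1)
    show ?case
    proof (cases "q = p1")
      case True
      then show ?thesis using step unfolding reach_def by blast
    next
      case False
      then have "E q p1" using D_out[of p q p1] step by blast
      then consider "(q, p1) \<in> D" | "(p1, q) \<in> D" using D_total by blast
      then show ?thesis
      proof cases
        case 1
        then have "?S\<^sup>*\<^sup>* q a" using step converse_rtranclp_into_rtranclp[of ?S q p1 a] by blast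
        then show ?thesis using step unfolding reach_def by blast
      next
        case 2
        then show ?thesis using step by blast
      qed
    qed
  qed
  have all: "reach z" if "walk U u z" for z
    using that
  proof (induction rule: walk_induct)
    case refl
    have "u \<in> C" by (simp add: C_def)
    then show ?case using u(2) unfolding reach_def by blast
  next
    case (step z z')
    have "z \<in> U" using step.hyps(1) u(1) walk_in by blast
    obtain a where a: "a \<in> C" "E x a" "?S\<^sup>*\<^sup>* z a" using step.IH unfolding reach_def by blast
    consider "(z, z') \<in> D" | "(z', z) \<in> D" using D_total step by blast
    then show ?case
    proof cases
      case 1
      then show ?thesis using fwd a step by blast
    next
      case 2
      then have "?S\<^sup>*\<^sup>* z' a" using a(3) \<open>z \<in> U\<close> converse_rtranclp_into_rtranclp[of ?S z' z a] by blast
      then show ?thesis using a unfolding reach_def by blast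
    qed
  qed
  obtain a where a: "a \<in> C" "E x a" "?S\<^sup>*\<^sup>* w a" using all[OF w(1)] unfolding reach_def by blast
  \<comment> \<open>Along the directed walk from \<open>w\<close> to \<open>a\<close>, adjacency to
    \<open>y\<close> is inherited by \<open>closed\<close>. The vertex \<open>a\<close> is then
    adjacent to both \<open>x\<close> and \<open>y\<close>, and both edges must leave
    \<open>a\<close>, which makes \<open>x\<close> and \<open>y\<close> adjacent.\<close>
  from a(3) have "a \<in> C \<and> E y a"
  proof (induction rule: rtranclp_induct)
    case base
    then show ?case using w E_sym by (auto simp: C_def)
  next
    case (step z z')
    then show ?case using closed[of y z z'] Ccl[of z z'] D_edge by blast
  qed
  then have "(a, x) \<in> D" "(a, y) \<in> D"
    using D_total[OF a(2)] D_total[of y a] no a(1) by (auto simp: C_def)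
  then show False using D_out xy by blast
qed

text \<open>The hypothesis \<open>notfull\<close> supplies, for each component outside the bag, the
  bag vertex through which the detour around it is led. The count leaves three independent vertices
  possible: their three pairs can be served by one vertex each.\<close>

lemma bag_no_independent_4:
  assumes pairs: "\<And>x y. x \<in> B \<Longrightarrow> y \<in> B \<Longrightarrow> conn E (- B) x y"
    and notfull: "\<And>u. u \<notin> B \<Longrightarrow> \<exists>p\<in>B. \<forall>z. walk (- B) u z \<longrightarrow> \<not> E z p"
    and in_B: "x1 \<in> B" "x2 \<in> B" "x3 \<in> B" "x4 \<in> B"
    and dist: "distinct [x1, x2, x3, x4]"
  shows "E x1 x2 \<or> E x1 x3 \<or> E x1 x4 \<or> E x2 x3 \<or> E x2 x4 \<or> E x3 x4"
proof (rule ccontr)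
  assume indep: "\<not> ?thesis"
  let ?U = "- B"
  define touch where "touch x u \<longleftrightarrow> (\<exists>z. walk ?U u z \<and> E z x)" for x u
  define tail where "tail x u \<longleftrightarrow> (\<exists>z. walk ?U u z \<and> (x, z) \<in> D)" for x u
  have F4: "tail x u \<or> tail y u"
    if h: "x \<in> B" "y \<in> B" "x \<noteq> y" "\<not> E x y" "u \<in> ?U" "touch x u" "touch y u" for x y u
  proof -
    obtain z w where z: "walk ?U u z" "E z x" and w: "walk ?U u w" "E w y"
      using h unfolding touch_def by blast
    have "z \<in> ?U" using walk_in[OF z(1)] h by blast
    moreover have "walk ?U z w" using walk_sym[OF z(1)] w(1) walk_trans h(5) by blast
    ultimately obtain t where "walk ?U z t" "(x, t) \<in> D \<or> (y, t) \<in> D"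
      using out_arc_into_component[of x ?U y z w] h z w E_sym by blast
    then show ?thesis using walk_trans[OF z(1)] unfolding tail_def by blast
  qed
  have F2: "walk ?U u u'" if h: "tail x u" "tail x u'" "u \<in> ?U" "u' \<in> ?U" for x u u'
  proof -
    obtain z z' where z: "walk ?U u z" "(x, z) \<in> D" and z': "walk ?U u' z'" "(x, z') \<in> D"
      using h unfolding tail_def by blast
    have "z' \<in> ?U" using walk_in[OF z'(1)] h by blast
    then have "walk ?U z z'" using D_out[OF z(2) z'(2)] walk_step[of ?U z z z'] by (cases "z = z'") auto
    then show ?thesis using z(1) walk_sym[OF z'(1) h(4)] walk_trans by blast
  qed
  \<comment> \<open>The rest of the bag joins \<open>x\<close> and \<open>y\<close> outside the component of \<open>u\<close> through a vertex \<open>p\<close> not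
    adjacent to it, so one of them would also have an out-neighbour on that side.\<close>
  have F3: "\<not> (tail x u \<and> tail y u)"
    if h: "x \<in> B" "y \<in> B" "x \<noteq> y" "\<not> E x y" "u \<in> ?U" "touch x u" "touch y u" for x y u
  proof
    assume tl: "tail x u \<and> tail y u"
    obtain p where p: "p \<in> B" "\<And>z. walk ?U u z \<Longrightarrow> \<not> E z p"
      using notfull[of u] \<open>u \<in> ?U\<close> by blast
    let ?W = "insert p {z \<in> ?U. \<not> walk ?U u z}"
    have off: "walk {z \<in> ?U. \<not> walk ?U u z} a b"
      if h: "walk ?U a b" "\<not> walk ?U u a" "a \<in> ?U" for a b
    proof -
      have "walk {z \<in> ?U. \<not> walk ?U u z} a b \<and> walk ?U a b"
        using h(1)
      proof (induction rule: walk_induct)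
        case (step b c)
        then have wac: "walk ?U a c" using walk_step by blast
        have "\<not> walk ?U u c"
        proof
          assume "walk ?U u c"
          then show False using walk_trans walk_sym[OF wac h(3)] h(2) by blast
        qed
        then have "walk {z \<in> ?U. \<not> walk ?U u z} a c"
          using step walk_step[of "{z \<in> ?U. \<not> walk ?U u z}" a b c] by blast
        then show ?case using wac by blast
      qed simp
      then show ?thesis ..
    qed
    \<comment> \<open>A connection that starts at \<open>p\<close> enters the outside of the bag in
      a component other than that of \<open>u\<close>, because \<open>p\<close> has no neighbour in
      the latter, and it cannot change components before it ends.\<close>
    have cp: "conn E {z \<in> ?U. \<not> walk ?U u z} p q" if h: "q \<in> B" for q
    proof -
      have "conn E ?U p q" using pairs p(1) h by blast
      then consider "p = q" | "E p q" | a b where "a \<in> ?U" "E p a" "walk ?U a b" "E b q"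
        unfolding conn_iff_walk by blast
      then show ?thesis
      proof cases
        case 3
        have "\<not> walk ?U u a" using p(2) 3(2) E_sym by blast
        then have "walk {z \<in> ?U. \<not> walk ?U u z} a b" using off 3 by blast
        then show ?thesis unfolding conn_iff_walk using 3 \<open>\<not> walk ?U u a\<close> by blast
      qed (auto intro: conn_edge)
    qed
    have px: "x \<noteq> p" "y \<noteq> p" using h p(2) unfolding touch_def by blast+
    have "conn E ?W x y"
      unfolding conn_insert using cp[OF \<open>x \<in> B\<close>] cp[OF \<open>y \<in> B\<close>] conn_sym[OF sym] by blast
    then obtain a b where ab: "a \<in> ?W" "E x a" "walk ?W a b" "E b y"
      unfolding conn_iff_walk using \<open>x \<noteq> y\<close> \<open>\<not> E x y\<close> by blast
    have "x \<notin> ?W" "y \<notin> ?W" using px h by auto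
    then obtain t where t: "walk ?W a t" "(x, t) \<in> D \<or> (y, t) \<in> D"
      using out_arc_into_component[of x ?W y a b] ab \<open>x \<noteq> y\<close> \<open>\<not> E x y\<close> by blast
    have tW: "t \<in> ?W" using walk_in[OF t(1) ab(1)] .
    obtain q where q: "q = x \<or> q = y" "(q, t) \<in> D" using t(2) by blast
    obtain d where d: "walk ?U u d" "(q, d) \<in> D" using tl q(1) unfolding tail_def by blast
    have "d \<in> ?U" using walk_in[OF d(1)] h by blast
    have "t \<noteq> d" using tW d(1) p \<open>d \<in> ?U\<close> by auto
    then have "E d t" using D_out[OF d(2) q(2)] by blast
    then show False using tW p(2)[OF d(1)] walk_step[OF d(1) \<open>E d t\<close>] by auto
  qed
  define T where "T x y \<longleftrightarrow> (\<exists>u\<in>?U. tail x u \<and> touch x u \<and> touch y u)" for x y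
  have T1: "T x y \<or> T y x" if h: "x \<in> B" "y \<in> B" "x \<noteq> y" "\<not> E x y" for x y
  proof -
    have "conn E ?U x y" using pairs h by blast
    then obtain u w where u: "u \<in> ?U" "E x u" "walk ?U u w" "E w y"
      unfolding conn_iff_walk using h by blast
    then have "touch x u" "touch y u" unfolding touch_def using E_sym walk_refl by blast+
    then show ?thesis using F4[of x y u] h u(1) unfolding T_def by blast
  qed
  \<comment> \<open>By \<open>F2\<close> the vertex \<open>x\<close> serves both pairs through one
    and the same component, which \<open>y\<close> and \<open>z\<close> then both touch. By
    \<open>F4\<close> one of these two has an out-arc into it as well, and together with
    \<open>x\<close> it violates \<open>F3\<close>.\<close>
  have T2: "\<not> (T x y \<and> T x z)"
    if h: "x \<in> B" "y \<in> B" "z \<in> B" "x \<noteq> y" "\<not> E x y" "x \<noteq> z" "\<not> E x z" "y \<noteq> z" "\<not> E y z" for x y z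
  proof
    assume "T x y \<and> T x z"
    then obtain u u' where u: "u \<in> ?U" "tail x u" "touch x u" "touch y u"
      and u': "u' \<in> ?U" "tail x u'" "touch z u'" unfolding T_def by blast
    have "walk ?U u u'" using F2 u u' by blast
    then have "touch z u" using u'(3) walk_trans unfolding touch_def by blast
    then have "tail y u \<or> tail z u" using F4[of y z u] h u by blast
    then show False using F3[of x y u] F3[of x z u] h u \<open>touch z u\<close> by blast
  qed
  have ne: "x1 \<noteq> x2" "x1 \<noteq> x3" "x1 \<noteq> x4" "x2 \<noteq> x3" "x2 \<noteq> x4" "x3 \<noteq> x4"
    using dist by auto
  have ind: "\<not> E x1 x2" "\<not> E x1 x3" "\<not> E x1 x4" "\<not> E x2 x3" "\<not> E x2 x4" "\<not> E x3 x4"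
    "\<not> E x2 x1" "\<not> E x3 x1" "\<not> E x4 x1" "\<not> E x3 x2" "\<not> E x4 x2" "\<not> E x4 x3"
    using indep E_sym by blast+
  note [simp] = in_B ne ne[symmetric] ind
  have "T x1 x2 \<or> T x2 x1" "T x1 x3 \<or> T x3 x1" "T x1 x4 \<or> T x4 x1"
    "T x2 x3 \<or> T x3 x2" "T x2 x4 \<or> T x4 x2" "T x3 x4 \<or> T x4 x3"
    by (rule T1; simp)+
  moreover have "\<not> (T x1 x2 \<and> T x1 x3)" "\<not> (T x1 x2 \<and> T x1 x4)" "\<not> (T x1 x3 \<and> T x1 x4)"
    "\<not> (T x2 x1 \<and> T x2 x3)" "\<not> (T x2 x1 \<and> T x2 x4)" "\<not> (T x2 x3 \<and> T x2 x4)"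
    "\<not> (T x3 x1 \<and> T x3 x2)" "\<not> (T x3 x1 \<and> T x3 x4)" "\<not> (T x3 x2 \<and> T x3 x4)"
    "\<not> (T x4 x1 \<and> T x4 x2)" "\<not> (T x4 x1 \<and> T x4 x3)" "\<not> (T x4 x2 \<and> T x4 x3)"
    by (rule T2; simp)+
  ultimately show False by argo
qed

end

section \<open>Bags along an elimination order\<close>

definition bag :: "(nat \<Rightarrow> nat \<Rightarrow> bool) \<Rightarrow> nat \<Rightarrow> (nat \<Rightarrow> nat) \<Rightarrow> nat \<Rightarrow> nat set" where
  "bag E n \<sigma> j = {x. x < n \<and> x \<notin> \<sigma> ` {..<j} \<and> conn E (\<sigma> ` {..<j}) (\<sigma> j) x}"

text \<open>Interior vertices may be eliminated or remaining ones, as long as they lie outside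
  \<open>B\<close>. For the bag of \<open>v\<close> this corresponds to \<open>v\<close> being an
  avoidable vertex of the filled graph.\<close>

definition avoidable :: "(nat \<Rightarrow> nat \<Rightarrow> bool) \<Rightarrow> nat set \<Rightarrow> bool" where
  "avoidable E B \<longleftrightarrow> (\<forall>x\<in>B. \<forall>y\<in>B. conn E (- B) x y)"

locale elim_order = one_po E D for E :: "nat \<Rightarrow> nat \<Rightarrow> bool" and D +
  fixes n :: nat and \<sigma> :: "nat \<Rightarrow> nat"
  assumes E_less: "\<And>u v. E u v \<Longrightarrow> u < n \<and> v < n"
    and bij: "bij_betw \<sigma> {..<n} {..<n}"
    and avoid: "\<And>j. j < n \<Longrightarrow> avoidable E (bag E n \<sigma> j)"
begin

lemma \<sigma>_less: "j < n \<Longrightarrow> \<sigma> j < n"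
  using bij by (auto simp: bij_betw_def)

lemma \<sigma>_inj: "i < n \<Longrightarrow> j < n \<Longrightarrow> \<sigma> i = \<sigma> j \<longleftrightarrow> i = j"
  using bij by (auto simp: bij_betw_def inj_on_def)

lemma \<sigma>_surj: "x < n \<Longrightarrow> \<exists>j<n. \<sigma> j = x"
  using bij_betw_imp_surj_on[OF bij] by (metis imageE lessThan_iff)

lemma self_in_bag: "j < n \<Longrightarrow> \<sigma> j \<in> bag E n \<sigma> j"
  using \<sigma>_less \<sigma>_inj by (fastforce simp: bag_def)

text \<open>
  A component that is full for a bag consists of eliminated vertices, so the bag is contained in
  the bag of the last of them.
\<close>

lemma bag_independent:
  assumes "j < n" "x1 \<in> bag E n \<sigma> j" "x2 \<in> bag E n \<sigma> j" "x3 \<in> bag E n \<sigma> j" "x4 \<in> bag E n \<sigma> j"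
    and dist: "distinct [x1, x2, x3, x4]"
  shows "E x1 x2 \<or> E x1 x3 \<or> E x1 x4 \<or> E x2 x3 \<or> E x2 x4 \<or> E x3 x4"
  using assms(1-5)
proof (induction j rule: less_induct)
  case (less j)
  define B where "B = bag E n \<sigma> j"
  define L where "L = \<sigma> ` {..<j}"
  show ?case
  proof (cases "\<forall>u. u \<notin> B \<longrightarrow> (\<exists>p\<in>B. \<forall>z. walk (- B) u z \<longrightarrow> \<not> E z p)")
    case True
    have "conn E (- B) x y" if "x \<in> B" "y \<in> B" for x y
      using avoid[OF \<open>j < n\<close>] that by (auto simp: avoidable_def B_def)
    then show ?thesis
      using bag_no_independent_4[of B x1 x2 x3 x4] True less.prems dist
      unfolding B_def[symmetric] by blast
  next
    case False
    then obtain u where u: "u \<notin> B" "\<And>p. p \<in> B \<Longrightarrow> \<exists>z. walk (- B) u z \<and> E z p" by blast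
    have "\<sigma> j \<in> B" using self_in_bag \<open>j < n\<close> by (simp add: B_def)
    then obtain z where z: "walk (- B) u z" "E z (\<sigma> j)" using u by blast
    have B_mem: "x \<in> B" if "conn E L (\<sigma> j) x" "x \<notin> L" "x < n" for x
      using that by (simp add: B_def bag_def L_def)
    have zB: "z \<notin> B" using walk_in[OF z(1)] u(1) by simp
    have "z \<in> L" using B_mem[of z] zB z(2) E_sym conn_edge[of E] E_less by blast
    \<comment> \<open>The component is explored from \<open>z\<close>: each new vertex is reached
      from the current one, and if it had not been eliminated yet, it would belong to the
      bag.\<close>
    have CL: "c \<in> L \<and> conn E L (\<sigma> j) c" if "walk (- B) z c" for c
      using that
    proof (induction rule: walk_induct)
      case refl
      then show ?case using \<open>z \<in> L\<close> z(2) E_sym conn_edge[of E] by blast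
    next
      case (step a b)
      have "conn E L (\<sigma> j) b" using step conn_trans[of E L _ a b] conn_edge[of E] by blast
      then show ?case using B_mem[of b] step E_less by blast
    qed
    define I where "I = {i. i < j \<and> walk (- B) z (\<sigma> i)}"
    have finI: "finite I" by (simp add: I_def)
    have "I \<noteq> {}" using \<open>z \<in> L\<close> by (auto simp: I_def L_def)
    define e where "e = Max I"
    have e: "e < j" "walk (- B) z (\<sigma> e)" using Max_in[OF finI \<open>I \<noteq> {}\<close>] by (auto simp: e_def I_def)
    have Le: "c \<in> \<sigma> ` {..<e} \<or> c = \<sigma> e" if h: "walk (- B) z c" for c
    proof -
      obtain i where i: "i < j" "c = \<sigma> i" using CL[OF h] by (auto simp: L_def)
      then have "i \<le> e" using Max_ge[OF finI, of i] h by (simp add: I_def e_def)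
      then show ?thesis using i by (cases "i = e") auto
    qed
    have conn_e: "conn E (\<sigma> ` {..<e}) (\<sigma> e) c" if "walk (- B) (\<sigma> e) c" for c
    proof -
      have "conn E (\<sigma> ` {..<e}) (\<sigma> e) c \<and> walk (- B) z c"
        using that
      proof (induction rule: walk_induct)
        case (step a b)
        then have "walk (- B) z b" using walk_step by blast
        moreover have "conn E (\<sigma> ` {..<e}) (\<sigma> e) b"
          using step Le[of a] conn_trans[of E _ "\<sigma> e" a b] conn_edge[of E] by blast
        ultimately show ?case by blast
      qed (use e in simp)
      then show ?thesis ..
    qed
    \<comment> \<open>Apart from \<open>\<sigma> e\<close>, all vertices of the component are
      eliminated before step \<open>e\<close>. So \<open>\<sigma> e\<close> reaches everything
      adjacent to the component, in particular all of \<open>B\<close>.\<close>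
    have "B \<subseteq> bag E n \<sigma> e"
    proof
      fix p assume p: "p \<in> B"
      obtain c where c: "walk (- B) u c" "E c p" using u(2)[OF p] by blast
      have zu: "walk (- B) z u" using walk_sym[OF z(1)] u(1) by simp
      have zc: "walk (- B) z c" using walk_trans[OF zu c(1)] .
      have ez: "walk (- B) (\<sigma> e) z" using walk_sym[OF e(2)] zB by simp
      have "conn E (\<sigma> ` {..<e}) (\<sigma> e) c" using conn_e walk_trans[OF ez zc] by blast
      then have "conn E (\<sigma> ` {..<e}) (\<sigma> e) p"
        using Le[OF zc] c(2) conn_trans[of E _ "\<sigma> e" c p] conn_edge[of E] by blast
      moreover have "\<sigma> ` {..<e} \<subseteq> \<sigma> ` {..<j}" using e(1) by (intro image_mono) simp
      ultimately show "p \<in> bag E n \<sigma> e" using p by (auto simp: B_def bag_def)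
    qed
    then show ?thesis using less.IH[of e] e(1) less.prems by (auto simp: B_def)
  qed
qed

end

text \<open>All that the dynamic program uses of the order. \<open>M v x\<close> stands for
  membership of \<open>x\<close> in the bag of \<open>v\<close>, and \<open>pos\<close> for the
  position in the order. \<open>M_par\<close> is the running intersection property: the bag of
  \<open>x\<close> without \<open>x\<close> is contained in the bag of its parent.
  \<open>M_indep\<close> is stated for sets containing \<open>v\<close> because it is applied when
  \<open>v\<close> looks for a free slot.\<close>

locale elim_forest =
  fixes E M :: "nat \<Rightarrow> nat \<Rightarrow> bool" and n :: nat and pos par :: "nat \<Rightarrow> nat"
  assumes E_sym: "\<And>u v. E u v \<Longrightarrow> E v u"
    and E_irrefl: "\<And>u. \<not> E u u"
    and E_less: "\<And>u v. E u v \<Longrightarrow> u < n \<and> v < n"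
    and M_less: "\<And>u v. M u v \<Longrightarrow> u < n \<and> v < n"
    and M_pos: "\<And>u v. M u v \<Longrightarrow> pos u \<le> pos v"
    and E_M: "\<And>u v. E u v \<Longrightarrow> pos u \<le> pos v \<Longrightarrow> M u v"
    and M_par: "\<And>x z. M x z \<Longrightarrow> x \<noteq> z \<Longrightarrow> \<exists>y. par x = Suc y \<and> M y z"
    and par_less: "\<And>x y. x < n \<Longrightarrow> par x = Suc y \<Longrightarrow> y < n \<and> pos x < pos y"
    and M_indep: "\<And>v a b c. M v a \<Longrightarrow> M v b \<Longrightarrow> M v c \<Longrightarrow> distinct [v, a, b, c] \<Longrightarrow>
      E v a \<or> E v b \<or> E v c \<or> E a b \<or> E a c \<or> E b c"
begin

section \<open>Subtrees of the elimination forest and the edges between them\<close>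

definition desc :: "nat \<Rightarrow> nat \<Rightarrow> bool" where
  "desc = (\<lambda>a b. a < n \<and> par a = Suc b)\<^sup>*\<^sup>*"

definition sub :: "nat \<Rightarrow> nat set" where
  "sub v = {x. x < n \<and> desc x v}"

definition ch :: "nat \<Rightarrow> nat set" where
  "ch p = {x. x < n \<and> par x = p}"

lemma desc_pos: "desc x v \<Longrightarrow> pos x \<le> pos v"
  unfolding desc_def
proof (induction rule: rtranclp_induct)
  case (step y z)
  then show ?case using par_less[of y z] by simp
qed simp

lemma desc_step: "desc y v \<Longrightarrow> x < n \<Longrightarrow> par x = Suc y \<Longrightarrow> desc x v"
  using converse_rtranclp_into_rtranclp[of "\<lambda>a b. a < n \<and> par a = Suc b" x y v]
  by (simp add: desc_def)

lemma desc_into: "desc x y \<Longrightarrow> y < n \<Longrightarrow> par y = Suc z \<Longrightarrow> desc x z"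
  using rtranclp.rtrancl_into_rtrancl[of "\<lambda>a b. a < n \<and> par a = Suc b" x y z]
  by (simp add: desc_def)

lemma desc_refl [simp]: "desc x x"
  by (simp add: desc_def)

lemma desc_trans: "desc x y \<Longrightarrow> desc y z \<Longrightarrow> desc x z"
  unfolding desc_def by (rule rtranclp_trans)

lemma desc_cases: "desc x v \<Longrightarrow> x = v \<or> (\<exists>y. x < n \<and> par x = Suc y \<and> desc y v)"
  unfolding desc_def by (metis (mono_tags, lifting) converse_rtranclpE)

lemma desc_cases_last: "desc x v \<Longrightarrow> x = v \<or> (\<exists>c\<in>ch (Suc v). desc x c)"
  unfolding desc_def ch_def by (metis (mono_tags, lifting) mem_Collect_eq rtranclp.cases)

lemma M_desc: "M x z \<Longrightarrow> desc x z"
proof (induction "pos z - pos x" arbitrary: x rule: less_induct)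
  case less
  show ?case
  proof (cases "x = z")
    case False
    then obtain y where y: "par x = Suc y" "M y z" using M_par less.prems by blast
    have x: "x < n" using M_less less.prems by blast
    then have "pos x < pos y" using par_less y by blast
    moreover have "pos y \<le> pos z" using M_pos y by blast
    ultimately have "desc y z" using less.hyps[of y] y by simp
    then show ?thesis using desc_step x y by blast
  qed simp
qed

text \<open>On the way up from \<open>x\<close> to \<open>v\<close>, \<open>M_par\<close> carries
  \<open>z\<close> from bag to bag; it could get stuck only at \<open>z\<close> itself, which does
  not lie on this way.\<close>

lemma M_desc_mono:
  assumes "desc x v" "M x z" "\<not> desc z v"
  shows "M v z"
  using assms
  unfolding desc_def
proof (induction rule: converse_rtranclp_induct)
  case (step x y)
  have "x \<noteq> z" using step by (metis (mono_tags, lifting) converse_rtranclp_into_rtranclp)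
  then show ?case using M_par[OF step.prems(1)] step by auto
qed

text \<open>If \<open>z\<close> preceded \<open>x\<close>, it would be a descendant of
  \<open>x\<close> and hence inside the subtree; so \<open>z\<close> is in the bag of
  \<open>x\<close> and travels up to that of \<open>v\<close>. This separation property justifies
  forgetting a chosen vertex outside the bag.\<close>

lemma edge_leaving:
  assumes "x \<in> sub v" "E x z" "z \<notin> sub v"
  shows "M v z"
proof -
  have z: "z < n" "\<not> desc z v" "desc x v" using assms E_less by (auto simp: sub_def)
  show ?thesis
  proof (cases "pos x \<le> pos z")
    case True
    then show ?thesis using M_desc_mono E_M assms(2) z by blast
  next
    case False
    then have "desc z x" using M_desc[OF E_M] E_sym assms(2) by simp
    then show ?thesis using desc_trans z by blast
  qed
qed

lemma desc_linear:
  assumes "desc x a" "desc x b"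
  shows "desc a b \<or> desc b a"
  using assms(1) unfolding desc_def[THEN fun_cong, THEN fun_cong, of x a]
proof (induction rule: rtranclp_induct)
  case base
  then show ?case using assms(2) by simp
next
  case (step y z)
  then consider "desc y b" | "desc b y" by (auto simp: desc_def)
  then show ?case
  proof cases
    case 1
    then show ?thesis using desc_cases[OF 1] step.hyps(2) desc_into[of b b z] by auto
  next
    case 2
    then show ?thesis using desc_into step.hyps(2) by blast
  qed
qed

text \<open>Every edge joins a vertex to one of its ancestors, the ancestors of a vertex form a
  chain, and siblings are incomparable.\<close>

lemma ch_sub_disjoint:
  assumes "a \<in> ch p" "b \<in> ch p" "a \<noteq> b" "x \<in> sub a" "y \<in> sub b"
  shows "x \<noteq> y" "\<not> E x y"
proof -
  have no: "\<not> desc c d" if h: "c \<in> ch p" "d \<in> ch p" "c \<noteq> d" for c d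
  proof
    assume "desc c d"
    then obtain z where "par c = Suc z" "desc z d" using desc_cases h(3) by blast
    then have "par d = Suc z" "pos z \<le> pos d" using h desc_pos by (auto simp: ch_def)
    then show False using par_less[of d z] h by (auto simp: ch_def)
  qed
  have sep: "\<not> desc z c \<or> \<not> desc z d" if "c \<in> ch p" "d \<in> ch p" "c \<noteq> d" for c d z
    using desc_linear no that by blast
  then show "x \<noteq> y" using assms by (auto simp: sub_def)
  have key: False if "c \<in> ch p" "d \<in> ch p" "c \<noteq> d" "x \<in> sub c" "y \<in> sub d" "E x y" "pos x \<le> pos y" for c d x y
  proof -
    have "desc x y" using M_desc E_M that by blast
    then show False using sep[of c d x] desc_trans that by (auto simp: sub_def)
  qed
  show "\<not> E x y"
    using key[of a b x y] key[of b a y x] assms E_sym by (metis nat_le_linear)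
qed

lemma sub_eq:
  assumes "v < n"
  shows "sub v = insert v (\<Union>c\<in>ch (Suc v). sub c)"
proof (intro equalityI subsetI)
  fix x assume "x \<in> sub v"
  then show "x \<in> insert v (\<Union>c\<in>ch (Suc v). sub c)"
    using desc_cases_last[of x v] by (auto simp: sub_def)
next
  fix x assume "x \<in> insert v (\<Union>c\<in>ch (Suc v). sub c)"
  then show "x \<in> sub v"
    using desc_into[of x _ v] assms by (auto simp: sub_def ch_def)
qed

lemma sub_ch_less: "c \<in> ch (Suc v) \<Longrightarrow> x \<in> sub c \<Longrightarrow> pos x < pos v"
  using par_less[of c v] desc_pos[of x c] by (auto simp: sub_def ch_def)

lemma root_exists: "x < n \<Longrightarrow> \<exists>r\<in>ch 0. x \<in> sub r"
\<comment> \<open>The sum serves merely as a common upper bound of all positions, which makes the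
  difference decrease on the way to the root.\<close>
proof (induction "(\<Sum>i<n. pos i) - pos x" arbitrary: x rule: less_induct)
  case less
  show ?case
  proof (cases "par x")
    case 0
    then show ?thesis using less.prems by (auto simp: ch_def sub_def)
  next
    case (Suc y)
    then have y: "y < n" "pos x < pos y" using par_less less.prems by auto
    have "pos y \<le> (\<Sum>i<n. pos i)" using y by (intro member_le_sum) auto
    then have "(\<Sum>i<n. pos i) - pos y < (\<Sum>i<n. pos i) - pos x" using y by simp
    then obtain r where "r \<in> ch 0" "y \<in> sub r" using less.hyps[of y] y by blast
    then show ?thesis using desc_step[of y r x] Suc less.prems by (auto simp: sub_def)
  qed
qed

lemma finite_sub [simp]: "finite (sub v)"
  by (simp add: sub_def)

lemma finite_ch [simp]: "finite (ch p)"
  by (simp add: ch_def)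

lemma sum_ch:
  fixes w :: "nat \<Rightarrow> 'b::comm_monoid_add"
  assumes "T \<subseteq> (\<Union>c\<in>ch p. sub c)"
  shows "sum w T = (\<Sum>c\<in>ch p. sum w (T \<inter> sub c))"
proof -
  have "T = (\<Union>c\<in>ch p. T \<inter> sub c)" using assms by blast
  then have "sum w T = sum w (\<Union>c\<in>ch p. T \<inter> sub c)" by simp
  also have "\<dots> = (\<Sum>c\<in>ch p. sum w (T \<inter> sub c))"
  proof (rule sum.UNION_disjoint)
    show "\<forall>c\<in>ch p. finite (T \<inter> sub c)" by simp
    show "\<forall>a\<in>ch p. \<forall>b\<in>ch p. a \<noteq> b \<longrightarrow> T \<inter> sub a \<inter> (T \<inter> sub b) = {}"
      using ch_sub_disjoint(1) by fast
  qed simp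
  finally show ?thesis .
qed

lemma sum_sub:
  fixes w :: "nat \<Rightarrow> 'b::comm_monoid_add"
  assumes "v < n" "T \<subseteq> sub v"
  shows "sum w T = (if v \<in> T then w v else 0) + (\<Sum>c\<in>ch (Suc v). sum w (T \<inter> sub c))"
proof -
  have v: "v \<notin> sub c" if "c \<in> ch (Suc v)" for c using sub_ch_less[OF that] by blast
  have "T - {v} \<subseteq> (\<Union>c\<in>ch (Suc v). sub c)" using sub_eq assms by auto
  then have "sum w (T - {v}) = (\<Sum>c\<in>ch (Suc v). sum w ((T - {v}) \<inter> sub c))" by (rule sum_ch)
  also have "\<dots> = (\<Sum>c\<in>ch (Suc v). sum w (T \<inter> sub c))"
    using v by (intro sum.cong refl arg_cong[of _ _ "sum w"]) blast
  finally have e: "sum w (T - {v}) = (\<Sum>c\<in>ch (Suc v). sum w (T \<inter> sub c))" .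
  have "finite T" using assms finite_sub finite_subset by blast
  then show ?thesis using e by (cases "v \<in> T") (simp_all add: sum.remove)
qed

end

text \<open>
  A triple lists the chosen vertices that may still matter. When \<open>v\<close> is chosen, it replaces an entry
  outside its bag, which has no neighbour at or below \<open>v\<close>; bags having independence number at most
  \<open>3\<close>, there is always one.
\<close>

definition put_slot ::
  "(nat \<Rightarrow> nat \<Rightarrow> bool) \<Rightarrow> (nat \<Rightarrow> nat \<Rightarrow> bool) \<Rightarrow> nat \<Rightarrow> nat \<times> nat \<times> nat \<Rightarrow> (nat \<times> nat \<times> nat) option" where
  "put_slot E M v = (\<lambda>(a, b, c).
     if E v a \<or> E v b \<or> E v c then None
     else if \<not> M v a then Some (v, b, c)
     else if \<not> M v b then Some (a, v, c)
     else if \<not> M v c then Some (a, b, v)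
     else None)"

text \<open>The Bellman equation of a single entry, kept as a predicate because the arrays of the
  program are known only to satisfy such equations. The intended meaning of \<open>f v t\<close> is
  the largest weight of an independent set in the subtree of \<open>v\<close> without neighbours in
  \<open>t\<close>. \<open>off\<close> and \<open>on\<close> are the values without and with
  \<open>v\<close>, and \<open>d\<close> records the decision, a tie leaving \<open>v\<close>
  out.\<close>

definition table_eq ::
  "(nat \<Rightarrow> nat \<Rightarrow> bool) \<Rightarrow> (nat \<Rightarrow> nat \<Rightarrow> bool) \<Rightarrow> (nat \<Rightarrow> nat set) \<Rightarrow> (nat \<Rightarrow> rat) \<Rightarrow>
   (nat \<Rightarrow> nat \<times> nat \<times> nat \<Rightarrow> rat) \<Rightarrow> (nat \<Rightarrow> nat \<times> nat \<times> nat \<Rightarrow> bool) \<Rightarrow>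
   nat \<Rightarrow> nat \<times> nat \<times> nat \<Rightarrow> bool" where
  "table_eq E M ch w f d v t \<longleftrightarrow>
     (let off = (\<Sum>c\<in>ch (Suc v). f c t) in
      case put_slot E M v t of
        None \<Rightarrow> \<not> d v t \<and> f v t = off
      | Some t' \<Rightarrow> let on = w v + (\<Sum>c\<in>ch (Suc v). f c t') in
          (d v t \<longleftrightarrow> off < on) \<and> f v t = (if off < on then on else off))"

context elim_forest
begin

section \<open>Correctness of the recurrence over triples\<close>

definition indep :: "nat set \<Rightarrow> bool" where
  "indep T \<longleftrightarrow> (\<forall>x\<in>T. \<forall>y\<in>T. \<not> E x y)"

fun avoids :: "nat \<times> nat \<times> nat \<Rightarrow> nat set \<Rightarrow> bool" where
  "avoids (a, b, c) T \<longleftrightarrow> (\<forall>x\<in>T. \<not> E x a \<and> \<not> E x b \<and> \<not> E x c)"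

text \<open>The index \<open>n\<close> marks an unused component of a triple.\<close>

fun valid :: "nat \<Rightarrow> nat \<times> nat \<times> nat \<Rightarrow> bool" where
  "valid v (a, b, c) \<longleftrightarrow> a \<le> n \<and> b \<le> n \<and> c \<le> n \<and>
     a \<notin> sub v \<and> b \<notin> sub v \<and> c \<notin> sub v \<and>
     (a = b \<longrightarrow> a = n) \<and> (a = c \<longrightarrow> a = n) \<and> (b = c \<longrightarrow> b = n) \<and>
     \<not> E a b \<and> \<not> E a c \<and> \<not> E b c"

lemma sub_mono: "c \<in> ch (Suc v) \<Longrightarrow> v < n \<Longrightarrow> sub c \<subseteq> sub v"
  using sub_eq by blast

lemma valid_ch: "valid v t \<Longrightarrow> v < n \<Longrightarrow> c \<in> ch (Suc v) \<Longrightarrow> valid c t"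
  using sub_mono[of c v] by (cases t) auto

lemma self_sub: "v < n \<Longrightarrow> v \<in> sub v"
  by (simp add: sub_def)

lemma put_slot_valid:
  assumes "valid v t" "v < n" "c \<in> ch (Suc v)" "put_slot E M v t = Some t'"
  shows "valid c t'"
proof -
  have v: "v \<notin> sub c" using sub_ch_less[OF assms(3)] by blast
  have "valid c t" using valid_ch assms by blast
  then show ?thesis
    using assms(1,2,4) v self_sub[OF assms(2)] E_sym
    by (cases t) (auto simp: put_slot_def split: if_splits)
qed

lemma put_slot_total:
  assumes "valid v (a, b, c)" "v < n" "\<not> E v a" "\<not> E v b" "\<not> E v c"
  shows "put_slot E M v (a, b, c) \<noteq> None"
proof
  assume "put_slot E M v (a, b, c) = None"
  then have M: "M v a" "M v b" "M v c" using assms by (auto simp: put_slot_def split: if_splits)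
  moreover have "distinct [v, a, b, c]" using assms M_less[OF M(1)] M_less[OF M(2)] self_sub[OF assms(2)] by auto
  ultimately show False using M_indep[OF M] assms by auto
qed

context
  fixes w :: "nat \<Rightarrow> rat" and f :: "nat \<Rightarrow> nat \<times> nat \<times> nat \<Rightarrow> rat"
    and d :: "nat \<Rightarrow> nat \<times> nat \<times> nat \<Rightarrow> bool"
  assumes eq: "\<And>v a b c. v < n \<Longrightarrow> a \<le> n \<Longrightarrow> b \<le> n \<Longrightarrow> c \<le> n \<Longrightarrow> table_eq E M ch w f d v (a, b, c)"
begin

lemma valid_eq: "v < n \<Longrightarrow> valid v t \<Longrightarrow> table_eq E M ch w f d v t"
  by (cases t) (auto intro!: eq)

text \<open>Replacing an entry only weakens what the children have to avoid, and the new entry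
  \<open>v\<close> is avoided because \<open>T\<close> is independent. Validity of the triple
  guarantees a slot whenever \<open>v\<close> belongs to \<open>T\<close>.\<close>

lemma table_upper:
  assumes "v < n" "valid v t" "T \<subseteq> sub v" "indep T" "avoids t T"
  shows "sum w T \<le> f v t"
  using assms
proof (induction "pos v" arbitrary: v t T rule: less_induct)
  case less
  obtain a b c where t: "t = (a, b, c)" by (cases t) auto
  have chn: "x < n \<and> pos x < pos v" if "x \<in> ch (Suc v)" for x
    using that par_less by (auto simp: ch_def)
  have te: "table_eq E M ch w f d v t" using valid_eq less.prems by blast
  have ind: "sum w (T \<inter> sub x) \<le> f x t'"
    if "x \<in> ch (Suc v)" "valid x t'" "avoids t' (T \<inter> sub x)" for x t'
    using less.hyps[of x t' "T \<inter> sub x"] chn that less.prems by (auto simp: indep_def)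
  show ?case
  proof (cases "v \<in> T")
    case False
    have "sum w T = (\<Sum>x\<in>ch (Suc v). sum w (T \<inter> sub x))"
      using sum_sub[of v T w] less.prems False by simp
    also have "\<dots> \<le> (\<Sum>x\<in>ch (Suc v). f x t)"
    proof (rule sum_mono)
      fix x assume x: "x \<in> ch (Suc v)"
      have "avoids t (T \<inter> sub x)" using less.prems(5) t by simp
      then show "sum w (T \<inter> sub x) \<le> f x t" using ind[OF x valid_ch[OF less.prems(2,1) x]] by blast
    qed
    also have "\<dots> \<le> f v t"
      using te by (auto simp: table_eq_def Let_def split: option.splits if_splits)
    finally show ?thesis .
  next
    case True
    have nE: "\<not> E v a" "\<not> E v b" "\<not> E v c" using less.prems(5) True t by auto
    then obtain t' where t': "put_slot E M v t = Some t'"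
      using put_slot_total[of v a b c] less.prems t by auto
    have av: "avoids t' (T \<inter> sub x)" for x
      using t' t less.prems(4,5) True
      by (auto simp: put_slot_def indep_def split: if_splits)
    have "sum w T = w v + (\<Sum>x\<in>ch (Suc v). sum w (T \<inter> sub x))"
      using sum_sub[of v T w] less.prems True by simp
    also have "\<dots> \<le> w v + (\<Sum>x\<in>ch (Suc v). f x t')"
      using ind[OF _ put_slot_valid[OF less.prems(2,1) _ t'] av] by (intro add_left_mono sum_mono) blast
    also have "\<dots> \<le> f v t"
      using te t' by (auto simp: table_eq_def Let_def)
    finally show ?thesis .
  qed
qed

text \<open>The decisions \<open>d\<close> are followed from the top, \<open>st v\<close> being the
  triple handed to \<open>v\<close>. In this direction the forgotten entry needs an argument: it is
  outside both the bag and the subtree of \<open>v\<close>, so by \<open>edge_leaving\<close>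
  nothing below \<open>v\<close> is adjacent to it.\<close>

lemma solution_attains:
  assumes out: "\<And>v. v < n \<Longrightarrow> v \<in> S \<longleftrightarrow> d v (st v)"
    and st: "\<And>v x. v < n \<Longrightarrow> x \<in> ch (Suc v) \<Longrightarrow>
      st x = (if d v (st v) then the (put_slot E M v (st v)) else st v)"
  assumes "v < n" "valid v (st v)"
  shows "indep (S \<inter> sub v) \<and> avoids (st v) (S \<inter> sub v) \<and> sum w (S \<inter> sub v) = f v (st v)"
  using assms(3,4)
proof (induction "pos v" arbitrary: v rule: less_induct)
  case less
  obtain a b c where t: "st v = (a, b, c)" by (cases "st v") auto
  have chn: "x < n \<and> pos x < pos v" if "x \<in> ch (Suc v)" for x
    using that par_less by (auto simp: ch_def)
  have te: "table_eq E M ch w f d v (st v)" using valid_eq less.prems by blast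
  let ?T = "\<lambda>x. S \<inter> sub x"
  have split: "?T v \<inter> sub x = ?T x" if "x \<in> ch (Suc v)" for x
    using sub_mono[OF that] less.prems by blast
  have sumv: "sum w (?T v) = (if v \<in> S then w v else 0) + (\<Sum>x\<in>ch (Suc v). sum w (?T x))"
    using sum_sub[of v "?T v" w] less.prems split self_sub by simp
  show ?case
  proof (cases "d v (st v)")
    case False
    have ih: "indep (?T x)" "avoids (st v) (?T x)" "sum w (?T x) = f x (st v)" if "x \<in> ch (Suc v)" for x
      using less.hyps[of x] chn[OF that] st[OF less.prems(1) that] False valid_ch[OF less.prems(2,1) that] by auto
    have vS: "v \<notin> S" using out less.prems False by blast
    have T: "?T v = (\<Union>x\<in>ch (Suc v). ?T x)" using sub_eq[OF less.prems(1)] vS by auto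
    have "indep (?T v)"
      unfolding indep_def
    proof (intro ballI)
      fix x y assume "x \<in> ?T v" "y \<in> ?T v"
      then obtain p q where pq: "p \<in> ch (Suc v)" "q \<in> ch (Suc v)" "x \<in> ?T p" "y \<in> ?T q" using T by blast
      then show "\<not> E x y"
        using ih(1)[OF pq(1)] ch_sub_disjoint(2)[of p _ q x y] by (cases "p = q") (auto simp: indep_def)
    qed
    moreover have "avoids (st v) (?T v)" using ih(2) unfolding T t by auto
    moreover have "sum w (?T v) = f v (st v)"
      using sumv vS ih(3) te False by (auto simp: table_eq_def Let_def split: option.splits if_splits)
    ultimately show ?thesis by blast
  next
    case True
    then obtain t' where t': "put_slot E M v (st v) = Some t'"
      using te by (auto simp: table_eq_def Let_def split: option.splits)
    have ih: "indep (?T x)" "avoids t' (?T x)" "sum w (?T x) = f x t'" if "x \<in> ch (Suc v)" for x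
      using less.hyps[of x] chn[OF that] st[OF less.prems(1) that] True t' put_slot_valid[OF less.prems(2,1) that t'] by auto
    have vS: "v \<in> S" using out less.prems True by blast
    have T: "?T v = insert v (\<Union>x\<in>ch (Suc v). ?T x)" using sub_eq[OF less.prems(1)] vS by auto
    have far: "\<not> E x z" if "x \<in> ?T v" "\<not> M v z" "z = a \<or> z = b \<or> z = c" for x z
      using edge_leaving[of x v z] that less.prems(2) t by auto
    have xv: "\<not> E x v" if "x \<in> ?T p" "p \<in> ch (Suc v)" for x p
      using ih(2)[OF that(2)] that(1) t' t by (auto simp: put_slot_def split: if_splits)
    have "indep (?T v)"
      unfolding indep_def
    proof (intro ballI)
      fix x y assume "x \<in> ?T v" "y \<in> ?T v"
      then consider "x = v" "y = v" | p where "x = v" "p \<in> ch (Suc v)" "y \<in> ?T p"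
        | p where "y = v" "p \<in> ch (Suc v)" "x \<in> ?T p"
        | p q where "p \<in> ch (Suc v)" "q \<in> ch (Suc v)" "x \<in> ?T p" "y \<in> ?T q" using T by blast
      then show "\<not> E x y"
      proof cases
        case (4 p q)
        then show ?thesis
          using ih(1)[OF 4(1)] ch_sub_disjoint(2)[of p _ q x y] by (cases "p = q") (auto simp: indep_def)
      qed (use xv E_sym E_irrefl in blast)+
    qed
    moreover have "avoids (st v) (?T v)"
    proof -
      have "\<not> E x z" if h: "x \<in> ?T v" "z = a \<or> z = b \<or> z = c" for x z
      proof (cases "x = v")
        case True
        then show ?thesis using t' t h by (auto simp: put_slot_def split: if_splits)
      next
        case False
        then obtain p where "p \<in> ch (Suc v)" "x \<in> ?T p" using T h by blast
        then show ?thesis using ih(2)[of p] t' t h far[OF h(1) _ h(2)]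
          by (auto simp: put_slot_def split: if_splits)
      qed
      then show ?thesis using t by auto
    qed
    moreover have "sum w (?T v) = f v (st v)"
      using sumv vS ih(3) te True t' by (auto simp: table_eq_def Let_def)
    ultimately show ?thesis by blast
  qed
qed

theorem solution_optimal:
  assumes S: "S \<subseteq> {..<n}"
    and out: "\<And>v. v < n \<Longrightarrow> v \<in> S \<longleftrightarrow> d v (st v)"
    and root: "\<And>x. x \<in> ch 0 \<Longrightarrow> st x = (n, n, n)"
    and st: "\<And>v x. v < n \<Longrightarrow> x \<in> ch (Suc v) \<Longrightarrow>
      st x = (if d v (st v) then the (put_slot E M v (st v)) else st v)"
  shows "indep S \<and> (\<forall>T. T \<subseteq> {..<n} \<longrightarrow> indep T \<longrightarrow> sum w T \<le> sum w S)"
proof -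
  have nE: "\<not> E x n" "\<not> E n x" for x using E_less by blast+
  have val: "valid x (n, n, n)" for x using nE by (auto simp: sub_def)
  have rn: "x < n" if "x \<in> ch 0" for x using that by (simp add: ch_def)
  have att: "indep (S \<inter> sub x)" "sum w (S \<inter> sub x) = f x (n, n, n)" if "x \<in> ch 0" for x
    using solution_attains[of S st x, OF out st rn[OF that]] root[OF that] val by auto
  have cover: "T \<subseteq> (\<Union>x\<in>ch 0. sub x)" if "T \<subseteq> {..<n}" for T using root_exists that by blast
  have "indep S"
    unfolding indep_def
  proof (intro ballI)
    fix x y assume "x \<in> S" "y \<in> S"
    then obtain p q where "p \<in> ch 0" "q \<in> ch 0" "x \<in> S \<inter> sub p" "y \<in> S \<inter> sub q"
      using cover[OF S] by blast
    then show "\<not> E x y"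
      using att(1)[of p] ch_sub_disjoint(2)[of p 0 q x y] by (cases "p = q") (auto simp: indep_def)
  qed
  moreover have "sum w T \<le> sum w S" if T: "T \<subseteq> {..<n}" "indep T" for T
  proof -
    have "sum w T = (\<Sum>x\<in>ch 0. sum w (T \<inter> sub x))" using sum_ch[OF cover[OF T(1)]] .
    also have "\<dots> \<le> (\<Sum>x\<in>ch 0. sum w (S \<inter> sub x))"
    proof (rule sum_mono)
      fix x assume x: "x \<in> ch 0"
      have "sum w (T \<inter> sub x) \<le> f x (n, n, n)"
        using table_upper[of x "(n, n, n)" "T \<inter> sub x"] rn[OF x] val T(2) nE by (auto simp: indep_def)
      then show "sum w (T \<inter> sub x) \<le> sum w (S \<inter> sub x)" using att(2)[OF x] by simp
    qed
    also have "\<dots> = sum w S" using sum_ch[OF cover[OF S], of w] by simp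
    finally show ?thesis .
  qed
  ultimately show ?thesis by blast
qed

end

end

section \<open>From an elimination order to its forest\<close>

definition bag_rel :: "(nat \<Rightarrow> nat \<Rightarrow> bool) \<Rightarrow> nat \<Rightarrow> (nat \<Rightarrow> nat) \<Rightarrow> nat \<Rightarrow> nat \<Rightarrow> bool" where
  "bag_rel E n \<sigma> v x \<longleftrightarrow> (\<exists>j<n. \<sigma> j = v \<and> x \<in> bag E n \<sigma> j)"

text \<open>Parents are stored shifted by one, \<open>0\<close> meaning that there is none.\<close>

definition parents_upto :: "(nat \<Rightarrow> nat \<Rightarrow> bool) \<Rightarrow> nat \<Rightarrow> (nat \<Rightarrow> nat) \<Rightarrow> (nat \<Rightarrow> nat) \<Rightarrow> nat \<Rightarrow> bool" where
  "parents_upto E n \<sigma> par i \<longleftrightarrow> (\<forall>j<i.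
     par (\<sigma> j) = 0 \<and> (\<forall>l. j < l \<and> l < i \<longrightarrow> \<sigma> l \<notin> bag E n \<sigma> j) \<or>
     (\<exists>l. j < l \<and> l < i \<and> \<sigma> l \<in> bag E n \<sigma> j \<and> par (\<sigma> j) = Suc (\<sigma> l) \<and>
        (\<forall>k. j < k \<and> k < l \<longrightarrow> \<sigma> k \<notin> bag E n \<sigma> j)))"

context elim_order
begin

definition pos :: "nat \<Rightarrow> nat" where
  "pos x = the_inv_into {..<n} \<sigma> x"

lemma pos_\<sigma>: "j < n \<Longrightarrow> pos (\<sigma> j) = j"
  using bij by (simp add: pos_def bij_betw_def the_inv_into_f_f)

lemma bag_later: "j < n \<Longrightarrow> k < n \<Longrightarrow> \<sigma> k \<in> bag E n \<sigma> j \<Longrightarrow> j \<le> k"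
  unfolding bag_def by (metis (mono_tags, lifting) imageI lessThan_iff mem_Collect_eq not_le)

text \<open>The parent is the first later member \<open>\<sigma> l\<close> of the bag. It reaches
  every other later member through \<open>\<sigma> j\<close>, which has been eliminated by step
  \<open>l\<close>; this gives the running intersection property.\<close>

lemma elim_forest:
  assumes irrefl: "\<And>u. \<not> E u u" and par: "parents_upto E n \<sigma> par n"
  shows "elim_forest E (bag_rel E n \<sigma>) n pos par"
proof
  show "E u v \<Longrightarrow> E v u" for u v by (rule E_sym)
  show "\<not> E u u" for u by (rule irrefl)
  show "E u v \<Longrightarrow> u < n \<and> v < n" for u v by (rule E_less)
  show "bag_rel E n \<sigma> u v \<Longrightarrow> u < n \<and> v < n" for u v
    using \<sigma>_less by (auto simp: bag_rel_def bag_def)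
  show "bag_rel E n \<sigma> u v \<Longrightarrow> pos u \<le> pos v" for u v
  proof -
    assume "bag_rel E n \<sigma> u v"
    then obtain j where j: "j < n" "\<sigma> j = u" "v \<in> bag E n \<sigma> j" by (auto simp: bag_rel_def)
    then obtain k where k: "k < n" "\<sigma> k = v" using \<sigma>_surj[of v] by (auto simp: bag_def)
    then show ?thesis using bag_later[of j k] pos_\<sigma> j by auto
  qed
  show "bag_rel E n \<sigma> u v" if e: "E u v" and le: "pos u \<le> pos v" for u v
  proof -
    obtain j k where j: "j < n" "\<sigma> j = u" and k: "k < n" "\<sigma> k = v"
      using \<sigma>_surj E_less[OF e] by blast
    have "j \<le> k" using le pos_\<sigma> j k by auto
    then have "v \<notin> \<sigma> ` {..<j}" using k j \<sigma>_inj[of k] by (auto simp: image_iff)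
    then have "v \<in> bag E n \<sigma> j" using e j E_less conn_edge[of E] by (simp add: bag_def)
    then show ?thesis using j by (auto simp: bag_rel_def)
  qed
  show "\<exists>y. par x = Suc y \<and> bag_rel E n \<sigma> y z" if xz: "bag_rel E n \<sigma> x z" and ne: "x \<noteq> z" for x z
  proof -
    obtain j where j: "j < n" "\<sigma> j = x" "z \<in> bag E n \<sigma> j" using xz by (auto simp: bag_rel_def)
    then obtain k where k: "k < n" "\<sigma> k = z" using \<sigma>_surj[of z] by (auto simp: bag_def)
    have "j < k" using bag_later[of j k] j k ne by (cases "j = k") auto
    then obtain l where l: "j < l" "l < n" "\<sigma> l \<in> bag E n \<sigma> j" "par x = Suc (\<sigma> l)" "l \<le> k"
      using par j k unfolding parents_upto_def by (metis not_le)
    have sub: "\<sigma> ` {..<j} \<subseteq> \<sigma> ` {..<l}" using l(1) by (intro image_mono) simp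
    have "conn E (\<sigma> ` {..<j}) (\<sigma> j) z" "conn E (\<sigma> ` {..<j}) (\<sigma> j) (\<sigma> l)"
      using j(3) l(3) by (auto simp: bag_def)
    then have "conn E (\<sigma> ` {..<l}) (\<sigma> j) z" "conn E (\<sigma> ` {..<l}) (\<sigma> l) (\<sigma> j)"
      using conn_mono[OF _ sub] conn_sym[OF sym] by blast+
    then have "conn E (\<sigma> ` {..<l}) (\<sigma> l) z"
      using conn_trans[of E _ "\<sigma> l" "\<sigma> j" z] l(1) by blast
    moreover have "z \<notin> \<sigma> ` {..<l}" using k l \<sigma>_inj[of k] by (auto simp: image_iff)
    ultimately have "z \<in> bag E n \<sigma> l" using k \<sigma>_less by (auto simp: bag_def)
    then show ?thesis using l by (auto simp: bag_rel_def)
  qed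
  show "y < n \<and> pos x < pos y" if x: "x < n" and y: "par x = Suc y" for x y
  proof -
    obtain j where j: "j < n" "\<sigma> j = x" using \<sigma>_surj x by blast
    then obtain l where "j < l" "l < n" "y = \<sigma> l"
      using par y unfolding parents_upto_def by (metis nat.distinct(1) nat.inject)
    then show ?thesis using j pos_\<sigma> \<sigma>_less by auto
  qed
  show "E v a \<or> E v b \<or> E v c \<or> E a b \<or> E a c \<or> E b c"
    if h: "bag_rel E n \<sigma> v a" "bag_rel E n \<sigma> v b" "bag_rel E n \<sigma> v c" "distinct [v, a, b, c]" for v a b c
  proof -
    obtain j where j: "j < n" "\<sigma> j = v" "a \<in> bag E n \<sigma> j" using h by (auto simp: bag_rel_def)
    then have "b \<in> bag E n \<sigma> j" "c \<in> bag E n \<sigma> j"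
      using h \<sigma>_inj by (auto simp: bag_rel_def)
    then show ?thesis
      using bag_independent[OF j(1) self_in_bag[OF j(1)] j(3)] h(4) unfolding j(2) by blast
  qed
qed

end

section \<open>Running times of structured programs\<close>

text \<open>Total correctness with a time budget: termination within \<open>B\<close> steps is part
  of the claim.\<close>

definition wp :: "com \<Rightarrow> (memory \<Rightarrow> bool) \<Rightarrow> nat \<Rightarrow> memory \<Rightarrow> bool" where
  "wp c Q B s \<longleftrightarrow> (\<exists>t s'. exec c s t s' \<and> t \<le> B \<and> Q s')"

primrec nmods :: "com \<Rightarrow> string set" where
  "nmods Skip = {}"
| "nmods (NSet x i a) = {x}"
| "nmods (QSet x i a) = {}"
| "nmods (Seq c d) = nmods c \<union> nmods d"
| "nmods (Cond b c d) = nmods c \<union> nmods d"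
| "nmods (While b c) = nmods c"

primrec qmods :: "com \<Rightarrow> string set" where
  "qmods Skip = {}"
| "qmods (NSet x i a) = {}"
| "qmods (QSet x i a) = {x}"
| "qmods (Seq c d) = qmods c \<union> qmods d"
| "qmods (Cond b c d) = qmods c \<union> qmods d"
| "qmods (While b c) = qmods c"

text \<open>The arrays that a program writes are over-approximated by its syntax, which frees loop
  invariants from restating everything that stays unchanged.\<close>

definition frame :: "com \<Rightarrow> memory \<Rightarrow> memory \<Rightarrow> bool" where
  "frame c s s' \<longleftrightarrow> (\<forall>x. x \<notin> nmods c \<longrightarrow> nmem s' x = nmem s x) \<and>
     (\<forall>x. x \<notin> qmods c \<longrightarrow> qmem s' x = qmem s x)"

lemma frameD:
  assumes "frame c s s'"
  shows "x \<notin> nmods c \<Longrightarrow> nmem s' x = nmem s x" "x \<notin> qmods c \<Longrightarrow> qmem s' x = qmem s x"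
  using assms by (auto simp: frame_def)

lemma frame_trans:
  "frame c s s' \<Longrightarrow> frame d s' s'' \<Longrightarrow> nmods c \<subseteq> nmods e \<Longrightarrow> nmods d \<subseteq> nmods e \<Longrightarrow>
    qmods c \<subseteq> qmods e \<Longrightarrow> qmods d \<subseteq> qmods e \<Longrightarrow> frame e s s''"
  unfolding frame_def by (metis subsetD)

lemma nmem_nstore [simp]: "nmem (nstore x i k s) y = (if y = x then (nmem s x)(i := k) else nmem s y)"
  by (simp add: nstore_def)

lemma qmem_nstore [simp]: "qmem (nstore x i k s) = qmem s"
  by (simp add: nstore_def)

lemma nmem_qstore [simp]: "nmem (qstore x i q s) = nmem s"
  by (simp add: qstore_def)

lemma qmem_qstore [simp]: "qmem (qstore x i q s) y = (if y = x then (qmem s x)(i := q) else qmem s y)"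
  by (simp add: qstore_def)

lemma exec_frame: "exec c s t s' \<Longrightarrow> frame c s s'"
proof (induction rule: exec.induct)
  case (Seq c s t s' d t' s'')
  then show ?case using frame_trans[of c s s' d s'' "Seq c d"] by simp
next
  case (WhileT b s c t s' t' s'')
  then show ?case using frame_trans[of c s s' "While b c" s'' "While b c"] by simp
qed (auto simp: frame_def)

lemma wp_conseq:
  assumes "wp c Q B s" "\<And>s'. frame c s s' \<Longrightarrow> Q s' \<Longrightarrow> R s'" "B \<le> B'"
  shows "wp c R B' s"
  using assms exec_frame unfolding wp_def by (meson le_trans)

lemma wp_mono: "wp c Q B s \<Longrightarrow> B \<le> B' \<Longrightarrow> wp c Q B' s"
  using wp_conseq by blast

lemma wp_Seq: "wp c (wp d Q B2) B1 s \<Longrightarrow> wp (Seq c d) Q (1 + B1 + B2) s"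
  unfolding wp_def using exec.Seq by (metis add_le_mono order_refl)

lemma wp_Skip: "Q s \<Longrightarrow> wp Skip Q 1 s"
  unfolding wp_def using exec.Skip by blast

lemma wp_NSet:
  "Q (nstore x (nval i s) (nval a s) s) \<Longrightarrow> wp (NSet x i a) Q (1 + ncost i + ncost a) s"
  unfolding wp_def using exec.NSet by blast

lemma wp_QSet:
  "Q (qstore x (nval i s) (qval a s) s) \<Longrightarrow> wp (QSet x i a) Q (1 + ncost i + qcost a) s"
  unfolding wp_def using exec.QSet by blast

lemma wp_Cond:
  assumes "bval b s \<Longrightarrow> wp c Q B s" "\<not> bval b s \<Longrightarrow> wp d Q B s"
  shows "wp (Cond b c d) Q (1 + bcost b + B) s"
proof (cases "bval b s")
  case True
  then obtain t s' where "exec c s t s'" "t \<le> B" "Q s'" using assms by (auto simp: wp_def)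
  then show ?thesis unfolding wp_def using exec.CondT[OF True] by (meson add_left_mono)
next
  case False
  then obtain t s' where "exec d s t s'" "t \<le> B" "Q s'" using assms by (auto simp: wp_def)
  then show ?thesis unfolding wp_def using exec.CondF[OF False] by (meson add_left_mono)
qed

text \<open>For loop-free code the final memory becomes a term that the simplifier can compute. The
  value for loops is a dummy, excluded by \<open>loop_free\<close> wherever \<open>den\<close> is
  used to describe an execution.\<close>

primrec den :: "com \<Rightarrow> memory \<Rightarrow> memory" where
  "den Skip s = s"
| "den (NSet x i a) s = nstore x (nval i s) (nval a s) s"
| "den (QSet x i a) s = qstore x (nval i s) (qval a s) s"
| "den (Seq c d) s = den d (den c s)"
| "den (Cond b c d) s = (if bval b s then den c s else den d s)"
| "den (While b c) s = s"

primrec loop_free :: "com \<Rightarrow> bool" where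
  "loop_free Skip = True"
| "loop_free (NSet x i a) = True"
| "loop_free (QSet x i a) = True"
| "loop_free (Seq c d) = (loop_free c \<and> loop_free d)"
| "loop_free (Cond b c d) = (loop_free c \<and> loop_free d)"
| "loop_free (While b c) = False"

text \<open>Loops get the junk cost \<open>0\<close>: only \<^const>\<open>loop_free\<close> programs are considered.\<close>

primrec ccost :: "com \<Rightarrow> nat" where
  "ccost Skip = 1"
| "ccost (NSet x i a) = 1 + ncost i + ncost a"
| "ccost (QSet x i a) = 1 + ncost i + qcost a"
| "ccost (Seq c d) = 1 + ccost c + ccost d"
| "ccost (Cond b c d) = 1 + bcost b + ccost c + ccost d"
| "ccost (While b c) = 0"

lemma wp_den_aux: "loop_free c \<Longrightarrow> wp c (\<lambda>s'. s' = den c s) (ccost c) s"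
proof (induction c arbitrary: s)
  case (Seq c d)
  then have "wp c (wp d (\<lambda>s'. s' = den (Seq c d) s) (ccost d)) (ccost c) s"
    by (intro wp_conseq[OF Seq.IH(1)]) auto
  then show ?case using wp_Seq by fastforce
next
  case (Cond b c d)
  have "wp (Cond b c d) (\<lambda>s'. s' = den (Cond b c d) s) (1 + bcost b + (ccost c + ccost d)) s"
  proof (rule wp_Cond)
    assume "bval b s"
    then show "wp c (\<lambda>s'. s' = den (Cond b c d) s) (ccost c + ccost d) s"
      using Cond wp_mono[of c _ "ccost c" s] by simp
  next
    assume "\<not> bval b s"
    then show "wp d (\<lambda>s'. s' = den (Cond b c d) s) (ccost c + ccost d) s"
      using Cond wp_mono[of d _ "ccost d" s] by simp
  qed
  then show ?case by (simp add: add.assoc)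
next
  case (NSet x i a)
  show ?case using wp_NSet[of "\<lambda>s'. s' = den (NSet x i a) s" x i s a] by simp
next
  case (QSet x i a)
  show ?case using wp_QSet[of "\<lambda>s'. s' = den (QSet x i a) s" x i s a] by simp
next
  case Skip
  show ?case using wp_Skip[of "\<lambda>s'. s' = den Skip s" s] by simp
qed simp

lemma wp_den:
  assumes "loop_free c" "Q (den c s)" "ccost c \<le> B"
  shows "wp c Q B s"
  using wp_conseq[OF wp_den_aux[OF assms(1)]] assms(2,3) by blast

section \<open>Counting loops and their cost\<close>

abbreviation V :: "string \<Rightarrow> nexp" where
  "V x \<equiv> NGet x (NConst 0)"

definition For :: "string \<Rightarrow> string \<Rightarrow> com \<Rightarrow> com" where
  "For x b c = Seq (NSet x (NConst 0) (NConst 0))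
     (While (NLess (V x) (V b)) (Seq c (NSet x (NConst 0) (NPlus (V x) (NConst 1)))))"

lemma nmods_For [simp]: "nmods (For x b c) = insert x (nmods c)"
  by (auto simp: For_def)

lemma qmods_For [simp]: "qmods (For x b c) = qmods c"
  by (auto simp: For_def)

text \<open>Each round adds 13 steps to the body: 6 for the loop and its test, 1 for the sequencing
  and 6 for the increment. The remaining 10 are 3 for the initialization, 1 for sequencing and 6 for
  the failing last test. The premise \<open>insens\<close> is needed because the loop itself writes
  the counter between two uses of the invariant.\<close>

lemma wp_For:
  assumes m: "nmem s b 0 = m" and x: "x \<noteq> b" "b \<notin> nmods c" "x \<notin> nmods c"
    and init: "I 0 s"
    and insens: "\<And>i k s. I i s \<Longrightarrow> I i (nstore x 0 k s)"
    and step: "\<And>i s'. i < m \<Longrightarrow> I i s' \<Longrightarrow> nmem s' x 0 = i \<Longrightarrow> frame (For x b c) s s' \<Longrightarrow>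
      wp c (I (Suc i)) B s'"
  shows "wp (For x b c) (I m) (m * (B + 13) + 10) s"
proof -
  let ?inc = "NSet x (NConst 0) (NPlus (V x) (NConst 1))"
  let ?W = "While (NLess (V x) (V b)) (Seq c ?inc)"
  have loop: "wp ?W (I m) ((m - i) * (B + 13) + 6) s'"
    if "i \<le> m" "I i s'" "nmem s' x 0 = i" "frame (For x b c) s s'" for i s'
    using that
  proof (induction "m - i" arbitrary: i s')
    case 0
    then have [simp]: "i = m" by simp
    have "nmem s' b 0 = m" using frameD(1)[OF 0(5), of b] x m by simp
    then have "exec ?W s' (1 + bcost (NLess (V x) (V b))) s'"
      using 0 by (intro exec.WhileF) simp
    then show ?case using 0 unfolding wp_def by fastforce
  next
    case (Suc k)
    then have i: "i < m" by simp
    have "nmem s' b 0 = m" using frameD(1)[OF Suc.prems(4), of b] x m by simp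
    then have b: "bval (NLess (V x) (V b)) s'" using Suc.prems i by simp
    obtain t1 s1 where e1: "exec c s' t1 s1" "t1 \<le> B" "I (Suc i) s1"
      using step[OF i Suc.prems(2-4)] unfolding wp_def by blast
    have fr1: "frame c s' s1" using exec_frame e1(1) .
    then have x1: "nmem s1 x 0 = i" using frameD(1)[OF fr1, of x] x Suc.prems(3) by simp
    let ?s2 = "nstore x 0 (Suc i) s1"
    have "exec ?inc s1 6 ?s2" using exec.NSet[of x "NConst 0" "NPlus (V x) (NConst 1)" s1] x1
      by (simp add: eval_nat_numeral)
    with e1(1) have e2: "exec (Seq c ?inc) s' (1 + t1 + 6) ?s2" by (rule exec.Seq)
    have "frame (For x b c) s ?s2"
      using Suc.prems(4) fr1 by (auto simp: frame_def)
    then have "wp ?W (I m) ((m - Suc i) * (B + 13) + 6) ?s2"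
      using Suc.hyps(1)[of "Suc i" ?s2] Suc.hyps(2) i e1(3) insens by simp
    then obtain t3 s3 where e3: "exec ?W ?s2 t3 s3" "t3 \<le> (m - Suc i) * (B + 13) + 6" "I m s3"
      unfolding wp_def by blast
    have "exec ?W s' (1 + bcost (NLess (V x) (V b)) + (1 + t1 + 6) + t3) s3"
      by (rule exec.WhileT[OF b e2 e3(1)])
    moreover have "(m - i) * (B + 13) = (m - Suc i) * (B + 13) + (B + 13)"
      using i by (simp add: Suc_diff_Suc[symmetric] del: mult_Suc) (metis Suc_diff_Suc add.commute mult_Suc)
    ultimately show ?case using e1(2) e3(2,3) unfolding wp_def by fastforce
  qed
  let ?s0 = "nstore x 0 0 s"
  have "frame (For x b c) s ?s0" by (auto simp: frame_def)
  then have "wp ?W (I m) (m * (B + 13) + 6) ?s0"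
    using loop[of 0 ?s0] insens init by simp
  then have "wp (NSet x (NConst 0) (NConst 0)) (wp ?W (I m) (m * (B + 13) + 6)) 3 s"
    using wp_NSet[of "wp ?W (I m) (m * (B + 13) + 6)" x "NConst 0" s "NConst 0"]
    by (simp add: numeral_3_eq_3)
  then show ?thesis
    unfolding For_def using wp_mono[OF wp_Seq] by simp
qed

text \<open>The invariant has two indices so that it can express lexicographic progress;
  \<open>row\<close> identifies the end of a row with the start of the next one.\<close>

lemma wp_For2:
  assumes m: "nmem s b 0 = m" and x: "x \<noteq> b" "y \<noteq> b" "x \<noteq> y" "b \<notin> nmods c" "x \<notin> nmods c" "y \<notin> nmods c"
    and init: "I 0 0 s"
    and insens: "\<And>i j k s. I i j s \<Longrightarrow> I i j (nstore x 0 k s)" "\<And>i j k s. I i j s \<Longrightarrow> I i j (nstore y 0 k s)"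
    and row: "\<And>i s. i < m \<Longrightarrow> I i m s \<Longrightarrow> I (Suc i) 0 s"
    and step: "\<And>i j s'. i < m \<Longrightarrow> j < m \<Longrightarrow> I i j s' \<Longrightarrow> nmem s' x 0 = i \<Longrightarrow> nmem s' y 0 = j \<Longrightarrow>
      frame (For x b (For y b c)) s s' \<Longrightarrow> wp c (I i (Suc j)) B s'"
  shows "wp (For x b (For y b c)) (I m 0) (m * ((m * (B + 13) + 10) + 13) + 10) s"
proof (rule wp_For[where I = "\<lambda>i. I i 0"])
  fix i s' assume i: "i < m" "I i 0 s'" "nmem s' x 0 = i" "frame (For x b (For y b c)) s s'"
  have "wp (For y b c) (I i m) (m * (B + 13) + 10) s'"
  proof (rule wp_For)
    show "nmem s' b 0 = m" using frameD(1)[OF i(4), of b] x m by simp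
    fix j s'' assume j: "j < m" "I i j s''" "nmem s'' y 0 = j" "frame (For y b c) s' s''"
    have "nmem s'' x 0 = i" using frameD(1)[OF j(4), of x] x i(3) by simp
    moreover have "frame (For x b (For y b c)) s s''" using frame_trans[OF i(4) j(4), of "For x b (For y b c)"] by auto
    ultimately show "wp c (I i (Suc j)) B s''" using step i j by blast
  qed (use x i insens in auto)
  then show "wp (For y b c) (I (Suc i) 0) (m * (B + 13) + 10) s'"
    by (rule wp_conseq) (use row i in auto)
qed (use x m init insens in auto)

text \<open>The overheads 13 and 10 of a loop are absorbed into the leading power, so that every
  level of nesting adds one to the exponent and 23 to the constant.\<close>

lemma loop_cost:
  fixes m N B K j :: nat
  assumes "m \<le> N" "1 \<le> N" "B \<le> K * N ^ j"
  shows "m * (B + 13) + 10 \<le> (K + 23) * N ^ Suc j"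
proof -
  have p: "1 \<le> N ^ k" for k using assms(2) by simp
  have "m * (B + 13) \<le> N * (K * N ^ j + 13)" using assms by (intro mult_mono) auto
  also have "\<dots> = K * N ^ Suc j + 13 * N" by (simp add: algebra_simps)
  also have "13 * N \<le> 13 * N ^ Suc j" using p[of j] by simp
  finally have "m * (B + 13) \<le> K * N ^ Suc j + 13 * N ^ Suc j" by simp
  moreover have "10 \<le> 10 * N ^ Suc j" using p[of "Suc j"] by simp
  moreover have "(K + 23) * N ^ Suc j = K * N ^ Suc j + 13 * N ^ Suc j + 10 * N ^ Suc j"
    by (simp only: distrib_right[symmetric]) simp
  ultimately show ?thesis by linarith
qed

section \<open>The elimination program\<close>

lemma wp_SeqI:
  assumes "wp c P Bc s" "\<And>s'. frame c s s' \<Longrightarrow> P s' \<Longrightarrow> wp d Q Bd s'" "1 + Bc + Bd \<le> B"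
  shows "wp (Seq c d) Q B s"
  by (rule wp_mono[OF wp_Seq[OF wp_conseq[OF assms(1)]] assms(3)]) (use assms(2) in auto)

lemma wp_den_Seq:
  assumes "loop_free c" "wp d Q Bd (den c s)" "1 + ccost c + Bd \<le> B"
  shows "wp (Seq c d) Q B s"
  by (rule wp_SeqI[OF wp_den_aux[OF assms(1)] _ assms(3)]) (use assms(2) in simp)

abbreviation setv :: "string \<Rightarrow> nexp \<Rightarrow> com" where
  "setv x e \<equiv> NSet x (NConst 0) e"

abbreviation pos_test :: "nexp \<Rightarrow> bexp" where
  "pos_test e \<equiv> NLess (NConst 0) e"

abbreviation zero_test :: "nexp \<Rightarrow> bexp" where
  "zero_test e \<equiv> BNot (NLess (NConst 0) e)"

abbreviation idx :: "nexp \<Rightarrow> nexp \<Rightarrow> nexp" where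
  "idx i j \<equiv> NPlus (NGet ''mul'' i) j"

text \<open>
  For want of multiplication, index computations look up the products with \<open>n + 1\<close> in a table. Rows
  have length \<open>n + 1\<close> rather than \<open>n\<close> to leave room for the index \<open>n\<close> of an unused triple component.
\<close>

definition base :: "nat \<Rightarrow> memory \<Rightarrow> bool" where
  "base n s \<longleftrightarrow> nmem s ''n'' 0 = n \<and> nmem s ''N'' 0 = Suc n \<and>
     (\<forall>k<Suc n ^ 3. nmem s ''mul'' k = k * Suc n)"

lemma base_frame:
  "base n s \<Longrightarrow> frame c s s' \<Longrightarrow> {''n'', ''N'', ''mul''} \<inter> nmods c = {} \<Longrightarrow> base n s'"
  by (auto simp: base_def frame_def)

lemma base_n: "base n s \<Longrightarrow> nmem s ''n'' 0 = n"
  by (simp add: base_def)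

lemma base_N: "base n s \<Longrightarrow> nmem s ''N'' 0 = Suc n"
  by (simp add: base_def)

section \<open>Index arithmetic and Boolean matrices\<close>

definition enc :: "nat \<Rightarrow> nat \<Rightarrow> nat \<Rightarrow> nat" where
  "enc n i j = i * Suc n + j"

lemma enc_inj [simp]:
  assumes "j \<le> n" "j' \<le> n"
  shows "enc n i j = enc n i' j' \<longleftrightarrow> i = i' \<and> j = j'"
proof
  assume e: "enc n i j = enc n i' j'"
  have "enc n i j div Suc n = i" "enc n i' j' div Suc n = i'"
    "enc n i j mod Suc n = j" "enc n i' j' mod Suc n = j'"
    using assms by (simp_all add: enc_def del: mult_Suc_right)
  then show "i = i' \<and> j = j'" using e by metis
qed simp

lemma enc_bound: "i < Suc n ^ k \<Longrightarrow> j \<le> n \<Longrightarrow> enc n i j < Suc n ^ Suc k"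
proof -
  assume "i < Suc n ^ k" "j \<le> n"
  then have "Suc i * Suc n \<le> Suc n ^ k * Suc n" by (intro mult_le_mono1) simp
  then show ?thesis using \<open>j \<le> n\<close> by (simp add: enc_def algebra_simps)
qed

lemma mul_enc: "base n s \<Longrightarrow> i < Suc n ^ 3 \<Longrightarrow> nmem s ''mul'' i + j = enc n i j"
  by (simp add: base_def enc_def)

lemma less_cube: "i \<le> n \<Longrightarrow> i < Suc n ^ 3"
  using self_le_power[of "Suc n" 3] by simp

lemma mul_enc1: "base n s \<Longrightarrow> i \<le> n \<Longrightarrow> nmem s ''mul'' i + j = enc n i j"
  using mul_enc less_cube by blast

definition mat :: "nat \<Rightarrow> (nat \<Rightarrow> nat) \<Rightarrow> (nat \<Rightarrow> nat \<Rightarrow> bool) \<Rightarrow> bool" where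
  "mat n f R \<longleftrightarrow> (\<forall>i<n. \<forall>j<n. 0 < f (enc n i j) \<longleftrightarrow> R i j)"

lemma matD: "mat n f R \<Longrightarrow> i < n \<Longrightarrow> j < n \<Longrightarrow> 0 < f (enc n i j) \<longleftrightarrow> R i j"
  by (simp add: mat_def)

lemma mat_upd:
  assumes "mat n f R" "i < n" "j < n"
    and "R' i j \<longleftrightarrow> 0 < v"
    and "\<And>x y. x < n \<Longrightarrow> y < n \<Longrightarrow> x \<noteq> i \<or> y \<noteq> j \<Longrightarrow> R' x y \<longleftrightarrow> R x y"
  shows "mat n (f(enc n i j := v)) R'"
  using assms unfolding mat_def by auto

lemma mat_cong:
  "mat n f R \<Longrightarrow> (\<And>x y. x < n \<Longrightarrow> y < n \<Longrightarrow> R' x y \<longleftrightarrow> R x y) \<Longrightarrow> mat n f R'"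
  by (simp add: mat_def)

lemma loop2_cost:
  fixes m N B K j :: nat
  assumes "m \<le> N" "1 \<le> N" "B \<le> K"
  shows "m * ((m * (B + 13) + 10) + 13) + 10 \<le> (K + 46) * N ^ 2"
proof -
  have "m * (B + 13) + 10 \<le> (K + 23) * N ^ Suc 0" using loop_cost[of m N B K 0] assms by simp
  then have "m * ((m * (B + 13) + 10) + 13) + 10 \<le> (K + 23 + 23) * N ^ Suc (Suc 0)"
    by (rule loop_cost[OF assms(1,2)])
  then show ?thesis by (simp add: numeral_2_eq_2 add.commute)
qed

lemma const_cost:
  fixes N a K j :: nat
  assumes "1 \<le> N" "a + K \<le> K'"
  shows "a + K * N ^ j \<le> K' * N ^ j"
proof -
  have "a * 1 \<le> a * N ^ j" using assms(1) by (intro mult_le_mono2) simp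
  then have "a + K * N ^ j \<le> (a + K) * N ^ j" by (simp add: distrib_right)
  also have "\<dots> \<le> K' * N ^ j" using assms(2) by (intro mult_le_mono1)
  finally show ?thesis .
qed

section \<open>Floyd-Warshall rounds and the test of a candidate vertex\<close>

definition pivot :: "string \<Rightarrow> com" where
  "pivot A = For ''x'' ''n'' (For ''y'' ''n''
     (Cond (BAnd (pos_test (NGet A (idx (V ''x'') (V ''k'')))) (pos_test (NGet A (idx (V ''k'') (V ''y'')))))
       (NSet A (idx (V ''x'') (V ''y'')) (NConst 1)) Skip))"

lemma mods_pivot [simp]: "nmods (pivot A) = {''x'', ''y'', A}" "qmods (pivot A) = {}"
  by (auto simp: pivot_def)

lemma wp_pivot:
  assumes b: "base n s" and A: "A \<notin> {''n'', ''N'', ''mul'', ''x'', ''y'', ''k''}"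
    and R: "mat n (nmem s A) R" and k: "nmem s ''k'' 0 = k" "k < n"
  shows "wp (pivot A) (\<lambda>s'. mat n (nmem s' A) (\<lambda>x y. R x y \<or> R x k \<and> R k y)) (100 * Suc n ^ 2) s"
proof -
  let ?I = "\<lambda>i j s'. mat n (nmem s' A) (\<lambda>x y. R x y \<or> (x < i \<or> x = i \<and> y < j) \<and> R x k \<and> R k y)"
  let ?c = "Cond (BAnd (pos_test (NGet A (idx (V ''x'') (V ''k'')))) (pos_test (NGet A (idx (V ''k'') (V ''y'')))))
       (NSet A (idx (V ''x'') (V ''y'')) (NConst 1)) Skip"
  have ne: "A \<noteq> ''n''" "A \<noteq> ''N''" "A \<noteq> ''mul''" "A \<noteq> ''x''" "A \<noteq> ''y''" "A \<noteq> ''k''"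
    using A by auto
  note [simp] = ne ne[symmetric]
  have "wp (pivot A) (?I n 0) (n * ((n * (54 + 13) + 10) + 13) + 10) s"
    unfolding pivot_def
  proof (rule wp_For2[where I = ?I])
    show "nmem s ''n'' 0 = n" using base_n[OF b] .
    show "?I 0 0 s" using R by (rule mat_cong) simp
    show "?I (Suc i) 0 s'" if "i < n" "?I i n s'" for i s'
      using that(2) by (rule mat_cong) auto
    fix i j s' assume i: "i < n" and j: "j < n" and I: "?I i j s'"
      and x: "nmem s' ''x'' 0 = i" and y: "nmem s' ''y'' 0 = j"
      and fr: "frame (For ''x'' ''n'' (For ''y'' ''n'' ?c)) s s'"
    have b': "base n s'" using base_frame[OF b fr] by simp
    have k': "nmem s' ''k'' 0 = k" using frameD(1)[OF fr, of "''k''"] k by simp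
    note [simp] = mul_enc1[OF b']
    \<comment> \<open>Working in place is harmless: an update in row or column \<open>k\<close>
      could only set an entry whose relation held before, so the two entries read here still have
      their old meaning.\<close>
    have den: "den ?c s' = (if R i k \<and> R k j then nstore A (enc n i j) 1 s' else s')"
      using matD[OF I i k(2)] matD[OF I k(2) j] i k(2) x y k' by auto
    show "wp ?c (?I i (Suc j)) 54 s'"
    proof (rule wp_den)
      show "?I i (Suc j) (den ?c s')"
      proof (cases "R i k \<and> R k j")
        case True
        then have "nmem (den ?c s') A = (nmem s' A)(enc n i j := 1)" unfolding den by simp
        then show ?thesis using True by (simp only:) (rule mat_upd[OF I i j], auto)
      next
        case False
        then have "nmem (den ?c s') A = nmem s' A" unfolding den by auto
        then show ?thesis using False by (simp only:) (auto intro!: mat_cong[OF I] simp: less_Suc_eq)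
      qed
    qed simp_all
  qed simp_all
  then show ?thesis
  proof (rule wp_conseq)
    show "mat n (nmem s' A) (\<lambda>x y. R x y \<or> R x k \<and> R k y)" if "?I n 0 s'" for s'
      using that by (rule mat_cong) auto
  qed (use loop2_cost[of n "Suc n" 54 54] in simp)
qed

text \<open>The bag as a function of the eliminated set alone, so that a candidate can be tested
  before it has a position in the order.\<close>

definition nbh :: "(nat \<Rightarrow> nat \<Rightarrow> bool) \<Rightarrow> nat \<Rightarrow> nat set \<Rightarrow> nat \<Rightarrow> nat set" where
  "nbh E n L v = {x. x < n \<and> x \<notin> L \<and> conn E L v x}"

lemma bag_nbh: "bag E n \<sigma> j = nbh E n (\<sigma> ` {..<j}) (\<sigma> j)"
  by (simp add: bag_def nbh_def)

text \<open>Complements such as \<open>- B\<close> contain numbers that are not vertices; no walk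
  passes through them.\<close>

lemma conn_restrict:
  assumes "\<And>u v. E u v \<Longrightarrow> v < n"
  shows "conn E L x y \<longleftrightarrow> conn E (L \<inter> {..<n}) x y"
proof -
  have "(\<lambda>u v. E u v \<and> v \<in> L) = (\<lambda>u v. E u v \<and> v \<in> L \<inter> {..<n})"
    using assms by (intro ext) auto
  then show ?thesis by (simp add: conn_def)
qed

text \<open>
  The array \<open>h\<close> holds \<^term>\<open>conn E L\<close>, \<open>L\<close> being the set of vertices flagged in \<open>el\<close>, and \<open>t\<close> its closure
  under paths through the remaining vertices outside the bag of \<open>v\<close>.
\<close>

definition in_bag :: "nexp \<Rightarrow> bexp" where
  "in_bag e = BAnd (zero_test (NGet ''el'' e)) (pos_test (NGet ''h'' (idx (V ''v'') e)))"

definition copy_mat :: com where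
  "copy_mat = For ''x'' ''n'' (For ''y'' ''n''
     (NSet ''t'' (idx (V ''x'') (V ''y'')) (NGet ''h'' (idx (V ''x'') (V ''y'')))))"

definition close_mat :: com where
  "close_mat = For ''k'' ''n''
     (Cond (BAnd (zero_test (NGet ''el'' (V ''k''))) (zero_test (NGet ''h'' (idx (V ''v'') (V ''k'')))))
       (pivot ''t'') Skip)"

definition check_bag :: com where
  "check_bag = For ''x'' ''n'' (For ''y'' ''n''
     (Cond (BAnd (in_bag (V ''x'')) (BAnd (in_bag (V ''y'')) (zero_test (NGet ''t'' (idx (V ''x'') (V ''y''))))))
       (setv ''good'' (NConst 0)) Skip))"

definition test_vertex :: com where
  "test_vertex = Seq copy_mat (Seq close_mat (Seq (setv ''good'' (NConst 1))
     (Seq check_bag (Cond (pos_test (V ''good'')) (setv ''cur'' (V ''v'')) Skip))))"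

definition search :: com where
  "search = For ''v'' ''n'' (Cond (zero_test (NGet ''el'' (V ''v''))) test_vertex Skip)"

lemma mods_search [simp]:
  "nmods copy_mat = {''x'', ''y'', ''t''}" "qmods copy_mat = {}"
  "nmods close_mat = {''k'', ''x'', ''y'', ''t''}" "qmods close_mat = {}"
  "nmods check_bag = {''x'', ''y'', ''good''}" "qmods check_bag = {}"
  "nmods test_vertex = {''k'', ''x'', ''y'', ''t'', ''good'', ''cur''}" "qmods test_vertex = {}"
  "nmods search = {''v'', ''k'', ''x'', ''y'', ''t'', ''good'', ''cur''}" "qmods search = {}"
  by (auto simp: copy_mat_def close_mat_def check_bag_def test_vertex_def search_def)

lemma wp_copy_mat:
  assumes b: "base n s" and R: "mat n (nmem s ''h'') R"
  shows "wp copy_mat (\<lambda>s'. mat n (nmem s' ''t'') R) (100 * Suc n ^ 2) s"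
proof -
  let ?I = "\<lambda>i j s'. \<forall>x<n. \<forall>y<n. x < i \<or> x = i \<and> y < j \<longrightarrow> (0 < nmem s' ''t'' (enc n x y) \<longleftrightarrow> R x y)"
  let ?c = "NSet ''t'' (idx (V ''x'') (V ''y'')) (NGet ''h'' (idx (V ''x'') (V ''y'')))"
  have "wp copy_mat (?I n 0) (n * ((n * (54 + 13) + 10) + 13) + 10) s"
    unfolding copy_mat_def
  proof (rule wp_For2[where I = ?I])
    show "nmem s ''n'' 0 = n" using base_n[OF b] .
    fix i j s' assume i: "i < n" and j: "j < n" and I: "?I i j s'"
      and x: "nmem s' ''x'' 0 = i" and y: "nmem s' ''y'' 0 = j"
      and fr: "frame (For ''x'' ''n'' (For ''y'' ''n'' ?c)) s s'"
    have b': "base n s'" using base_frame[OF b fr] by simp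
    have h: "nmem s' ''h'' = nmem s ''h''" using frameD(1)[OF fr] by simp
    note [simp] = mul_enc1[OF b']
    have "den ?c s' = nstore ''t'' (enc n i j) (nmem s ''h'' (enc n i j)) s'"
      using i j x y h by simp
    then show "wp ?c (?I i (Suc j)) 54 s'"
      using I i j matD[OF R i j] by (intro wp_den) (auto simp: less_Suc_eq)
  qed (auto simp: less_Suc_eq)
  then show ?thesis
    by (rule wp_conseq) (use loop2_cost[of n "Suc n" 54 54] in \<open>auto simp: mat_def\<close>)
qed

lemma wp_close_mat:
  assumes b: "base n s" and L: "\<And>x. x < n \<Longrightarrow> 0 < nmem s ''el'' x \<longleftrightarrow> x \<in> L"
    and v: "nmem s ''v'' 0 = v" "v < n"
    and h: "mat n (nmem s ''h'') (conn E L)" and t: "mat n (nmem s ''t'') (conn E L)"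
  shows "wp close_mat (\<lambda>s'. mat n (nmem s' ''t'') (conn E (L \<union> {u. u < n \<and> u \<notin> L \<and> \<not> conn E L v u})))
    (200 * Suc n ^ 3) s"
proof -
  let ?M = "\<lambda>i. L \<union> {u. u < i \<and> u \<notin> L \<and> \<not> conn E L v u}"
  let ?I = "\<lambda>i s'. mat n (nmem s' ''t'') (conn E (?M i))"
  let ?b = "BAnd (zero_test (NGet ''el'' (V ''k''))) (zero_test (NGet ''h'' (idx (V ''v'') (V ''k''))))"
  have "wp close_mat (?I n) (n * ((1 + bcost ?b + 100 * Suc n ^ 2) + 13) + 10) s"
    unfolding close_mat_def
  proof (rule wp_For[where I = ?I])
    show "nmem s ''n'' 0 = n" using base_n[OF b] .
    show "?I 0 s" using t by simp
    fix i s' assume i: "i < n" and I: "?I i s'" and k: "nmem s' ''k'' 0 = i"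
      and fr: "frame (For ''k'' ''n'' (Cond ?b (pivot ''t'') Skip)) s s'"
    have b': "base n s'" using base_frame[OF b fr] by simp
    have eq: "nmem s' ''h'' = nmem s ''h''" "nmem s' ''el'' = nmem s ''el''" "nmem s' ''v'' = nmem s ''v''"
      using frameD(1)[OF fr] by simp_all
    note [simp] = mul_enc1[OF b']
    have bv: "bval ?b s' \<longleftrightarrow> i \<notin> L \<and> \<not> conn E L v i"
      using L[OF i] matD[OF h v(2) i] eq k v i by auto
    show "wp (Cond ?b (pivot ''t'') Skip) (?I (Suc i)) (1 + bcost ?b + 100 * Suc n ^ 2) s'"
    proof (rule wp_Cond)
      assume "bval ?b s'"
      then have "?M (Suc i) = insert i (?M i)" using bv by (auto simp: less_Suc_eq)
      then have "conn E (?M (Suc i)) = (\<lambda>x y. conn E (?M i) x y \<or> conn E (?M i) x i \<and> conn E (?M i) i y)"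
        by (intro ext) (simp add: conn_insert)
      then show "wp (pivot ''t'') (?I (Suc i)) (100 * Suc n ^ 2) s'"
        using wp_pivot[OF b' _ I k i] by simp
    next
      assume "\<not> bval ?b s'"
      then have "?M (Suc i) = ?M i" using bv by (auto simp: less_Suc_eq)
      then show "wp Skip (?I (Suc i)) (100 * Suc n ^ 2) s'"
        using I by (intro wp_mono[OF wp_Skip]) auto
    qed
  qed auto
  moreover have "n * ((1 + bcost ?b + 100 * Suc n ^ 2) + 13) + 10 \<le> (150 + 23) * Suc n ^ Suc 2"
    by (rule loop_cost[OF _ _ const_cost]) auto
  ultimately show ?thesis by (rule wp_mono[OF _ order.trans]) simp
qed

lemma wp_check_bag:
  assumes b: "base n s" and L: "\<And>x. x < n \<Longrightarrow> 0 < nmem s ''el'' x \<longleftrightarrow> x \<in> L"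
    and v: "nmem s ''v'' 0 = v" "v < n"
    and h: "mat n (nmem s ''h'') (conn E L)" and t: "mat n (nmem s ''t'') R"
    and good: "nmem s ''good'' 0 = 1"
  shows "wp check_bag (\<lambda>s'. 0 < nmem s' ''good'' 0 \<longleftrightarrow> (\<forall>x\<in>nbh E n L v. \<forall>y\<in>nbh E n L v. R x y)) (200 * Suc n ^ 2) s"
proof -
  let ?I = "\<lambda>i j s'. 0 < nmem s' ''good'' 0 \<longleftrightarrow>
    (\<forall>x\<in>nbh E n L v. \<forall>y\<in>nbh E n L v. x < i \<or> x = i \<and> y < j \<longrightarrow> R x y)"
  let ?c = "Cond (BAnd (in_bag (V ''x'')) (BAnd (in_bag (V ''y'')) (zero_test (NGet ''t'' (idx (V ''x'') (V ''y''))))))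
       (setv ''good'' (NConst 0)) Skip"
  have "wp check_bag (?I n 0) (n * ((n * (154 + 13) + 10) + 13) + 10) s"
    unfolding check_bag_def
  proof (rule wp_For2[where I = ?I])
    show "nmem s ''n'' 0 = n" using base_n[OF b] .
    show "?I 0 0 s" using good by simp
    show "?I (Suc i) 0 s'" if "i < n" "?I i n s'" for i s'
    proof -
      have "x < Suc i \<longleftrightarrow> x < i \<or> x = i \<and> y < n" if "y \<in> nbh E n L v" for x y
        using that by (auto simp: nbh_def)
      then show ?thesis using that(2) by auto
    qed
    fix i j s' assume i: "i < n" and j: "j < n" and I: "?I i j s'"
      and x: "nmem s' ''x'' 0 = i" and y: "nmem s' ''y'' 0 = j"
      and fr: "frame (For ''x'' ''n'' (For ''y'' ''n'' ?c)) s s'"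
    have b': "base n s'" using base_frame[OF b fr] by simp
    have eq: "nmem s' ''h'' = nmem s ''h''" "nmem s' ''el'' = nmem s ''el''" "nmem s' ''v'' = nmem s ''v''"
       "nmem s' ''t'' = nmem s ''t''" using frameD(1)[OF fr] by (simp_all add: in_bag_def)
    note [simp] = mul_enc1[OF b']
    have "den ?c s' = (if i \<in> nbh E n L v \<and> j \<in> nbh E n L v \<and> \<not> R i j then nstore ''good'' 0 0 s' else s')"
      using L[OF i] L[OF j] matD[OF h v(2) i] matD[OF h v(2) j] matD[OF t i j] i j x y v eq
      by (auto simp: in_bag_def nbh_def)
    then show "wp ?c (?I i (Suc j)) 154 s'"
      using I i j by (intro wp_den) (auto simp: less_Suc_eq in_bag_def)
  qed (auto simp: in_bag_def)
  then show ?thesis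
    by (rule wp_conseq) (use loop2_cost[of n "Suc n" 154 154] in \<open>auto simp: nbh_def\<close>)
qed

lemma wp_test_vertex:
  assumes E_less: "\<And>u v. E u v \<Longrightarrow> v < n" and "L \<subseteq> {..<n}"
    and b: "base n s" and L: "\<And>x. x < n \<Longrightarrow> 0 < nmem s ''el'' x \<longleftrightarrow> x \<in> L"
    and v: "nmem s ''v'' 0 = v" "v < n"
    and h: "mat n (nmem s ''h'') (conn E L)"
  shows "wp test_vertex (\<lambda>s'. nmem s' ''cur'' 0 =
    (if avoidable E (nbh E n L v) then v else nmem s ''cur'' 0)) (1000 * Suc n ^ 3) s"
proof -
  let ?B = "nbh E n L v"
  have fr_base: "base n s'" if "frame test_vertex s s'" for s'
    using base_frame[OF b that] by simp
  \<comment> \<open>The eliminated vertices together with the remaining non-members of the bag are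
    all vertices outside the bag.\<close>
  have M: "conn E (L \<union> {u. u < n \<and> u \<notin> L \<and> \<not> conn E L v u}) = conn E (- ?B)"
  proof -
    have "L \<union> {u. u < n \<and> u \<notin> L \<and> \<not> conn E L v u} = - ?B \<inter> {..<n}"
      using assms(2) by (auto simp: nbh_def)
    then show ?thesis using conn_restrict[of E n "- ?B"] E_less by (intro ext) auto
  qed
  have copy: "wp copy_mat (\<lambda>s1. wp (Seq close_mat (Seq (setv ''good'' (NConst 1))
     (Seq check_bag (Cond (pos_test (V ''good'')) (setv ''cur'' (V ''v'')) Skip))))
     (\<lambda>s'. nmem s' ''cur'' 0 = (if avoidable E ?B then v else nmem s ''cur'' 0))
     (1 + 200 * Suc n ^ 3 + (1 + 3 + (1 + 200 * Suc n ^ 2 + 20))) s1) (100 * Suc n ^ 2) s"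
  proof (rule wp_conseq[OF wp_copy_mat[OF b h]])
    fix s1 assume f1: "frame copy_mat s s1" and t1: "mat n (nmem s1 ''t'') (conn E L)"
    have e1: "nmem s1 x = nmem s x" if "x \<notin> {''x'', ''y'', ''t''}" for x
      using frameD(1)[OF f1] that by simp
    have b1: "base n s1" using base_frame[OF b f1] by simp
    show "wp (Seq close_mat (Seq (setv ''good'' (NConst 1))
     (Seq check_bag (Cond (pos_test (V ''good'')) (setv ''cur'' (V ''v'')) Skip))))
     (\<lambda>s'. nmem s' ''cur'' 0 = (if avoidable E ?B then v else nmem s ''cur'' 0))
     (1 + 200 * Suc n ^ 3 + (1 + 3 + (1 + 200 * Suc n ^ 2 + 20))) s1"
    proof (rule wp_Seq, rule wp_conseq[OF wp_close_mat[OF b1 _ _ v(2) _ t1]])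
      fix s2 assume f2: "frame close_mat s1 s2"
        and t2: "mat n (nmem s2 ''t'') (conn E (L \<union> {u. u < n \<and> u \<notin> L \<and> \<not> conn E L v u}))"
      have e2: "nmem s2 x = nmem s x" if "x \<notin> {''x'', ''y'', ''t'', ''k''}" for x
        using frameD(1)[OF f2, of x] e1[of x] that by simp
      have b2: "base n s2" using base_frame[OF b1 f2] by simp
      let ?s3 = "nstore ''good'' 0 1 s2"
      have b3: "base n ?s3" using b2 by (simp add: base_def)
      have chk: "wp check_bag (\<lambda>s'. 0 < nmem s' ''good'' 0 \<longleftrightarrow>
          (\<forall>x\<in>nbh E n L v. \<forall>y\<in>nbh E n L v. conn E (- ?B) x y)) (200 * Suc n ^ 2) ?s3"
        using L v h t2 e2 unfolding M by (intro wp_check_bag[OF b3]) auto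
      have "wp (Seq check_bag (Cond (pos_test (V ''good'')) (setv ''cur'' (V ''v'')) Skip))
        (\<lambda>s'. nmem s' ''cur'' 0 = (if avoidable E ?B then v else nmem s ''cur'' 0)) (1 + 200 * Suc n ^ 2 + 20) ?s3"
      proof (rule wp_Seq, rule wp_conseq[OF chk])
        fix s4 assume f4: "frame check_bag ?s3 s4"
          and g: "0 < nmem s4 ''good'' 0 \<longleftrightarrow> (\<forall>x\<in>nbh E n L v. \<forall>y\<in>nbh E n L v. conn E (- ?B) x y)"
        have "nmem s4 ''v'' = nmem s ''v''" "nmem s4 ''cur'' = nmem s ''cur''"
          using frameD(1)[OF f4] e2 by simp_all
        then show "wp (Cond (pos_test (V ''good'')) (setv ''cur'' (V ''v'')) Skip)
          (\<lambda>s'. nmem s' ''cur'' 0 = (if avoidable E ?B then v else nmem s ''cur'' 0)) 20 s4"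
          using g v by (intro wp_den) (auto simp: avoidable_def)
      qed simp
      then have "wp (Seq check_bag (Cond (pos_test (V ''good'')) (setv ''cur'' (V ''v'')) Skip))
        (\<lambda>s'. nmem s' ''cur'' 0 = (if avoidable E ?B then v else nmem s ''cur'' 0)) (1 + 200 * Suc n ^ 2 + 20)
        (den (setv ''good'' (NConst 1)) s2)"
        by (simp only: den.simps nval.simps)
      then show "wp (Seq (setv ''good'' (NConst 1)) (Seq check_bag (Cond (pos_test (V ''good'')) (setv ''cur'' (V ''v'')) Skip)))
        (\<lambda>s'. nmem s' ''cur'' 0 = (if avoidable E ?B then v else nmem s ''cur'' 0)) (1 + 3 + (1 + 200 * Suc n ^ 2 + 20)) s2"
        by (rule wp_den_Seq[rotated]) simp_all
    qed (use L v h e1 in auto)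
  qed simp
  have "(1 + 100 * Suc n ^ 2) + (1 + 200 * Suc n ^ 3 + (1 + 3 + (1 + 200 * Suc n ^ 2 + 20))) \<le> 1000 * Suc n ^ 3"
  proof -
    have "Suc n ^ 2 \<le> Suc n ^ 3" "1 \<le> Suc n ^ 3" by (auto intro: power_increasing)
    then show ?thesis by linarith
  qed
  then show ?thesis unfolding test_vertex_def by (rule wp_mono[OF wp_Seq[OF copy]])
qed

lemma wp_search:
  assumes E_less: "\<And>u v. E u v \<Longrightarrow> v < n" and Ln: "L \<subseteq> {..<n}"
    and b: "base n s" and L: "\<And>x. x < n \<Longrightarrow> 0 < nmem s ''el'' x \<longleftrightarrow> x \<in> L"
    and h: "mat n (nmem s ''h'') (conn E L)"
    and ex: "\<exists>v<n. v \<notin> L \<and> avoidable E (nbh E n L v)"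
  shows "wp search (\<lambda>s'. nmem s' ''cur'' 0 < n \<and> nmem s' ''cur'' 0 \<notin> L \<and>
    avoidable E (nbh E n L (nmem s' ''cur'' 0))) (2000 * Suc n ^ 4) s"
proof -
  let ?P = "\<lambda>v. v < n \<and> v \<notin> L \<and> avoidable E (nbh E n L v)"
  \<comment> \<open>An implication, because \<open>cur\<close> may still hold the vertex of the
    preceding round until some candidate passes; later successes overwrite earlier ones.\<close>
  let ?I = "\<lambda>i s'. (\<exists>v<i. ?P v) \<longrightarrow> ?P (nmem s' ''cur'' 0)"
  let ?b = "zero_test (NGet ''el'' (V ''v''))"
  have loop: "wp search (?I n) (n * ((1 + bcost ?b + 1000 * Suc n ^ 3) + 13) + 10) s"
    unfolding search_def
  proof (rule wp_For[where I = ?I])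
    show "nmem s ''n'' 0 = n" using base_n[OF b] .
    fix i s' assume i: "i < n" and I: "?I i s'" and v: "nmem s' ''v'' 0 = i"
      and fr: "frame (For ''v'' ''n'' (Cond ?b test_vertex Skip)) s s'"
    have b': "base n s'" using base_frame[OF b fr] by simp
    have eq: "nmem s' ''h'' = nmem s ''h''" "nmem s' ''el'' = nmem s ''el''"
      using frameD(1)[OF fr] by simp_all
    have bv: "bval ?b s' \<longleftrightarrow> i \<notin> L" using L[OF i] eq v by simp
    show "wp (Cond ?b test_vertex Skip) (?I (Suc i)) (1 + bcost ?b + 1000 * Suc n ^ 3) s'"
    proof (rule wp_Cond)
      assume "bval ?b s'"
      then have "i \<notin> L" using bv by blast
      have "wp test_vertex (\<lambda>s''. nmem s'' ''cur'' 0 =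
        (if avoidable E (nbh E n L i) then i else nmem s' ''cur'' 0)) (1000 * Suc n ^ 3) s'"
        by (rule wp_test_vertex[OF E_less Ln b' _ v i]) (use L h eq in auto)
      then show "wp test_vertex (?I (Suc i)) (1000 * Suc n ^ 3) s'"
        by (rule wp_conseq) (use I i \<open>i \<notin> L\<close> in \<open>auto simp: less_Suc_eq\<close>)
    next
      assume "\<not> bval ?b s'"
      then show "wp Skip (?I (Suc i)) (1000 * Suc n ^ 3) s'"
        using I bv by (intro wp_mono[OF wp_Skip]) (auto simp: less_Suc_eq)
    qed
  qed auto
  have "n * ((1 + bcost ?b + 1000 * Suc n ^ 3) + 13) + 10 \<le> (1100 + 23) * Suc n ^ Suc 3"
    by (rule loop_cost[OF _ _ const_cost]) auto
  also have "\<dots> \<le> 2000 * Suc n ^ 4" by simp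
  finally have bnd: "n * ((1 + bcost ?b + 1000 * Suc n ^ 3) + 13) + 10 \<le> 2000 * Suc n ^ 4" .
  show ?thesis by (rule wp_conseq[OF loop _ bnd]) (use ex in blast)
qed

section \<open>One round of elimination and its invariant\<close>

definition record_vertex :: com where
  "record_vertex = For ''x'' ''n''
     (Seq (Cond (zero_test (NGet ''el'' (V ''x'')))
            (NSet ''m'' (idx (V ''cur'') (V ''x'')) (NGet ''h'' (idx (V ''cur'') (V ''x''))))
            (NSet ''m'' (idx (V ''cur'') (V ''x'')) (NConst 0)))
       (Cond (BAnd (pos_test (NGet ''el'' (V ''x''))) (BAnd (zero_test (NGet ''par'' (V ''x'')))
               (pos_test (NGet ''m'' (idx (V ''x'') (V ''cur''))))))
          (NSet ''par'' (V ''x'') (NPlus (V ''cur'') (NConst 1))) Skip))"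

text \<open>The bag of \<open>cur\<close> is read off \<open>h\<close> before \<open>cur\<close> is
  flagged and pivoted, since it is defined by walks through strictly earlier vertices. For the same
  reason \<open>cur\<close>, still counted as remaining, is recorded in its own bag.\<close>

definition elim_step :: com where
  "elim_step = Seq search (Seq (NSet ''ord'' (V ''i'') (V ''cur'')) (Seq record_vertex
     (Seq (Seq (NSet ''el'' (V ''cur'') (NConst 1)) (setv ''k'' (V ''cur''))) (pivot ''h''))))"

definition elim :: com where
  "elim = For ''i'' ''n'' elim_step"

lemma mods_elim [simp]:
  "nmods record_vertex = {''x'', ''m'', ''par''}" "qmods record_vertex = {}"
  "nmods elim_step = {''v'', ''k'', ''x'', ''y'', ''t'', ''good'', ''cur'', ''ord'', ''m'', ''par'', ''el'', ''h''}"
  "qmods elim_step = {}"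
  "nmods elim = {''i'', ''v'', ''k'', ''x'', ''y'', ''t'', ''good'', ''cur'', ''ord'', ''m'', ''par'', ''el'', ''h''}"
  "qmods elim = {}"
  by (auto simp: record_vertex_def elim_step_def elim_def)

lemma bag_cong: "(\<And>l. l \<le> j \<Longrightarrow> \<sigma> l = \<tau> l) \<Longrightarrow> bag E n \<sigma> j = bag E n \<tau> j"
  unfolding bag_def by (metis (no_types, lifting) image_cong lessThan_iff less_imp_le_nat order_refl)

definition elim_inv :: "(nat \<Rightarrow> nat \<Rightarrow> bool) \<Rightarrow> nat \<Rightarrow> nat \<Rightarrow> memory \<Rightarrow> bool" where
  "elim_inv E n i s \<longleftrightarrow> (let \<sigma> = nmem s ''ord''; m = nmem s ''m''; par = nmem s ''par'' in
     inj_on \<sigma> {..<i} \<and> \<sigma> ` {..<i} \<subseteq> {..<n} \<and>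
     (\<forall>x<n. 0 < nmem s ''el'' x \<longleftrightarrow> x \<in> \<sigma> ` {..<i}) \<and>
     mat n (nmem s ''h'') (conn E (\<sigma> ` {..<i})) \<and>
     (\<forall>j<i. avoidable E (bag E n \<sigma> j)) \<and>
     (\<forall>j<i. \<forall>x<n. 0 < m (enc n (\<sigma> j) x) \<longleftrightarrow> x \<in> bag E n \<sigma> j) \<and>
     (\<forall>x<n. m (enc n x n) = 0) \<and>
     parents_upto E n \<sigma> par i \<and>
     (\<forall>x<n. x \<notin> \<sigma> ` {..<i} \<longrightarrow> par x = 0))"

text \<open>\<open>ex_avoidable\<close> is applied to the filled graph on the remaining vertices;
  \<open>conn_conn\<close> then turns its connections into walks of \<open>E\<close> outside the
  bag.\<close>

lemma ex_avoidable_vertex: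
  assumes sym: "symp E" and L: "finite L" "card L < n"
  shows "\<exists>v<n. v \<notin> L \<and> avoidable E (nbh E n L v)"
proof -
  have "\<not> {..<n} \<subseteq> L" using L card_mono[of L "{..<n}"] by auto
  then have ne: "{..<n} - L \<noteq> {}" by blast
  have "symp (conn E L)" using conn_sym[OF sym] by (auto intro: sympI)
  then obtain v where v: "v \<in> {..<n} - L"
    and av: "\<And>x y. x \<in> {..<n} - L \<Longrightarrow> y \<in> {..<n} - L \<Longrightarrow> conn E L v x \<Longrightarrow> conn E L v y \<Longrightarrow>
      conn (conn E L) {k \<in> {..<n} - L. \<not> conn E L v k} x y"
    using ex_avoidable[of "{..<n} - L" "conn E L"] ne by auto
  have "avoidable E (nbh E n L v)"
    unfolding avoidable_def
  proof (intro ballI)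
    fix x y assume "x \<in> nbh E n L v" "y \<in> nbh E n L v"
    then have "conn E (L \<union> {k \<in> {..<n} - L. \<not> conn E L v k}) x y"
      using av[of x y] conn_conn by (auto simp: nbh_def)
    then show "conn E (- nbh E n L v) x y"
      by (rule conn_mono) (auto simp: nbh_def)
  qed
  then show ?thesis using v by auto
qed

text \<open>An eliminated vertex receives its parent when the first later member of its bag is
  eliminated, and the test for a zero parent preserves that first one. The test reads column
  \<open>c\<close> in rows of eliminated vertices while row \<open>c\<close> is being written;
  \<open>c \<notin> L\<close> keeps the two apart.\<close>

lemma wp_record_vertex:
  assumes b: "base n s" and L: "\<And>x. x < n \<Longrightarrow> 0 < nmem s ''el'' x \<longleftrightarrow> x \<in> L"
    and h: "mat n (nmem s ''h'') (conn E L)"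
    and c: "nmem s ''cur'' 0 = c" "c < n" "c \<notin> L"
  shows "wp record_vertex (\<lambda>s'.
    (\<forall>x<n. 0 < nmem s' ''m'' (enc n c x) \<longleftrightarrow> x \<in> nbh E n L c) \<and>
    (\<forall>x y. y \<le> n \<longrightarrow> x \<noteq> c \<or> y = n \<longrightarrow> nmem s' ''m'' (enc n x y) = nmem s ''m'' (enc n x y)) \<and>
    (\<forall>x. nmem s' ''par'' x = (if x < n \<and> x \<in> L \<and> nmem s ''par'' x = 0 \<and> 0 < nmem s ''m'' (enc n x c)
       then Suc c else nmem s ''par'' x))) (200 * Suc n) s"
proof -
  let ?m = "nmem s ''m''" and ?p = "nmem s ''par''"
  let ?I = "\<lambda>k s'. (\<forall>x<k. 0 < nmem s' ''m'' (enc n c x) \<longleftrightarrow> x \<in> nbh E n L c) \<and>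
    (\<forall>x y. y \<le> n \<longrightarrow> x \<noteq> c \<or> y = n \<longrightarrow> nmem s' ''m'' (enc n x y) = ?m (enc n x y)) \<and>
    (\<forall>x. nmem s' ''par'' x = (if x < k \<and> x \<in> L \<and> ?p x = 0 \<and> 0 < ?m (enc n x c) then Suc c else ?p x))"
  have loop: "wp record_vertex (?I n) (n * (150 + 13) + 10) s"
    unfolding record_vertex_def
  proof (rule wp_For[where I = ?I])
    show "nmem s ''n'' 0 = n" using base_n[OF b] .
    fix i s' assume i: "i < n" and I: "?I i s'" and x: "nmem s' ''x'' 0 = i"
      and fr: "frame (For ''x'' ''n'' (Seq (Cond (zero_test (NGet ''el'' (V ''x'')))
            (NSet ''m'' (idx (V ''cur'') (V ''x'')) (NGet ''h'' (idx (V ''cur'') (V ''x''))))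
            (NSet ''m'' (idx (V ''cur'') (V ''x'')) (NConst 0)))
       (Cond (BAnd (pos_test (NGet ''el'' (V ''x''))) (BAnd (zero_test (NGet ''par'' (V ''x'')))
               (pos_test (NGet ''m'' (idx (V ''x'') (V ''cur''))))))
          (NSet ''par'' (V ''x'') (NPlus (V ''cur'') (NConst 1))) Skip))) s s'"
    have b': "base n s'" using base_frame[OF b fr] by simp
    have eq: "nmem s' ''h'' = nmem s ''h''" "nmem s' ''el'' = nmem s ''el''" "nmem s' ''cur'' = nmem s ''cur''"
      using frameD(1)[OF fr] by simp_all
    note [simp] = mul_enc1[OF b']
    show "wp (Seq (Cond (zero_test (NGet ''el'' (V ''x'')))
            (NSet ''m'' (idx (V ''cur'') (V ''x'')) (NGet ''h'' (idx (V ''cur'') (V ''x''))))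
            (NSet ''m'' (idx (V ''cur'') (V ''x'')) (NConst 0)))
       (Cond (BAnd (pos_test (NGet ''el'' (V ''x''))) (BAnd (zero_test (NGet ''par'' (V ''x'')))
               (pos_test (NGet ''m'' (idx (V ''x'') (V ''cur''))))))
          (NSet ''par'' (V ''x'') (NPlus (V ''cur'') (NConst 1))) Skip)) (?I (Suc i)) 150 s'" (is "wp ?c _ _ _")
    proof (rule wp_den)
      have I1: "0 < nmem s' ''m'' (enc n c x) \<longleftrightarrow> x \<in> nbh E n L c" if "x < i" for x
        using I that by blast
      have I2: "nmem s' ''m'' (enc n x y) = ?m (enc n x y)" if "y \<le> n" "x \<noteq> c \<or> y = n" for x y
        using I that by blast
      have I3: "nmem s' ''par'' x = (if x < i \<and> x \<in> L \<and> ?p x = 0 \<and> 0 < ?m (enc n x c) then Suc c else ?p x)" for x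
        using I by blast
      show "?I (Suc i) (den ?c s')"
      proof (cases "i \<in> L")
        case True
        have ic: "i \<noteq> c" using True c(3) by auto
        have pi: "nmem s' ''par'' i = ?p i" using I3[of i] by simp
        have mi: "nmem s' ''m'' (enc n i c) = ?m (enc n i c)" using I2[of c i] ic c(2) by simp
        let ?s1 = "nstore ''m'' (enc n c i) 0 s'"
        have den: "den ?c s' = (if ?p i = 0 \<and> 0 < ?m (enc n i c) then nstore ''par'' i (Suc c) ?s1 else ?s1)"
          using L[OF i] True i c(1,2) x eq pi mi ic by simp
        have "i \<notin> nbh E n L c" using True by (simp add: nbh_def)
        moreover have m: "nmem (den ?c s') ''m'' = (nmem s' ''m'')(enc n c i := 0)" unfolding den by simp
        ultimately have "\<forall>x<Suc i. 0 < nmem (den ?c s') ''m'' (enc n c x) \<longleftrightarrow> x \<in> nbh E n L c"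
          unfolding m using I1 i by (auto simp: less_Suc_eq)
        moreover have "\<forall>x y. y \<le> n \<longrightarrow> x \<noteq> c \<or> y = n \<longrightarrow> nmem (den ?c s') ''m'' (enc n x y) = ?m (enc n x y)"
          unfolding m using I2 i by auto
        moreover have "nmem (den ?c s') ''par'' x =
            (if x < Suc i \<and> x \<in> L \<and> ?p x = 0 \<and> 0 < ?m (enc n x c) then Suc c else ?p x)" for x
          unfolding den using I3 True by (simp add: less_Suc_eq)
        ultimately show ?thesis by blast
      next
        case False
        have den: "den ?c s' = nstore ''m'' (enc n c i) (nmem s ''h'' (enc n c i)) s'"
          using L[OF i] False i c(1,2) x eq by simp
        have m: "nmem (den ?c s') ''m'' = (nmem s' ''m'')(enc n c i := nmem s ''h'' (enc n c i))"
          unfolding den by simp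
        have "0 < nmem s ''h'' (enc n c i) \<longleftrightarrow> i \<in> nbh E n L c"
          using matD[OF h c(2) i] False i by (simp add: nbh_def)
        then have "\<forall>x<Suc i. 0 < nmem (den ?c s') ''m'' (enc n c x) \<longleftrightarrow> x \<in> nbh E n L c"
          unfolding m using I1 i by (auto simp: less_Suc_eq)
        moreover have "\<forall>x y. y \<le> n \<longrightarrow> x \<noteq> c \<or> y = n \<longrightarrow> nmem (den ?c s') ''m'' (enc n x y) = ?m (enc n x y)"
          unfolding m using I2 i by auto
        moreover have "nmem (den ?c s') ''par'' x =
            (if x < Suc i \<and> x \<in> L \<and> ?p x = 0 \<and> 0 < ?m (enc n x c) then Suc c else ?p x)" for x
          unfolding den using I3 False by (auto simp: less_Suc_eq)
        ultimately show ?thesis by blast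
      qed
    qed simp_all
  qed auto
  show ?thesis by (rule wp_conseq[OF loop]) auto
qed

lemma wp_elim_step:
  assumes sym: "symp E" and E_less: "\<And>u v. E u v \<Longrightarrow> v < n"
    and b: "base n s" and I: "elim_inv E n i s" and i: "nmem s ''i'' 0 = i" "i < n"
  shows "wp elim_step (elim_inv E n (Suc i)) (3000 * Suc n ^ 4) s"
proof -
  define \<sigma> m par L where "\<sigma> = nmem s ''ord''" and "m = nmem s ''m''" and "par = nmem s ''par''"
    and "L = \<sigma> ` {..<i}"
  have inj: "inj_on \<sigma> {..<i}" and Ln: "L \<subseteq> {..<n}"
    and el: "\<And>x. x < n \<Longrightarrow> 0 < nmem s ''el'' x \<longleftrightarrow> x \<in> L"
    and h: "mat n (nmem s ''h'') (conn E L)"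
    and av: "\<And>j. j < i \<Longrightarrow> avoidable E (bag E n \<sigma> j)"
    and mb: "\<And>j x. j < i \<Longrightarrow> x < n \<Longrightarrow> 0 < m (enc n (\<sigma> j) x) \<longleftrightarrow> x \<in> bag E n \<sigma> j"
    and m0: "\<And>x. x < n \<Longrightarrow> m (enc n x n) = 0"
    and pu: "parents_upto E n \<sigma> par i"
    and p0: "\<And>x. x < n \<Longrightarrow> x \<notin> L \<Longrightarrow> par x = 0"
    using I unfolding elim_inv_def Let_def \<sigma>_def m_def par_def L_def by auto
  have "finite L" "card L < n"
    using i(2) card_image_le[of "{..<i}" \<sigma>] by (auto simp: L_def)
  then have ex: "\<exists>v<n. v \<notin> L \<and> avoidable E (nbh E n L v)" by (rule ex_avoidable_vertex[OF sym])
  let ?store = "NSet ''ord'' (V ''i'') (V ''cur'')"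
  let ?mark = "Seq (NSet ''el'' (V ''cur'') (NConst 1)) (setv ''k'' (V ''cur''))"
  show ?thesis
    unfolding elim_step_def
  proof (rule wp_SeqI[OF wp_search[OF E_less Ln b el h ex], where Bd = "900 * Suc n ^ 2"])
    fix s1 assume f1: "frame search s s1" and cc: "nmem s1 ''cur'' 0 < n \<and> nmem s1 ''cur'' 0 \<notin> L \<and>
      avoidable E (nbh E n L (nmem s1 ''cur'' 0))"
    define c where "c = nmem s1 ''cur'' 0"
    have c: "c < n" "c \<notin> L" "avoidable E (nbh E n L c)" using cc by (auto simp: c_def)
    define \<tau> where "\<tau> = \<sigma>(i := c)"
    have tau_im: "\<tau> ` {..<j} = \<sigma> ` {..<j}" if "j \<le> i" for j
      using that by (auto simp: \<tau>_def)
    have tau_i: "\<tau> i = c" by (simp add: \<tau>_def)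
    have tau_Suc: "\<tau> ` {..<Suc i} = insert c L"
      unfolding lessThan_Suc image_insert tau_i tau_im[OF order_refl] L_def ..
    have bagj: "bag E n \<tau> j = bag E n \<sigma> j" if "j < i" for j
      using that by (intro bag_cong) (simp add: \<tau>_def)
    have bagi: "bag E n \<tau> i = nbh E n L c"
      unfolding bag_nbh tau_i tau_im[OF order_refl] L_def ..
    have e1: "nmem s1 x = nmem s x" if "x \<notin> {''v'', ''k'', ''x'', ''y'', ''t'', ''good'', ''cur''}" for x
      using frameD(1)[OF f1] that by simp
    have b1: "base n s1" using base_frame[OF b f1] by simp
    let ?s2 = "nstore ''ord'' i c s1"
    have b2: "base n ?s2" using b1 by (simp add: base_def)
    have rec: "wp record_vertex (\<lambda>s'.
      (\<forall>x<n. 0 < nmem s' ''m'' (enc n c x) \<longleftrightarrow> x \<in> nbh E n L c) \<and>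
      (\<forall>x y. y \<le> n \<longrightarrow> x \<noteq> c \<or> y = n \<longrightarrow> nmem s' ''m'' (enc n x y) = nmem ?s2 ''m'' (enc n x y)) \<and>
      (\<forall>x. nmem s' ''par'' x = (if x < n \<and> x \<in> L \<and> nmem ?s2 ''par'' x = 0 \<and> 0 < nmem ?s2 ''m'' (enc n x c)
         then Suc c else nmem ?s2 ''par'' x))) (200 * Suc n) ?s2"
      using el h c by (intro wp_record_vertex[OF b2]) (auto simp: e1 c_def)
    have "wp (Seq record_vertex (Seq ?mark (pivot ''h''))) (elim_inv E n (Suc i)) (500 * Suc n ^ 2) ?s2"
    proof (rule wp_SeqI[OF rec, where Bd = "150 * Suc n ^ 2"])
      fix s3 assume f3: "frame record_vertex ?s2 s3" and r: "(\<forall>x<n. 0 < nmem s3 ''m'' (enc n c x) \<longleftrightarrow> x \<in> nbh E n L c) \<and>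
      (\<forall>x y. y \<le> n \<longrightarrow> x \<noteq> c \<or> y = n \<longrightarrow> nmem s3 ''m'' (enc n x y) = nmem ?s2 ''m'' (enc n x y)) \<and>
      (\<forall>x. nmem s3 ''par'' x = (if x < n \<and> x \<in> L \<and> nmem ?s2 ''par'' x = 0 \<and> 0 < nmem ?s2 ''m'' (enc n x c)
         then Suc c else nmem ?s2 ''par'' x))"
      have b3: "base n s3" using base_frame[OF b2 f3] by simp
      have e3: "nmem s3 x = nmem ?s2 x" if "x \<notin> {''x'', ''m'', ''par''}" for x
        using frameD(1)[OF f3] that by simp
      have k3: "nmem s3 ''cur'' 0 = c" "nmem s3 ''el'' = nmem s ''el''" "nmem s3 ''ord'' = \<tau>" "nmem s3 ''h'' = nmem s ''h''"
        using e3 e1 by (simp_all add: c_def \<tau>_def \<sigma>_def)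
      have mc: "\<And>x. x < n \<Longrightarrow> 0 < nmem s3 ''m'' (enc n c x) \<longleftrightarrow> x \<in> nbh E n L c"
        and mo: "\<And>x y. y \<le> n \<Longrightarrow> x \<noteq> c \<or> y = n \<Longrightarrow> nmem s3 ''m'' (enc n x y) = m (enc n x y)"
        and pp: "\<And>x. nmem s3 ''par'' x = (if x < n \<and> x \<in> L \<and> par x = 0 \<and> 0 < m (enc n x c) then Suc c else par x)"
        using r e1 by (auto simp: m_def par_def)
      let ?s4 = "nstore ''k'' 0 c (nstore ''el'' c 1 s3)"
      have b4: "base n ?s4" using b3 by (simp add: base_def)
      have piv: "wp (pivot ''h'') (\<lambda>s'. mat n (nmem s' ''h'') (\<lambda>x y. conn E L x y \<or> conn E L x c \<and> conn E L c y))
        (100 * Suc n ^ 2) ?s4"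
        using h k3 c by (intro wp_pivot[OF b4]) auto
      have "wp (pivot ''h'') (elim_inv E n (Suc i)) (100 * Suc n ^ 2) ?s4"
      proof (rule wp_conseq[OF piv])
        fix s5 assume f5: "frame (pivot ''h'') ?s4 s5"
          and h5: "mat n (nmem s5 ''h'') (\<lambda>x y. conn E L x y \<or> conn E L x c \<and> conn E L c y)"
        have e5: "nmem s5 ''ord'' = \<tau>" "nmem s5 ''m'' = nmem s3 ''m''" "nmem s5 ''par'' = nmem s3 ''par''"
          "nmem s5 ''el'' = (nmem s ''el'')(c := 1)"
          using frameD(1)[OF f5] k3 by simp_all
        have "inj_on \<tau> {..<Suc i}"
        proof -
          have "inj_on \<tau> {..<i}" using inj by (auto simp: inj_on_def \<tau>_def)
          moreover have "\<tau> i \<notin> \<tau> ` {..<i}"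
            using c(2) unfolding tau_i tau_im[OF order_refl] L_def .
          ultimately show ?thesis by (simp add: lessThan_Suc)
        qed
        moreover have "insert c L \<subseteq> {..<n}" using Ln c by auto
        moreover have "\<forall>x<n. 0 < nmem s5 ''el'' x \<longleftrightarrow> x \<in> insert c L" using el e5 by auto
        moreover have "mat n (nmem s5 ''h'') (conn E (insert c L))"
          by (rule mat_cong[OF h5]) (simp add: conn_insert)
        moreover have "\<forall>j<Suc i. avoidable E (bag E n \<tau> j)"
          using av bagj bagi c by (auto simp: less_Suc_eq)
        moreover have "\<forall>j<Suc i. \<forall>x<n. 0 < nmem s5 ''m'' (enc n (\<tau> j) x) \<longleftrightarrow> x \<in> bag E n \<tau> j"
        proof (intro allI impI)
          fix j x assume j: "j < Suc i" and x: "x < n"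
          show "0 < nmem s5 ''m'' (enc n (\<tau> j) x) \<longleftrightarrow> x \<in> bag E n \<tau> j"
          proof (cases "j = i")
            case True
            then show ?thesis using mc[OF x] bagi e5 by (simp add: \<tau>_def)
          next
            case False
            then have "j < i" "\<sigma> j \<noteq> c" using j c by (auto simp: L_def)
            then show ?thesis using mb[of j x] mo[of x "\<sigma> j"] x bagj e5 by (simp add: \<tau>_def)
          qed
        qed
        moreover have "\<forall>x<n. nmem s5 ''m'' (enc n x n) = 0" using mo m0 e5 by simp
        moreover have "parents_upto E n \<tau> (nmem s5 ''par'') (Suc i)"
          unfolding parents_upto_def
        proof (intro allI impI)
          fix j assume j: "j < Suc i"
          let ?par = "nmem s5 ''par''"
          show "?par (\<tau> j) = 0 \<and> (\<forall>l. j < l \<and> l < Suc i \<longrightarrow> \<tau> l \<notin> bag E n \<tau> j) \<or>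
            (\<exists>l>j. l < Suc i \<and> \<tau> l \<in> bag E n \<tau> j \<and> ?par (\<tau> j) = Suc (\<tau> l) \<and>
              (\<forall>k. j < k \<and> k < l \<longrightarrow> \<tau> k \<notin> bag E n \<tau> j))"
          proof (cases "j = i")
            case True
            then have "?par (\<tau> j) = 0" using pp[of c] c p0[of c] e5 by (simp add: \<tau>_def)
            then show ?thesis using True by auto
          next
            case False
            then have ji: "j < i" using j by simp
            then have tj: "\<tau> j = \<sigma> j" "\<sigma> j \<in> L" "\<sigma> j < n" using Ln by (auto simp: \<tau>_def L_def)
            note mj = mb[OF ji c(1)]
            from pu[unfolded parents_upto_def, rule_format, OF ji] consider
              "par (\<sigma> j) = 0" "\<forall>l. j < l \<and> l < i \<longrightarrow> \<sigma> l \<notin> bag E n \<sigma> j"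
              | l where "j < l" "l < i" "\<sigma> l \<in> bag E n \<sigma> j" "par (\<sigma> j) = Suc (\<sigma> l)"
                "\<forall>k. j < k \<and> k < l \<longrightarrow> \<sigma> k \<notin> bag E n \<sigma> j"
              by (elim disjE conjE exE) blast+
            then show ?thesis
            proof cases
              case 1
              show ?thesis
              proof (cases "c \<in> bag E n \<sigma> j")
                case True
                then have "?par (\<tau> j) = Suc (\<tau> i)" using pp[of "\<sigma> j"] e5 tj mj 1(1) by (simp add: \<tau>_def)
                moreover have "\<tau> i \<in> bag E n \<tau> j" using True bagj[OF ji] by (simp add: \<tau>_def)
                moreover have "\<forall>k. j < k \<and> k < i \<longrightarrow> \<tau> k \<notin> bag E n \<tau> j"
                  using 1(2) bagj[OF ji] by (simp add: \<tau>_def)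
                ultimately show ?thesis using ji by blast
              next
                case F: False
                then have "?par (\<tau> j) = 0" using pp[of "\<sigma> j"] e5 tj mj 1(1) by simp
                moreover have "\<forall>l. j < l \<and> l < Suc i \<longrightarrow> \<tau> l \<notin> bag E n \<tau> j"
                  using 1(2) bagj[OF ji] F by (auto simp: \<tau>_def less_Suc_eq)
                ultimately show ?thesis by blast
              qed
            next
              case (2 l)
              have "?par (\<tau> j) = Suc (\<tau> l)" using pp[of "\<sigma> j"] e5 tj 2 by (simp add: \<tau>_def)
              moreover have "\<tau> l \<in> bag E n \<tau> j" using 2 bagj[OF ji] by (simp add: \<tau>_def)
              moreover have "\<forall>k. j < k \<and> k < l \<longrightarrow> \<tau> k \<notin> bag E n \<tau> j"
                using 2 bagj[OF ji] by (simp add: \<tau>_def)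
              ultimately show ?thesis using 2(1,2) by (intro disjI2 exI[of _ l]) simp
            qed
          qed
        qed
        moreover have "\<forall>x<n. x \<notin> insert c L \<longrightarrow> nmem s5 ''par'' x = 0" using pp p0 e5 by simp
        ultimately show "elim_inv E n (Suc i) s5"
          unfolding elim_inv_def Let_def e5(1) tau_Suc by blast
      qed simp
      then have "wp (pivot ''h'') (elim_inv E n (Suc i)) (100 * Suc n ^ 2) (den ?mark s3)"
        using k3 by simp
      then show "wp (Seq ?mark (pivot ''h'')) (elim_inv E n (Suc i)) (150 * Suc n ^ 2) s3"
      proof (rule wp_den_Seq[rotated])
        show "1 + ccost ?mark + 100 * Suc n ^ 2 \<le> 150 * Suc n ^ 2" by (rule const_cost) simp_all
      qed simp
    next
      have sq: "1 + 200 * N + 150 * N ^ 2 \<le> 500 * N ^ 2" if "1 \<le> N" for N :: nat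
      proof -
        have "N \<le> N ^ 2" "1 \<le> N ^ 2" using that by (simp_all add: power2_eq_square)
        then show ?thesis by linarith
      qed
      show "1 + 200 * Suc n + 150 * Suc n ^ 2 \<le> 500 * Suc n ^ 2" by (rule sq) simp
    qed
    then have "wp (Seq record_vertex (Seq ?mark (pivot ''h''))) (elim_inv E n (Suc i)) (500 * Suc n ^ 2) (den ?store s1)"
      using e1[of "''i''"] i(1) by (simp add: c_def)
    then show "wp (Seq ?store (Seq record_vertex (Seq ?mark (pivot ''h'')))) (elim_inv E n (Suc i)) (900 * Suc n ^ 2) s1"
    proof (rule wp_den_Seq[rotated])
      show "1 + ccost ?store + 500 * Suc n ^ 2 \<le> 900 * Suc n ^ 2" by (rule const_cost) simp_all
    qed simp
  next
    have "Suc n ^ 2 \<le> Suc n ^ 4" "1 \<le> Suc n ^ 4" by (auto intro: power_increasing)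
    then show "1 + 2000 * Suc n ^ 4 + 900 * Suc n ^ 2 \<le> 3000 * Suc n ^ 4" by linarith
  qed
qed

lemma wp_elim:
  assumes sym: "symp E" and E_less: "\<And>u v. E u v \<Longrightarrow> v < n"
    and b: "base n s" and I: "elim_inv E n 0 s"
  shows "wp elim (elim_inv E n n) (4000 * Suc n ^ 5) s"
proof -
  have loop: "wp elim (elim_inv E n n) (n * (3000 * Suc n ^ 4 + 13) + 10) s"
    unfolding elim_def
  proof (rule wp_For[where I = "elim_inv E n"])
    show "nmem s ''n'' 0 = n" using base_n[OF b] .
    fix i s' assume "i < n" "elim_inv E n i s'" "nmem s' ''i'' 0 = i" and fr: "frame (For ''i'' ''n'' elim_step) s s'"
    then show "wp elim_step (elim_inv E n (Suc i)) (3000 * Suc n ^ 4) s'"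
      using base_frame[OF b fr] by (intro wp_elim_step[OF sym E_less]) auto
  qed (use I in \<open>auto simp: elim_inv_def\<close>)
  have "n * (3000 * Suc n ^ 4 + 13) + 10 \<le> (3000 + 23) * Suc n ^ Suc 4" by (rule loop_cost) auto
  also have "\<dots> \<le> 4000 * Suc n ^ 5" by simp
  finally show ?thesis using wp_mono[OF loop] by blast
qed

section \<open>The dynamic program\<close>

abbreviation eq_test :: "nexp \<Rightarrow> nexp \<Rightarrow> bexp" where
  "eq_test a b \<equiv> BAnd (BNot (NLess a b)) (BNot (NLess b a))"

abbreviation idx4 :: "nexp \<Rightarrow> nexp \<Rightarrow> nexp \<Rightarrow> nexp \<Rightarrow> nexp" where
  "idx4 v a b c \<equiv> idx (idx (idx v a) b) c"

abbreviation qvar :: "string \<Rightarrow> qexp" where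
  "qvar x \<equiv> QGet x (NConst 0)"

definition enc4 :: "nat \<Rightarrow> nat \<Rightarrow> nat \<Rightarrow> nat \<Rightarrow> nat \<Rightarrow> nat" where
  "enc4 n v a b c = enc n (enc n (enc n v a) b) c"

lemma enc4_inj [simp]:
  assumes "a \<le> n" "b \<le> n" "c \<le> n" "a' \<le> n" "b' \<le> n" "c' \<le> n"
  shows "enc4 n v a b c = enc4 n v' a' b' c' \<longleftrightarrow> v = v' \<and> a = a' \<and> b = b' \<and> c = c'"
  using assms by (auto simp: enc4_def)

text \<open>The three nested lookups have arguments below the first, second and third power of
  \<open>n + 1\<close>. This is why the product table has \<open>(n + 1)^3\<close> entries.\<close>

lemma mul_enc4:
  assumes b: "base n s" and le: "v \<le> n" "a \<le> n" "b \<le> n"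
  shows "nmem s ''mul'' (nmem s ''mul'' (nmem s ''mul'' v + a) + b) + c = enc4 n v a b c"
proof -
  have 2: "enc n v a < Suc n ^ Suc 1" using le by (intro enc_bound) auto
  have 3: "enc n (enc n v a) b < Suc n ^ 3"
    using enc_bound[OF 2 le(3)] by (simp add: numeral_3_eq_3)
  have "enc n v a < Suc n ^ 3"
    by (rule less_le_trans[OF 2]) (rule power_increasing, simp_all)
  then show ?thesis
    using mul_enc[OF b 3] mul_enc[OF b] mul_enc1[OF b le(1)] by (simp add: enc4_def)
qed

section \<open>Computing a single table entry\<close>

definition child_sum :: "string \<Rightarrow> string \<Rightarrow> string \<Rightarrow> string \<Rightarrow> com" where
  "child_sum a b c acc = For ''x'' ''n''
     (Cond (eq_test (NGet ''par'' (V ''x'')) (NPlus (V ''v'') (NConst 1)))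
       (QSet acc (NConst 0) (QPlus (qvar acc) (QGet ''F'' (idx4 (V ''x'') (V a) (V b) (V c))))) Skip)"

definition slot :: com where
  "slot = Seq (Seq (setv ''a2'' (V ''a'')) (Seq (setv ''b2'' (V ''b'')) (Seq (setv ''c2'' (V ''c'')) (setv ''ok'' (NConst 1)))))
    (Cond (BAnd (zero_test (NGet ''g'' (idx (V ''v'') (V ''a''))))
        (BAnd (zero_test (NGet ''g'' (idx (V ''v'') (V ''b'')))) (zero_test (NGet ''g'' (idx (V ''v'') (V ''c''))))))
      (Cond (zero_test (NGet ''m'' (idx (V ''v'') (V ''a'')))) (setv ''a2'' (V ''v''))
        (Cond (zero_test (NGet ''m'' (idx (V ''v'') (V ''b'')))) (setv ''b2'' (V ''v''))
          (Cond (zero_test (NGet ''m'' (idx (V ''v'') (V ''c'')))) (setv ''c2'' (V ''v''))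
            (setv ''ok'' (NConst 0)))))
      (setv ''ok'' (NConst 0)))"

definition store_entry :: com where
  "store_entry = Cond (BAnd (pos_test (V ''ok'')) (QLess (qvar ''off'') (qvar ''on'')))
     (Seq (QSet ''F'' (idx4 (V ''v'') (V ''a'') (V ''b'') (V ''c'')) (qvar ''on''))
       (NSet ''d'' (idx4 (V ''v'') (V ''a'') (V ''b'') (V ''c'')) (NConst 1)))
     (Seq (QSet ''F'' (idx4 (V ''v'') (V ''a'') (V ''b'') (V ''c'')) (qvar ''off''))
       (NSet ''d'' (idx4 (V ''v'') (V ''a'') (V ''b'') (V ''c'')) (NConst 0)))"

text \<open>
  If there is no free slot, the second sum is computed from meaningless entries and then ignored.
\<close>

definition entry :: com where
  "entry = Seq (QSet ''off'' (NConst 0) (QConst 0)) (Seq (child_sum ''a'' ''b'' ''c'' ''off'')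
     (Seq (Seq slot (QSet ''on'' (NConst 0) (QGet ''w'' (V ''v''))))
       (Seq (child_sum ''a2'' ''b2'' ''c2'' ''on'') store_entry)))"

definition row :: com where
  "row = For ''a'' ''N'' (For ''b'' ''N'' (For ''c'' ''N'' entry))"

definition table :: com where
  "table = For ''i'' ''n'' (Seq (setv ''v'' (NGet ''ord'' (V ''i''))) row)"

lemma mods_table [simp]:
  "nmods (child_sum a b c acc) = {''x''}" "qmods (child_sum a b c acc) = {acc}"
  "nmods slot = {''a2'', ''b2'', ''c2'', ''ok''}" "qmods slot = {}"
  "nmods store_entry = {''d''}" "qmods store_entry = {''F''}"
  "nmods entry = {''x'', ''a2'', ''b2'', ''c2'', ''ok'', ''d''}" "qmods entry = {''off'', ''on'', ''F''}"
  "nmods row = {''a'', ''b'', ''c'', ''x'', ''a2'', ''b2'', ''c2'', ''ok'', ''d''}" "qmods row = {''off'', ''on'', ''F''}"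
  "nmods table = {''i'', ''v'', ''a'', ''b'', ''c'', ''x'', ''a2'', ''b2'', ''c2'', ''ok'', ''d''}"
  "qmods table = {''off'', ''on'', ''F''}"
  by (auto simp: child_sum_def slot_def store_entry_def entry_def row_def table_def)

definition children :: "nat \<Rightarrow> (nat \<Rightarrow> nat) \<Rightarrow> nat \<Rightarrow> nat set" where
  "children n par p = {x. x < n \<and> par x = p}"

definition tab :: "nat \<Rightarrow> (nat \<Rightarrow> 'b) \<Rightarrow> nat \<Rightarrow> nat \<times> nat \<times> nat \<Rightarrow> 'b" where
  "tab n f v = (\<lambda>(a, b, c). f (enc4 n v a b c))"

lemma wp_child_sum:
  assumes b: "base n s" and ne: "{a, b, c} \<inter> {''x'', ''n'', ''N'', ''mul''} = {}" "acc \<noteq> ''F''"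
    and v: "nmem s ''v'' 0 = v"
    and le: "nmem s a 0 \<le> n" "nmem s b 0 \<le> n" "nmem s c 0 \<le> n"
  shows "wp (child_sum a b c acc) (\<lambda>s'. qmem s' acc 0 = qmem s acc 0 +
      (\<Sum>x\<in>children n (nmem s ''par'') (Suc v). tab n (qmem s ''F'') x (nmem s a 0, nmem s b 0, nmem s c 0)))
    (100 * Suc n) s"
proof -
  let ?t = "(nmem s a 0, nmem s b 0, nmem s c 0)"
  let ?I = "\<lambda>i s'. qmem s' acc 0 = qmem s acc 0 +
    (\<Sum>x\<in>children i (nmem s ''par'') (Suc v). tab n (qmem s ''F'') x ?t)"
  let ?c = "Cond (eq_test (NGet ''par'' (V ''x'')) (NPlus (V ''v'') (NConst 1)))
       (QSet acc (NConst 0) (QPlus (qvar acc) (QGet ''F'' (idx4 (V ''x'') (V a) (V b) (V c))))) Skip"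
  have loop: "wp (child_sum a b c acc) (?I n) (n * (77 + 13) + 10) s"
    unfolding child_sum_def
  proof (rule wp_For[where I = ?I])
    show "nmem s ''n'' 0 = n" using base_n[OF b] .
    show "?I 0 s" by (simp add: children_def)
    fix i s' assume i: "i < n" and I: "?I i s'" and x: "nmem s' ''x'' 0 = i"
      and fr: "frame (For ''x'' ''n'' ?c) s s'"
    have b': "base n s'" using base_frame[OF b fr] by simp
    have eq: "nmem s' ''par'' = nmem s ''par''" "nmem s' ''v'' = nmem s ''v''" "qmem s' ''F'' = qmem s ''F''"
      "nmem s' a = nmem s a" "nmem s' b = nmem s b" "nmem s' c = nmem s c"
      using frameD[OF fr] ne by auto
    have e4: "nmem s' ''mul'' (nmem s' ''mul'' (nmem s' ''mul'' i + nmem s a 0) + nmem s b 0) + nmem s c 0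
        = enc4 n i (nmem s a 0) (nmem s b 0) (nmem s c 0)"
      using mul_enc4[OF b'] i le by simp
    have fin: "finite (children i (nmem s ''par'') (Suc v))" by (simp add: children_def)
    have chS: "children (Suc i) (nmem s ''par'') (Suc v) =
      (if nmem s ''par'' i = Suc v then insert i (children i (nmem s ''par'') (Suc v)) else children i (nmem s ''par'') (Suc v))"
      by (auto simp: children_def less_Suc_eq)
    have ni: "i \<notin> children i (nmem s ''par'') (Suc v)" by (simp add: children_def)
    have bv: "bval (eq_test (NGet ''par'' (V ''x'')) (NPlus (V ''v'') (NConst 1))) s' \<longleftrightarrow> nmem s ''par'' i = Suc v"
      using x v eq by auto
    show "wp ?c (?I (Suc i)) 77 s'"
    proof (rule wp_den)
      show "?I (Suc i) (den ?c s')"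
      proof (cases "nmem s ''par'' i = Suc v")
        case True
        then have "den ?c s' = qstore acc 0 (qmem s' acc 0 + qmem s ''F'' (enc4 n i (nmem s a 0) (nmem s b 0) (nmem s c 0))) s'"
          using bv x eq e4 by simp
        then show ?thesis using I True chS fin ni by (simp add: tab_def)
      next
        case False
        then have "den ?c s' = s'" using bv by auto
        then show ?thesis using I False chS by simp
      qed
    qed simp_all
  qed (use ne in auto)
  show ?thesis by (rule wp_conseq[OF loop]) auto
qed

definition adj_ok :: "(nat \<Rightarrow> nat \<Rightarrow> bool) \<Rightarrow> (nat \<Rightarrow> nat \<Rightarrow> bool) \<Rightarrow> nat \<Rightarrow> memory \<Rightarrow> bool" where
  "adj_ok E M n s \<longleftrightarrow> (\<forall>v<n. \<forall>x\<le>n. (0 < nmem s ''g'' (enc n v x) \<longleftrightarrow> E v x) \<and> (0 < nmem s ''m'' (enc n v x) \<longleftrightarrow> M v x))"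

text \<open>The bounds on the new components are claimed even if there is no free slot, because the
  second child sum is evaluated in that case too and must address the table within range.\<close>

lemma den_slot:
  assumes b: "base n s" and g: "adj_ok E M n s" and v: "nmem s ''v'' 0 = v" "v < n"
    and t: "nmem s ''a'' 0 = a" "nmem s ''b'' 0 = b" "nmem s ''c'' 0 = c" and le: "a \<le> n" "b \<le> n" "c \<le> n"
  defines "s' \<equiv> den slot s"
  shows "case put_slot E M v (a, b, c) of
      None \<Rightarrow> nmem s' ''ok'' 0 = 0
    | Some t' \<Rightarrow> nmem s' ''ok'' 0 = 1 \<and> t' = (nmem s' ''a2'' 0, nmem s' ''b2'' 0, nmem s' ''c2'' 0)"
    "nmem s' ''a2'' 0 \<le> n" "nmem s' ''b2'' 0 \<le> n" "nmem s' ''c2'' 0 \<le> n"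
proof -
  note [simp] = mul_enc1[OF b]
  have E: "0 < nmem s ''g'' (enc n v x) \<longleftrightarrow> E v x" "0 < nmem s ''m'' (enc n v x) \<longleftrightarrow> M v x" if "x \<le> n" for x
    using g v(2) that by (auto simp: adj_ok_def)
  let ?s1 = "nstore ''ok'' 0 1 (nstore ''c2'' 0 c (nstore ''b2'' 0 b (nstore ''a2'' 0 a s)))"
  have "s' = (if E v a \<or> E v b \<or> E v c then nstore ''ok'' 0 0 ?s1
     else if \<not> M v a then nstore ''a2'' 0 v ?s1
     else if \<not> M v b then nstore ''b2'' 0 v ?s1
     else if \<not> M v c then nstore ''c2'' 0 v ?s1
     else nstore ''ok'' 0 0 ?s1)"
    unfolding s'_def slot_def using v t le E by (simp del: neq0_conv)
  then show "case put_slot E M v (a, b, c) of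
      None \<Rightarrow> nmem s' ''ok'' 0 = 0
    | Some t' \<Rightarrow> nmem s' ''ok'' 0 = 1 \<and> t' = (nmem s' ''a2'' 0, nmem s' ''b2'' 0, nmem s' ''c2'' 0)"
    "nmem s' ''a2'' 0 \<le> n" "nmem s' ''b2'' 0 \<le> n" "nmem s' ''c2'' 0 \<le> n"
    using le v by (auto simp: put_slot_def)
qed

lemma table_eq_cong:
  assumes "f' u t = f u t" "d' u t = d u t"
    and "\<And>c. c \<in> ch (Suc u) \<Longrightarrow> f' c t = f c t"
    and "\<And>c t'. c \<in> ch (Suc u) \<Longrightarrow> put_slot E M u t = Some t' \<Longrightarrow> f' c t' = f c t'"
  shows "table_eq E M ch w f' d' u t \<longleftrightarrow> table_eq E M ch w f d u t"
  using assms by (auto simp: table_eq_def Let_def split: option.splits cong: sum.cong)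

section \<open>Filling the table in elimination order\<close>

definition triples :: "nat \<Rightarrow> (nat \<times> nat \<times> nat) set" where
  "triples n = {..n} \<times> {..n} \<times> {..n}"

lemma tab_upd:
  assumes "t \<in> triples n" "(a, b, c) \<in> triples n"
  shows "tab n (f(enc4 n v a b c := y)) x t = (if x = v \<and> t = (a, b, c) then y else tab n f x t)"
  using assms by (cases t) (simp add: tab_def triples_def)

lemma put_slot_triples:
  "put_slot E M v t = Some t' \<Longrightarrow> t \<in> triples n \<Longrightarrow> v < n \<Longrightarrow> t' \<in> triples n"
  by (cases t) (auto simp: put_slot_def triples_def split: if_splits)

text \<open>An arbitrary set of finished entries is used, so that every loop around the computation
  of an entry merely enlarges it.\<close>

definition rows_ok ::
  "(nat \<Rightarrow> nat \<Rightarrow> bool) \<Rightarrow> (nat \<Rightarrow> nat \<Rightarrow> bool) \<Rightarrow> nat \<Rightarrow> (nat \<Rightarrow> nat) \<Rightarrow> (nat \<Rightarrow> rat) \<Rightarrow> memory \<Rightarrow>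
   (nat \<times> nat \<times> nat \<times> nat) set \<Rightarrow> bool" where
  "rows_ok E M n par w s X \<longleftrightarrow> (\<forall>(u, t)\<in>X. table_eq E M (children n par) w
     (tab n (qmem s ''F'')) (\<lambda>v t. 0 < tab n (nmem s ''d'') v t) u t)"

definition ctx ::
  "(nat \<Rightarrow> nat \<Rightarrow> bool) \<Rightarrow> (nat \<Rightarrow> nat \<Rightarrow> bool) \<Rightarrow> nat \<Rightarrow> (nat \<Rightarrow> nat) \<Rightarrow> (nat \<Rightarrow> rat) \<Rightarrow> nat \<Rightarrow> memory \<Rightarrow> bool" where
  "ctx E M n par w v s \<longleftrightarrow> base n s \<and> adj_ok E M n s \<and> nmem s ''par'' = par \<and>
     qmem s ''w'' = w \<and> nmem s ''v'' 0 = v"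

lemma ctx_frame:
  assumes "ctx E M n par w v s" "frame c s s'"
    and "{''n'', ''N'', ''mul'', ''g'', ''m'', ''par'', ''v''} \<inter> nmods c = {}" "''w'' \<notin> qmods c"
  shows "ctx E M n par w v s'"
  using assms base_frame[of n s c s'] by (auto simp: ctx_def adj_ok_def frame_def)

text \<open>The equation at \<open>u\<close> reads only entries of \<open>u\<close> and of its
  children. As \<open>v\<close> is no child of a vertex in \<open>X\<close>, writing its entry for
  \<open>t0\<close> leaves all other finished equations intact, by injectivity of the
  addresses.\<close>

lemma rows_ok_update:
  assumes tt: "t0 \<in> triples n" and v: "v < n" and t0: "t0 = (a, b, c)"
    and X: "\<And>u t. (u, t) \<in> X \<Longrightarrow> u < n \<and> t \<in> triples n \<and> v \<notin> children n par (Suc u)"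
    and vv: "v \<notin> children n par (Suc v)"
    and rows: "rows_ok E M n par w s X"
    and F: "qmem s' ''F'' = (qmem s ''F'')(enc4 n v a b c := y)"
    and d: "nmem s' ''d'' = (nmem s ''d'')(enc4 n v a b c := if hit then 1 else 0)"
    and y: "case put_slot E M v t0 of
        None \<Rightarrow> \<not> hit \<and> y = (\<Sum>x\<in>children n par (Suc v). tab n (qmem s ''F'') x t0)
      | Some t' \<Rightarrow> let off = \<Sum>x\<in>children n par (Suc v). tab n (qmem s ''F'') x t0;
          on = w v + (\<Sum>x\<in>children n par (Suc v). tab n (qmem s ''F'') x t')
        in (hit \<longleftrightarrow> off < on) \<and> y = (if off < on then on else off)"
  shows "rows_ok E M n par w s' (insert (v, t0) X)"
proof -
  let ?f = "tab n (qmem s ''F'')" and ?f' = "tab n (qmem s' ''F'')"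
  have same: "?f' x t = ?f x t" if "x \<noteq> v" "t \<in> triples n" for x t
    unfolding F tab_upd[OF that(2) tt[unfolded t0]] using that(1) by simp
  have "table_eq E M (children n par) w ?f' (\<lambda>v t. 0 < tab n (nmem s' ''d'') v t) v t0"
  proof -
    have nv: "x \<noteq> v" if "x \<in> children n par (Suc v)" for x using vv that by auto
    have offs: "(\<Sum>x\<in>children n par (Suc v). ?f' x t) = (\<Sum>x\<in>children n par (Suc v). ?f x t)"
      if "t \<in> triples n" for t
      using same[OF nv that] by simp
    have dv: "0 < tab n (nmem s' ''d'') v t0 \<longleftrightarrow> hit"
      unfolding d tab_upd[OF tt tt[unfolded t0]] using t0 by simp
    have Fv: "?f' v t0 = y"
      unfolding F tab_upd[OF tt tt[unfolded t0]] using t0 by simp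
    show ?thesis
    proof (cases "put_slot E M v t0")
      case None
      then show ?thesis using y offs[OF tt] dv Fv by (simp add: table_eq_def)
    next
      case (Some t')
      then show ?thesis
        using y offs[OF tt] dv Fv offs[OF put_slot_triples[OF Some tt v]]
        by (simp add: table_eq_def Let_def)
    qed
  qed
  moreover have "table_eq E M (children n par) w ?f' (\<lambda>v t. 0 < tab n (nmem s' ''d'') v t) u t"
    if ut: "(u, t) \<in> X" "(u, t) \<noteq> (v, t0)" for u t
  proof -
    have u: "u < n" "t \<in> triples n" "v \<notin> children n par (Suc u)" using X[OF ut(1)] by auto
    have old: "table_eq E M (children n par) w ?f (\<lambda>v t. 0 < tab n (nmem s ''d'') v t) u t"
      using rows ut(1) unfolding rows_ok_def by blast
    show ?thesis
    proof (rule table_eq_cong[THEN iffD2, OF _ _ _ _ old])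
      show "?f' u t = ?f u t"
        unfolding F tab_upd[OF u(2) tt[unfolded t0]] using ut(2) t0 by auto
      show "(0 < tab n (nmem s' ''d'') u t) = (0 < tab n (nmem s ''d'') u t)"
        unfolding d tab_upd[OF u(2) tt[unfolded t0]] using ut(2) t0 by auto
      show "?f' x t = ?f x t" if "x \<in> children n par (Suc u)" for x
        using same[OF _ u(2), of x] u(3) that by blast
      show "?f' x t' = ?f x t'" if "x \<in> children n par (Suc u)" "put_slot E M u t = Some t'" for x t'
        using same[OF _ put_slot_triples[OF that(2) u(2,1)], of x] u(3) that by blast
    qed
  qed
  ultimately show ?thesis unfolding rows_ok_def by blast
qed

lemma wp_entry:
  assumes cx: "ctx E M n par w v s" and v: "v < n"
    and t: "nmem s ''a'' 0 = a" "nmem s ''b'' 0 = b" "nmem s ''c'' 0 = c" and le: "a \<le> n" "b \<le> n" "c \<le> n"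
    and X: "\<And>u t. (u, t) \<in> X \<Longrightarrow> u < n \<and> t \<in> triples n \<and> v \<notin> children n par (Suc u)"
    and vv: "v \<notin> children n par (Suc v)"
    and rows: "rows_ok E M n par w s X"
  shows "wp entry (\<lambda>s'. rows_ok E M n par w s' (insert (v, a, b, c) X)) (500 * Suc n) s"
proof -
  let ?f = "tab n (qmem s ''F'')"
  let ?off = "\<Sum>x\<in>children n par (Suc v). ?f x (a, b, c)"
  let ?Q = "\<lambda>s'. rows_ok E M n par w s' (insert (v, a, b, c) X)"
  let ?mid = "Seq slot (QSet ''on'' (NConst 0) (QGet ''w'' (V ''v'')))"
  have b: "base n s" and ag: "adj_ok E M n s" and par: "nmem s ''par'' = par" and w: "qmem s ''w'' = w"
    and vs: "nmem s ''v'' 0 = v"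
    using cx by (auto simp: ctx_def)
  let ?s1 = "qstore ''off'' 0 0 s"
  have b1: "base n ?s1" using b by (simp add: base_def)
  have cs1: "wp (child_sum ''a'' ''b'' ''c'' ''off'') (\<lambda>s'. qmem s' ''off'' 0 = qmem ?s1 ''off'' 0 +
      (\<Sum>x\<in>children n (nmem ?s1 ''par'') (Suc v). tab n (qmem ?s1 ''F'') x (nmem ?s1 ''a'' 0, nmem ?s1 ''b'' 0, nmem ?s1 ''c'' 0)))
    (100 * Suc n) ?s1"
    by (rule wp_child_sum[OF b1]) (use vs t le in auto)
  have "wp (Seq (child_sum ''a'' ''b'' ''c'' ''off'') (Seq ?mid (Seq (child_sum ''a2'' ''b2'' ''c2'' ''on'') store_entry))) ?Q
    (480 * Suc n) ?s1"
  proof (rule wp_SeqI[OF cs1, where Bd = "370 * Suc n"])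
    fix s2 assume f2: "frame (child_sum ''a'' ''b'' ''c'' ''off'') ?s1 s2"
      and "qmem s2 ''off'' 0 = qmem ?s1 ''off'' 0 +
      (\<Sum>x\<in>children n (nmem ?s1 ''par'') (Suc v). tab n (qmem ?s1 ''F'') x (nmem ?s1 ''a'' 0, nmem ?s1 ''b'' 0, nmem ?s1 ''c'' 0))"
    then have off2: "qmem s2 ''off'' 0 = ?off" using par t by simp
    have e2: "nmem s2 x = nmem s x" if "x \<noteq> ''x''" for x using frameD(1)[OF f2] that by simp
    have q2: "qmem s2 x = qmem s x" if "x \<noteq> ''off''" for x using frameD(2)[OF f2] that by simp
    have b2: "base n s2" using base_frame[OF b1 f2] by simp
    have ag2: "adj_ok E M n s2" using ag e2 by (simp add: adj_ok_def)
    define s3 where "s3 = den slot s2"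
    have "loop_free slot" by (simp add: slot_def)
    then have f3: "frame slot s2 s3"
      using wp_den_aux[of slot s2] exec_frame unfolding wp_def s3_def by blast
    have sl: "case put_slot E M v (a, b, c) of
      None \<Rightarrow> nmem s3 ''ok'' 0 = 0
      | Some t' \<Rightarrow> nmem s3 ''ok'' 0 = 1 \<and> t' = (nmem s3 ''a2'' 0, nmem s3 ''b2'' 0, nmem s3 ''c2'' 0)"
      and le3: "nmem s3 ''a2'' 0 \<le> n" "nmem s3 ''b2'' 0 \<le> n" "nmem s3 ''c2'' 0 \<le> n"
      using den_slot[OF b2 ag2 _ v, of a b c] e2 vs t le unfolding s3_def by auto
    have e3: "nmem s3 x = nmem s x" if "x \<notin> {''x'', ''a2'', ''b2'', ''c2'', ''ok''}" for x
      using frameD(1)[OF f3, of x] e2[of x] that by simp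
    have q3: "qmem s3 = qmem s2" using frameD(2)[OF f3] by auto
    have b3: "base n s3" using base_frame[OF b2 f3] by simp
    let ?s4 = "qstore ''on'' 0 (w v) s3"
    let ?t' = "(nmem s3 ''a2'' 0, nmem s3 ''b2'' 0, nmem s3 ''c2'' 0)"
    let ?on = "w v + (\<Sum>x\<in>children n par (Suc v). ?f x ?t')"
    have b4: "base n ?s4" using b3 by (simp add: base_def)
    have cs4: "wp (child_sum ''a2'' ''b2'' ''c2'' ''on'') (\<lambda>s'. qmem s' ''on'' 0 = qmem ?s4 ''on'' 0 +
      (\<Sum>x\<in>children n (nmem ?s4 ''par'') (Suc v). tab n (qmem ?s4 ''F'') x (nmem ?s4 ''a2'' 0, nmem ?s4 ''b2'' 0, nmem ?s4 ''c2'' 0)))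
      (100 * Suc n) ?s4"
      by (rule wp_child_sum[OF b4]) (use e3 vs le3 in auto)
    have "wp (Seq (child_sum ''a2'' ''b2'' ''c2'' ''on'') store_entry) ?Q (250 * Suc n) ?s4"
    proof (rule wp_SeqI[OF cs4, where Bd = 100])
      fix s5 assume f5: "frame (child_sum ''a2'' ''b2'' ''c2'' ''on'') ?s4 s5"
        and "qmem s5 ''on'' 0 = qmem ?s4 ''on'' 0 +
      (\<Sum>x\<in>children n (nmem ?s4 ''par'') (Suc v). tab n (qmem ?s4 ''F'') x (nmem ?s4 ''a2'' 0, nmem ?s4 ''b2'' 0, nmem ?s4 ''c2'' 0))"
      then have on5: "qmem s5 ''on'' 0 = ?on"
        using e3 q3 q2 par by simp
      have e5: "nmem s5 x = nmem s3 x" if "x \<noteq> ''x''" for x using frameD(1)[OF f5] that by simp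
      have q5: "qmem s5 x = qmem s2 x" if "x \<noteq> ''on''" for x using frameD(2)[OF f5] q3 that by simp
      have b5: "base n s5" using base_frame[OF b4 f5] by simp
      let ?e = "enc4 n v a b c"
      have e4: "nmem s5 ''mul'' (nmem s5 ''mul'' (nmem s5 ''mul'' v + a) + b) + c = ?e"
        using mul_enc4[OF b5] v le by simp
      have n5: "nmem s5 ''v'' 0 = v" "nmem s5 ''a'' 0 = a" "nmem s5 ''b'' 0 = b" "nmem s5 ''c'' 0 = c"
        "nmem s5 ''ok'' 0 = nmem s3 ''ok'' 0" "qmem s5 ''off'' 0 = ?off"
        using e5 e3 vs t q5 off2 by simp_all
      define hit where "hit \<longleftrightarrow> 0 < nmem s3 ''ok'' 0 \<and> ?off < ?on"
      have st: "den store_entry s5 = (if hit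
          then nstore ''d'' ?e 1 (qstore ''F'' ?e ?on s5)
          else nstore ''d'' ?e 0 (qstore ''F'' ?e ?off s5))"
        unfolding store_entry_def hit_def by (simp add: e4 n5 on5 del: neq0_conv)
      show "wp store_entry ?Q 100 s5"
      proof (rule wp_den)
        show "?Q (den store_entry s5)"
        proof (rule rows_ok_update[OF _ v refl X vv rows])
          show "(a, b, c) \<in> triples n" using le by (simp add: triples_def)
          show "qmem (den store_entry s5) ''F'' = (qmem s ''F'')(?e := if hit then ?on else ?off)"
            unfolding st using q5 q2 by simp
          show "nmem (den store_entry s5) ''d'' = (nmem s ''d'')(?e := if hit then 1 else 0)"
            unfolding st using e5 e3 by simp
        qed (use sl in \<open>auto simp: hit_def Let_def split: option.splits\<close>)
      qed (simp_all add: store_entry_def)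
    qed simp
    then have "wp (Seq (child_sum ''a2'' ''b2'' ''c2'' ''on'') store_entry) ?Q (250 * Suc n) (den ?mid s2)"
      using e3[of "''v''"] q3 q2 w vs by (simp add: s3_def)
    then show "wp (Seq ?mid (Seq (child_sum ''a2'' ''b2'' ''c2'' ''on'') store_entry)) ?Q (370 * Suc n) s2"
      by (rule wp_den_Seq[rotated]) (simp_all add: slot_def)
  qed simp
  then have "wp (Seq (child_sum ''a'' ''b'' ''c'' ''off'') (Seq ?mid (Seq (child_sum ''a2'' ''b2'' ''c2'' ''on'') store_entry))) ?Q
    (480 * Suc n) (den (QSet ''off'' (NConst 0) (QConst 0)) s)" by simp
  then show ?thesis
    unfolding entry_def by (rule wp_den_Seq[rotated]) simp_all
qed

lemma wp_row:
  assumes cx: "ctx E M n par w v s" and v: "v < n"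
    and X: "\<And>u t. (u, t) \<in> X \<Longrightarrow> u < n \<and> t \<in> triples n \<and> v \<notin> children n par (Suc u)"
    and vv: "v \<notin> children n par (Suc v)"
    and rows: "rows_ok E M n par w s X"
  shows "wp row (\<lambda>s'. rows_ok E M n par w s' (X \<union> {v} \<times> triples n)) (569 * Suc n ^ 4) s"
proof -
  \<comment> \<open>Progress in lexicographic order: \<open>?A\<close> collects the finished values
    of the first component, \<open>?B\<close> and \<open>?C\<close> add those of the second and
    third within the current ones.\<close>
  let ?A = "\<lambda>i. X \<union> {(v, a, b, c) | a b c. a < i \<and> b \<le> n \<and> c \<le> n}"
  let ?B = "\<lambda>i j. ?A i \<union> {(v, i, b, c) | b c. b < j \<and> c \<le> n}"
  let ?C = "\<lambda>i j k. ?B i j \<union> {(v, i, j, c) | c. c < k}"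
  have XC: "u < n \<and> t \<in> triples n \<and> v \<notin> children n par (Suc u)"
    if "(u, t) \<in> ?C i j k" "i \<le> n" "j \<le> n" "k \<le> n" for u t i j k
    using that X[of u t] v vv by (auto simp: triples_def)
  have eqs: "?C i j 0 = ?B i j" "?C i j (Suc n) = ?B i (Suc j)" "?C i j (Suc k) = insert (v, i, j, k) (?C i j k)"
    "?B i 0 = ?A i" "?B i (Suc n) = ?A (Suc i)" "?A 0 = X" "?A (Suc n) = X \<union> {v} \<times> triples n" for i j k
    by (auto simp: less_Suc_eq less_Suc_eq_le triples_def)
  let ?R = "\<lambda>Y s'. rows_ok E M n par w s' Y"
  let ?loop_c = "For ''c'' ''N'' entry" and ?loop_b = "For ''b'' ''N'' (For ''c'' ''N'' entry)"
  have loop_c: "wp ?loop_c (?R (?B i (Suc j))) ((500 + 23) * Suc n ^ 2) s1"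
    if "ctx E M n par w v s1" "nmem s1 ''a'' 0 = i" "nmem s1 ''b'' 0 = j" "i \<le> n" "j \<le> n" "?R (?B i j) s1" for i j s1
  proof -
    have "wp ?loop_c (?R (?C i j (Suc n))) (Suc n * (500 * Suc n ^ 1 + 13) + 10) s1"
    proof (rule wp_For[where I = "\<lambda>k. ?R (?C i j k)"])
      show "nmem s1 ''N'' 0 = Suc n" using that(1) base_N by (simp add: ctx_def)
      show "?R (?C i j 0) s1" using that(6) unfolding eqs .
      fix k s' assume k: "k < Suc n" "?R (?C i j k) s'" "nmem s' ''c'' 0 = k" and fr: "frame ?loop_c s1 s'"
      have "wp entry (?R (insert (v, i, j, k) (?C i j k))) (500 * Suc n) s'"
      proof (rule wp_entry[OF _ v])
        show "ctx E M n par w v s'" using ctx_frame[OF that(1) fr] by simp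
        show "nmem s' ''a'' 0 = i" "nmem s' ''b'' 0 = j" "nmem s' ''c'' 0 = k"
          using frameD(1)[OF fr] that k by simp_all
        show "\<And>u t. (u, t) \<in> ?C i j k \<Longrightarrow> u < n \<and> t \<in> triples n \<and> v \<notin> children n par (Suc u)"
          by (rule XC, assumption) (use k(1) that(4,5) in simp_all)
      qed (use that k vv in auto)
      then show "wp entry (?R (?C i j (Suc k))) (500 * Suc n ^ 1) s'" unfolding eqs by simp
    qed (auto simp: rows_ok_def)
    then show ?thesis
      unfolding eqs by (rule wp_mono) (use loop_cost[of "Suc n" "Suc n" "500 * Suc n ^ 1" 500 1] in \<open>simp add: numeral_2_eq_2\<close>)
  qed
  have loop_b: "wp ?loop_b (?R (?A (Suc i))) ((523 + 23) * Suc n ^ 3) s1"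
    if "ctx E M n par w v s1" "nmem s1 ''a'' 0 = i" "i \<le> n" "?R (?A i) s1" for i s1
  proof -
    have "wp ?loop_b (?R (?B i (Suc n))) (Suc n * ((500 + 23) * Suc n ^ 2 + 13) + 10) s1"
    proof (rule wp_For[where I = "\<lambda>j. ?R (?B i j)"])
      show "nmem s1 ''N'' 0 = Suc n" using that(1) base_N by (simp add: ctx_def)
      show "?R (?B i 0) s1" using that(4) unfolding eqs .
      fix j s' assume j: "j < Suc n" "?R (?B i j) s'" "nmem s' ''b'' 0 = j" and fr: "frame ?loop_b s1 s'"
      show "wp ?loop_c (?R (?B i (Suc j))) ((500 + 23) * Suc n ^ 2) s'"
      proof (rule loop_c)
        show "ctx E M n par w v s'" using ctx_frame[OF that(1) fr] by simp
        show "nmem s' ''a'' 0 = i" using frameD(1)[OF fr] that by simp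
      qed (use that j in auto)
    qed (auto simp: rows_ok_def)
    then show ?thesis
      unfolding eqs by (rule wp_mono) (use loop_cost[of "Suc n" "Suc n" "523 * Suc n ^ 2" 523 2] in simp)
  qed
  have "wp row (?R (?A (Suc n))) (Suc n * ((523 + 23) * Suc n ^ 3 + 13) + 10) s"
    unfolding row_def
  proof (rule wp_For[where I = "\<lambda>i. ?R (?A i)"])
    show "nmem s ''N'' 0 = Suc n" using cx base_N by (simp add: ctx_def)
    show "?R (?A 0) s" using rows unfolding eqs .
    fix i s' assume i: "i < Suc n" "?R (?A i) s'" "nmem s' ''a'' 0 = i" and fr: "frame (For ''a'' ''N'' ?loop_b) s s'"
    show "wp ?loop_b (?R (?A (Suc i))) ((523 + 23) * Suc n ^ 3) s'"
    proof (rule loop_b)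
      show "ctx E M n par w v s'" using ctx_frame[OF cx fr] by simp
    qed (use i in auto)
  qed (auto simp: rows_ok_def)
  then show ?thesis
    unfolding eqs by (rule wp_mono) (use loop_cost[of "Suc n" "Suc n" "546 * Suc n ^ 3" 546 3] in simp)
qed

text \<open>By \<open>later\<close>, the row being written belongs neither to a child of an already
  treated vertex nor to a child of the current vertex itself, so an equation stays true once it has
  been established.\<close>

lemma wp_table:
  assumes b: "base n s" and ag: "adj_ok E M n s" and par: "nmem s ''par'' = par" and w: "qmem s ''w'' = w"
    and ord: "nmem s ''ord'' = \<sigma>" "\<And>j. j < n \<Longrightarrow> \<sigma> j < n"
    and later: "\<And>i j. i < n \<Longrightarrow> j \<le> i \<Longrightarrow> par (\<sigma> i) \<noteq> Suc (\<sigma> j)"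
  shows "wp table (\<lambda>s'. rows_ok E M n par w s' (\<sigma> ` {..<n} \<times> triples n)) (1000 * Suc n ^ 5) s"
proof -
  let ?I = "\<lambda>i s'. rows_ok E M n par w s' (\<sigma> ` {..<i} \<times> triples n)"
  have loop: "wp table (?I n) (n * (600 * Suc n ^ 4 + 13) + 10) s"
    unfolding table_def
  proof (rule wp_For[where I = ?I])
    show "nmem s ''n'' 0 = n" using base_n[OF b] .
    fix i s' assume i: "i < n" and I: "?I i s'" and x: "nmem s' ''i'' 0 = i"
      and fr: "frame (For ''i'' ''n'' (Seq (setv ''v'' (NGet ''ord'' (V ''i''))) row)) s s'"
    have b': "base n s'" using base_frame[OF b fr] by simp
    have eq: "nmem s' ''g'' = nmem s ''g''" "nmem s' ''m'' = nmem s ''m''" "nmem s' ''par'' = par" "qmem s' ''w'' = w"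
      "nmem s' ''ord'' = \<sigma>"
      using frameD[OF fr] par w ord by simp_all
    let ?s1 = "nstore ''v'' 0 (\<sigma> i) s'"
    have cx: "ctx E M n par w (\<sigma> i) ?s1"
      using b' ag eq by (simp add: ctx_def base_def adj_ok_def)
    have "wp row (\<lambda>s''. rows_ok E M n par w s'' (\<sigma> ` {..<i} \<times> triples n \<union> {\<sigma> i} \<times> triples n)) (569 * Suc n ^ 4) ?s1"
    proof (rule wp_row[OF cx ord(2)[OF i]])
      show "u < n \<and> t \<in> triples n \<and> \<sigma> i \<notin> children n par (Suc u)"
        if ut: "(u, t) \<in> \<sigma> ` {..<i} \<times> triples n" for u t
      proof -
        obtain l where l: "l < i" "u = \<sigma> l" "t \<in> triples n" using ut by auto
        then show ?thesis using i ord(2)[of l] later[OF i, of l] by (simp add: children_def)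
      qed
      show "\<sigma> i \<notin> children n par (Suc (\<sigma> i))" using later[OF i, of i] by (simp add: children_def)
      show "rows_ok E M n par w ?s1 (\<sigma> ` {..<i} \<times> triples n)" using I by (simp add: rows_ok_def)
    qed
    moreover have "\<sigma> ` {..<i} \<times> triples n \<union> {\<sigma> i} \<times> triples n = \<sigma> ` {..<Suc i} \<times> triples n"
      by (auto simp: less_Suc_eq)
    ultimately have "wp row (?I (Suc i)) (569 * Suc n ^ 4) (den (setv ''v'' (NGet ''ord'' (V ''i''))) s')"
      using x eq by simp
    then show "wp (Seq (setv ''v'' (NGet ''ord'' (V ''i''))) row) (?I (Suc i)) (600 * Suc n ^ 4) s'"
    proof (rule wp_den_Seq[rotated])
      show "1 + ccost (setv ''v'' (NGet ''ord'' (V ''i''))) + 569 * Suc n ^ 4 \<le> 600 * Suc n ^ 4"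
        by (rule const_cost) simp_all
    qed simp
  qed (auto simp: rows_ok_def)
  show ?thesis
    by (rule wp_mono[OF loop]) (use loop_cost[of n "Suc n" "600 * Suc n ^ 4" 600 4] in simp)
qed

text \<open>
  Position \<open>Suc v\<close> holds the triple that \<open>v\<close> passes on to its children, position \<open>0\<close> the one for the roots.
\<close>

definition post :: "memory \<Rightarrow> nat \<Rightarrow> nat \<times> nat \<times> nat" where
  "post s k = (nmem s ''pa'' k, nmem s ''pb'' k, nmem s ''pc'' k)"

section \<open>Reading off an optimal set from the top of the forest. Shifted parents index the
  stored triples directly\<close>

definition recon_load :: com where
  "recon_load = Seq (setv ''v'' (NGet ''ord'' (NMinus (NMinus (V ''n'') (NConst 1)) (V ''i''))))
     (Seq (setv ''a'' (NGet ''pa'' (NGet ''par'' (V ''v''))))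
       (Seq (setv ''b'' (NGet ''pb'' (NGet ''par'' (V ''v'')))) (setv ''c'' (NGet ''pc'' (NGet ''par'' (V ''v''))))))"

definition recon_store :: com where
  "recon_store = Cond (pos_test (NGet ''d'' (idx4 (V ''v'') (V ''a'') (V ''b'') (V ''c''))))
     (Seq (NSet ''out'' (V ''v'') (NConst 1)) (Seq (NSet ''pa'' (NPlus (V ''v'') (NConst 1)) (V ''a2''))
       (Seq (NSet ''pb'' (NPlus (V ''v'') (NConst 1)) (V ''b2'')) (NSet ''pc'' (NPlus (V ''v'') (NConst 1)) (V ''c2'')))))
     (Seq (NSet ''out'' (V ''v'') (NConst 0)) (Seq (NSet ''pa'' (NPlus (V ''v'') (NConst 1)) (V ''a''))
       (Seq (NSet ''pb'' (NPlus (V ''v'') (NConst 1)) (V ''b'')) (NSet ''pc'' (NPlus (V ''v'') (NConst 1)) (V ''c'')))))"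

definition recon_step :: com where
  "recon_step = Seq recon_load (Seq slot recon_store)"

definition recon :: com where
  "recon = Seq (Seq (NSet ''pa'' (NConst 0) (V ''n'')) (Seq (NSet ''pb'' (NConst 0) (V ''n'')) (NSet ''pc'' (NConst 0) (V ''n''))))
     (For ''i'' ''n'' recon_step)"

lemma mods_recon [simp]:
  "nmods recon_load = {''v'', ''a'', ''b'', ''c''}" "qmods recon_load = {}"
  "nmods recon_store = {''out'', ''pa'', ''pb'', ''pc''}" "qmods recon_store = {}"
  "nmods recon_step = {''v'', ''a'', ''b'', ''c'', ''a2'', ''b2'', ''c2'', ''ok'', ''out'', ''pa'', ''pb'', ''pc''}" "qmods recon_step = {}"
  by (auto simp: recon_load_def recon_store_def recon_step_def)

lemma loop_free_recon_step: "loop_free recon_step"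
  by (simp add: recon_step_def recon_load_def recon_store_def slot_def)

lemma den_frame: "loop_free c \<Longrightarrow> frame c s (den c s)"
  using wp_den_aux[of c s] exec_frame unfolding wp_def by blast

lemma den_recon_step:
  assumes b: "base n s" and ag: "adj_ok E M n s" and i: "nmem s ''i'' 0 = i" "i < n"
    and v: "nmem s ''ord'' (n - 1 - i) = v" "v < n"
    and t: "post s (nmem s ''par'' v) = t" "t \<in> triples n"
    and dec: "0 < tab n (nmem s ''d'') v t \<Longrightarrow> put_slot E M v t \<noteq> None"
  defines "s' \<equiv> den recon_step s"
  shows "post s' = (post s)(Suc v := if 0 < tab n (nmem s ''d'') v t then the (put_slot E M v t) else t)"
    and "nmem s' ''out'' = (nmem s ''out'')(v := if 0 < tab n (nmem s ''d'') v t then 1 else 0)"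
proof -
  obtain a b' c where abc: "t = (a, b', c)" by (cases t)
  have le: "a \<le> n" "b' \<le> n" "c \<le> n" using t(2) abc by (auto simp: triples_def)
  define s1 where "s1 = den recon_load s"
  have p: "nmem s ''pa'' (nmem s ''par'' v) = a" "nmem s ''pb'' (nmem s ''par'' v) = b'" "nmem s ''pc'' (nmem s ''par'' v) = c"
    using t(1) abc by (auto simp: post_def)
  have s1: "s1 = nstore ''c'' 0 c (nstore ''b'' 0 b' (nstore ''a'' 0 a (nstore ''v'' 0 v s)))"
    unfolding s1_def recon_load_def using base_n[OF b] i v p by simp
  have b1: "base n s1" using b by (simp add: s1 base_def)
  have ag1: "adj_ok E M n s1" using ag by (simp add: s1 adj_ok_def)
  define s2 where "s2 = den slot s1"
  have sl: "case put_slot E M v t of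
      None \<Rightarrow> nmem s2 ''ok'' 0 = 0
      | Some t' \<Rightarrow> nmem s2 ''ok'' 0 = 1 \<and> t' = (nmem s2 ''a2'' 0, nmem s2 ''b2'' 0, nmem s2 ''c2'' 0)"
    unfolding s2_def abc by (rule den_slot(1)[OF b1 ag1 _ v(2) _ _ _ le]) (simp_all add: s1)
  have f2: "frame slot s1 s2" unfolding s2_def by (rule den_frame) (simp add: slot_def)
  have e2: "nmem s2 x = nmem s1 x" if "x \<notin> {''a2'', ''b2'', ''c2'', ''ok''}" for x
    using frameD(1)[OF f2, of x] that by simp
  have b2: "base n s2" using base_frame[OF b1 f2] by simp
  have e4: "nmem s2 ''mul'' (nmem s2 ''mul'' (nmem s2 ''mul'' v + a) + b') + c = enc4 n v a b' c"
    using mul_enc4[OF b2] v(2) le by simp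
  have vs: "nmem s2 ''v'' 0 = v" "nmem s2 ''a'' 0 = a" "nmem s2 ''b'' 0 = b'" "nmem s2 ''c'' 0 = c"
    "nmem s2 ''d'' = nmem s ''d''" "nmem s2 ''out'' = nmem s ''out''"
    "nmem s2 ''pa'' = nmem s ''pa''" "nmem s2 ''pb'' = nmem s ''pb''" "nmem s2 ''pc'' = nmem s ''pc''"
    using e2 by (simp_all add: s1)
  have s': "s' = den recon_store s2" by (simp add: s'_def recon_step_def s1_def s2_def)
  have dv: "tab n (nmem s ''d'') v t = nmem s ''d'' (enc4 n v a b' c)" by (simp add: tab_def abc)
  show "post s' = (post s)(Suc v := if 0 < tab n (nmem s ''d'') v t then the (put_slot E M v t) else t)"
  proof (cases "0 < tab n (nmem s ''d'') v t")
    case True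
    then obtain t' where t': "put_slot E M v t = Some t'" using dec by blast
    then have "t' = (nmem s2 ''a2'' 0, nmem s2 ''b2'' 0, nmem s2 ''c2'' 0)" using sl by simp
    then show ?thesis using True t' dv unfolding s' recon_store_def
      by (intro ext) (simp add: vs e4 post_def)
  next
    case False
    then show ?thesis using dv abc unfolding s' recon_store_def
      by (intro ext) (simp add: vs e4 post_def)
  qed
  show "nmem s' ''out'' = (nmem s ''out'')(v := if 0 < tab n (nmem s ''d'') v t then 1 else 0)"
    using dv unfolding s' recon_store_def by (simp add: vs e4)
qed

text \<open>The order is traversed backwards: a parent comes later in it than its children, so the
  triple it passes on is available when they are treated.\<close>

lemma wp_recon:
  assumes b: "base n s" and ag: "adj_ok E M n s" and par: "nmem s ''par'' = par"
    and ord: "nmem s ''ord'' = \<sigma>" "bij_betw \<sigma> {..<n} {..<n}"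
    and later: "\<And>j. j < n \<Longrightarrow> par (\<sigma> j) = 0 \<or> (\<exists>l. j < l \<and> l < n \<and> par (\<sigma> j) = Suc (\<sigma> l))"
    and d: "nmem s ''d'' = d"
    and dec: "\<And>v t. v < n \<Longrightarrow> t \<in> triples n \<Longrightarrow> 0 < tab n d v t \<Longrightarrow> put_slot E M v t \<noteq> None"
  shows "wp recon (\<lambda>s'. post s' 0 = (n, n, n) \<and> (\<forall>v<n. let t = post s' (par v) in
      (0 < nmem s' ''out'' v \<longleftrightarrow> 0 < tab n d v t) \<and>
      post s' (Suc v) = (if 0 < tab n d v t then the (put_slot E M v t) else t))) (1000 * Suc n) s"
proof -
  have lt: "\<sigma> j < n" if "j < n" for j using ord(2) that by (auto simp: bij_betw_def)
  have inj: "\<sigma> i = \<sigma> j \<longleftrightarrow> i = j" if "i < n" "j < n" for i j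
    using ord(2) that by (auto simp: bij_betw_def inj_on_def)
  \<comment> \<open>Membership in \<open>triples\<close> is carried along because
    \<open>dec\<close>, which makes \<open>the\<close> meaningful, and the table addresses need
    components of at most \<open>n\<close>.\<close>
  define ok where "ok P out v \<longleftrightarrow> (let t = P (par v) in t \<in> triples n \<and> P (Suc v) \<in> triples n \<and>
      (0 < out v \<longleftrightarrow> 0 < tab n d v t) \<and>
      P (Suc v) = (if 0 < tab n d v t then the (put_slot E M v t) else t))"
    for P :: "nat \<Rightarrow> nat \<times> nat \<times> nat" and out :: "nat \<Rightarrow> nat" and v
  let ?I = "\<lambda>i s'. post s' 0 = (n, n, n) \<and> (\<forall>j<n. n - i \<le> j \<longrightarrow> ok (post s') (nmem s' ''out'') (\<sigma> j))"
  let ?s1 = "nstore ''pc'' 0 n (nstore ''pb'' 0 n (nstore ''pa'' 0 n s))"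
  have loop: "wp (For ''i'' ''n'' recon_step) (?I n) (n * (600 + 13) + 10) ?s1"
  proof (rule wp_For[where I = ?I])
    show "nmem ?s1 ''n'' 0 = n" using base_n[OF b] by simp
    show "?I 0 ?s1" by (simp add: post_def)
    fix i s' assume i: "i < n" and I: "?I i s'" and x: "nmem s' ''i'' 0 = i"
      and fr: "frame (For ''i'' ''n'' recon_step) ?s1 s'"
    have b': "base n s'" using base_frame[of n ?s1, OF _ fr] b by (simp add: base_def)
    have eq: "nmem s' ''par'' = par" "nmem s' ''ord'' = \<sigma>" "nmem s' ''d'' = d"
      "nmem s' ''g'' = nmem s ''g''" "nmem s' ''m'' = nmem s ''m''"
      using frameD(1)[OF fr] par ord d by simp_all
    have ag': "adj_ok E M n s'" using ag eq by (simp add: adj_ok_def)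
    let ?j = "n - 1 - i"
    have j: "?j < n" using i by simp
    let ?v = "\<sigma> ?j"
    let ?t = "post s' (par ?v)"
    have t: "?t \<in> triples n"
    proof (cases "par ?v = 0")
      case True
      then show ?thesis using I by (simp add: triples_def)
    next
      case False
      then obtain l where l: "?j < l" "l < n" "par ?v = Suc (\<sigma> l)" using later[OF j] by auto
      then have "ok (post s') (nmem s' ''out'') (\<sigma> l)" using I by simp
      then have "post s' (Suc (\<sigma> l)) \<in> triples n" unfolding ok_def Let_def by (elim conjE)
      then show ?thesis by (simp only: l(3))
    qed
    have dec': "put_slot E M ?v ?t \<noteq> None" if "0 < tab n (nmem s' ''d'') ?v ?t"
      using dec[OF lt[OF j] t] that eq by simp
    have P: "post (den recon_step s') = (post s')(Suc ?v := if 0 < tab n d ?v ?t then the (put_slot E M ?v ?t) else ?t)"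
      and out: "nmem (den recon_step s') ''out'' = (nmem s' ''out'')(?v := if 0 < tab n d ?v ?t then 1 else 0)"
      using den_recon_step[OF b' ag' x i _ lt[OF j] _ t dec'] eq by simp_all
    have new: "(if 0 < tab n d ?v ?t then the (put_slot E M ?v ?t) else ?t) \<in> triples n"
      using t dec' put_slot_triples[OF _ t lt[OF j]] eq(3) by auto
    show "wp recon_step (?I (Suc i)) 600 s'"
    proof (rule wp_den[OF loop_free_recon_step])
      show "?I (Suc i) (den recon_step s')"
      proof (intro conjI allI impI)
        show "post (den recon_step s') 0 = (n, n, n)" unfolding P using I by simp
        fix l assume l: "l < n" "n - Suc i \<le> l"
        \<comment> \<open>The cell written in this round is not one that a treated vertex has read:
          the parent of such a vertex stands strictly later in the order than the current
          vertex.\<close>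
        have parv: "par (\<sigma> l) \<noteq> Suc ?v"
        proof
          assume e: "par (\<sigma> l) = Suc ?v"
          then obtain l' where "l < l'" "l' < n" "\<sigma> l' = ?v" using later[OF l(1)] by auto
          then show False using inj[of l' ?j] j l by simp
        qed
        show "ok (post (den recon_step s')) (nmem (den recon_step s') ''out'') (\<sigma> l)"
        proof (cases "l = ?j")
          case True
          then show ?thesis using parv t new unfolding ok_def P out Let_def by simp
        next
          case False
          then have "ok (post s') (nmem s' ''out'') (\<sigma> l)" using I l by simp
          moreover have "\<sigma> l \<noteq> ?v" using False inj[OF l(1) j] by simp
          then have "post (den recon_step s') (par (\<sigma> l)) = post s' (par (\<sigma> l))"
            "post (den recon_step s') (Suc (\<sigma> l)) = post s' (Suc (\<sigma> l))"
            "nmem (den recon_step s') ''out'' (\<sigma> l) = nmem s' ''out'' (\<sigma> l)"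
            using parv unfolding P out by simp_all
          ultimately show ?thesis unfolding ok_def by (simp only:)
        qed
      qed
    qed (simp add: recon_step_def recon_load_def recon_store_def slot_def)
  qed (auto simp: post_def[abs_def])
  have "wp (For ''i'' ''n'' recon_step) (\<lambda>s'. post s' 0 = (n, n, n) \<and> (\<forall>v<n. let t = post s' (par v) in
      (0 < nmem s' ''out'' v \<longleftrightarrow> 0 < tab n d v t) \<and>
      post s' (Suc v) = (if 0 < tab n d v t then the (put_slot E M v t) else t))) (700 * Suc n) ?s1"
  proof (rule wp_conseq[OF loop])
    fix s' assume I: "?I n s'"
    have "ok (post s') (nmem s' ''out'') v" if "v < n" for v
      using I bij_betw_imp_surj_on[OF ord(2)] that by (metis imageE lessThan_iff diff_self_eq_0 zero_le)
    then show "post s' 0 = (n, n, n) \<and> (\<forall>v<n. let t = post s' (par v) in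
      (0 < nmem s' ''out'' v \<longleftrightarrow> 0 < tab n d v t) \<and>
      post s' (Suc v) = (if 0 < tab n d v t then the (put_slot E M v t) else t))"
      using I unfolding ok_def Let_def by blast
  qed simp
  then show ?thesis
    unfolding recon_def using base_n[OF b]
    by (intro wp_den_Seq[where Bd = "700 * Suc n"]) simp_all
qed

section \<open>The complete algorithm\<close>

text \<open>Powers of \<open>n + 1\<close> are formed by repeated addition. The product table grows
  from its entry \<open>0\<close>, whose value is the initial zero of the memory.\<close>

definition init_tables :: com where
  "init_tables = Seq (Seq (setv ''N'' (NPlus (V ''n'') (NConst 1))) (Seq (setv ''N2'' (NConst 0)) (setv ''N3'' (NConst 0))))
    (Seq (For ''x'' ''N'' (setv ''N2'' (NPlus (V ''N2'') (V ''N''))))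
      (Seq (For ''x'' ''N'' (setv ''N3'' (NPlus (V ''N3'') (V ''N2''))))
        (For ''k'' ''N3'' (NSet ''mul'' (NPlus (V ''k'') (NConst 1)) (NPlus (NGet ''mul'' (V ''k'')) (V ''N''))))))"

text \<open>The input matrix has rows of length \<open>n\<close>, whereas the product table holds
  multiples of \<open>n + 1\<close>: subtracting \<open>x\<close> from \<open>x * (n + 1)\<close>
  gives \<open>x * n\<close>.\<close>

abbreviation adj_idx :: nexp where
  "adj_idx \<equiv> NPlus (NMinus (NGet ''mul'' (V ''x'')) (V ''x'')) (V ''y'')"

text \<open>\<open>g\<close> is the adjacency matrix with rows of length \<open>n + 1\<close>; its
  column \<open>n\<close> is not written and stays zero, so the marker \<open>n\<close> has no
  neighbours. \<open>h\<close> gets a full diagonal, being \<open>conn\<close> before any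
  elimination.\<close>

definition init_mats :: com where
  "init_mats = For ''x'' ''n'' (For ''y'' ''n''
     (Seq (NSet ''g'' (idx (V ''x'') (V ''y'')) (NGet ''adj'' adj_idx))
       (Cond (eq_test (V ''x'') (V ''y'')) (NSet ''h'' (idx (V ''x'') (V ''y'')) (NConst 1))
         (NSet ''h'' (idx (V ''x'') (V ''y'')) (NGet ''adj'' adj_idx)))))"

lemma mods_init [simp]:
  "nmods init_tables = {''N'', ''N2'', ''N3'', ''x'', ''k'', ''mul''}" "qmods init_tables = {}"
  "nmods init_mats = {''x'', ''y'', ''g'', ''h''}" "qmods init_mats = {}"
  by (auto simp: init_tables_def init_mats_def)

lemma wp_init_tables:
  assumes n: "nmem s ''n'' 0 = n" and mul: "nmem s ''mul'' 0 = 0"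
  shows "wp init_tables (base n) (200 * Suc n ^ 4) s"
proof -
  let ?N = "Suc n"
  let ?s1 = "nstore ''N3'' 0 0 (nstore ''N2'' 0 0 (nstore ''N'' 0 ?N s))"
  let ?c1 = "setv ''N2'' (NPlus (V ''N2'') (V ''N''))" and ?c2 = "setv ''N3'' (NPlus (V ''N3'') (V ''N2''))"
  let ?c3 = "NSet ''mul'' (NPlus (V ''k'') (NConst 1)) (NPlus (NGet ''mul'' (V ''k'')) (V ''N''))"
  have l1: "wp (For ''x'' ''N'' ?c1) (\<lambda>s'. nmem s' ''N2'' 0 = ?N * ?N) (?N * (7 + 13) + 10) ?s1"
  proof (rule wp_For[where I = "\<lambda>i s'. nmem s' ''N2'' 0 = i * ?N"])
    fix i s' assume "nmem s' ''N2'' 0 = i * ?N" and fr: "frame (For ''x'' ''N'' ?c1) ?s1 s'"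
    then show "wp ?c1 (\<lambda>s'. nmem s' ''N2'' 0 = Suc i * ?N) 7 s'"
      using frameD(1)[OF fr, of "''N''"] by (intro wp_den) simp_all
  qed auto
  have l2: "wp (For ''x'' ''N'' ?c2) (\<lambda>s'. nmem s' ''N3'' 0 = ?N * (?N * ?N)) (?N * (7 + 13) + 10) s2"
    if "nmem s2 ''N'' 0 = ?N" "nmem s2 ''N2'' 0 = ?N * ?N" "nmem s2 ''N3'' 0 = 0" for s2
  proof (rule wp_For[where I = "\<lambda>i s'. nmem s' ''N3'' 0 = i * (?N * ?N)"])
    fix i s' assume "nmem s' ''N3'' 0 = i * (?N * ?N)" and fr: "frame (For ''x'' ''N'' ?c2) s2 s'"
    then show "wp ?c2 (\<lambda>s'. nmem s' ''N3'' 0 = Suc i * (?N * ?N)) 7 s'"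
      using frameD(1)[OF fr, of "''N2''"] that by (intro wp_den) simp_all
  qed (use that in auto)
  have l3: "wp (For ''k'' ''N3'' ?c3) (\<lambda>s'. \<forall>k\<le>?N ^ 3. nmem s' ''mul'' k = k * ?N) (?N ^ 3 * (20 + 13) + 10) s3"
    if "nmem s3 ''N'' 0 = ?N" "nmem s3 ''N3'' 0 = ?N ^ 3" "nmem s3 ''mul'' 0 = 0" for s3
  proof (rule wp_For[where I = "\<lambda>i s'. \<forall>k\<le>i. nmem s' ''mul'' k = k * ?N"])
    fix i s' assume I: "\<forall>k\<le>i. nmem s' ''mul'' k = k * ?N" and k: "nmem s' ''k'' 0 = i"
      and fr: "frame (For ''k'' ''N3'' ?c3) s3 s'"
    have "den ?c3 s' = nstore ''mul'' (Suc i) (Suc i * ?N) s'"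
      using I k frameD(1)[OF fr, of "''N''"] that by (simp add: ac_simps)
    then show "wp ?c3 (\<lambda>s'. \<forall>k\<le>Suc i. nmem s' ''mul'' k = k * ?N) 20 s'"
      using I by (intro wp_den) (auto simp: le_Suc_eq)
  qed (use that in auto)
  let ?K = "?N ^ 3 * (20 + 13) + 10" and ?J = "?N * (7 + 13) + 10"
  have "wp (Seq (For ''x'' ''N'' ?c1) (Seq (For ''x'' ''N'' ?c2) (For ''k'' ''N3'' ?c3))) (base n) (1 + ?J + (1 + ?J + ?K)) ?s1"
  proof (rule wp_SeqI[OF l1])
    fix s2 assume f2: "frame (For ''x'' ''N'' ?c1) ?s1 s2" and q2: "nmem s2 ''N2'' 0 = ?N * ?N"
    have e2: "nmem s2 ''N'' 0 = ?N" "nmem s2 ''N3'' 0 = 0" "nmem s2 ''n'' 0 = n" "nmem s2 ''mul'' 0 = 0"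
      using frameD(1)[OF f2] n mul by simp_all
    show "wp (Seq (For ''x'' ''N'' ?c2) (For ''k'' ''N3'' ?c3)) (base n) (1 + ?J + ?K) s2"
    proof (rule wp_SeqI[OF l2[OF e2(1) q2 e2(2)]])
      fix s3 assume f3: "frame (For ''x'' ''N'' ?c2) s2 s3" and q3: "nmem s3 ''N3'' 0 = ?N * (?N * ?N)"
      have e3: "nmem s3 ''N'' 0 = ?N" "nmem s3 ''n'' 0 = n" "nmem s3 ''mul'' 0 = 0"
        using frameD(1)[OF f3] e2 by simp_all
      have q3': "nmem s3 ''N3'' 0 = ?N ^ 3" using q3 by (simp add: power3_eq_cube algebra_simps)
      show "wp (For ''k'' ''N3'' ?c3) (base n) ?K s3"
      proof (rule wp_conseq[OF l3[OF e3(1) q3' e3(3)]])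
        fix s4 assume f4: "frame (For ''k'' ''N3'' ?c3) s3 s4" and q4: "\<forall>k\<le>?N ^ 3. nmem s4 ''mul'' k = k * ?N"
        show "base n s4" using frameD(1)[OF f4] e3 q4 by (simp add: base_def)
      qed simp
    qed simp
  qed simp
  then have "wp (Seq (For ''x'' ''N'' ?c1) (Seq (For ''x'' ''N'' ?c2) (For ''k'' ''N3'' ?c3))) (base n) (1 + ?J + (1 + ?J + ?K))
    (den (Seq (setv ''N'' (NPlus (V ''n'') (NConst 1))) (Seq (setv ''N2'' (NConst 0)) (setv ''N3'' (NConst 0)))) s)"
    using n by simp
  moreover have "40 + (1 + ?J + (1 + ?J + ?K)) \<le> 200 * ?N ^ 4"
  proof -
    have "40 + (1 + (M * (7 + 13) + 10) + (1 + (M * (7 + 13) + 10) + (M ^ 3 * (20 + 13) + 10))) \<le> 200 * M ^ 4"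
      if "1 \<le> M" for M :: nat
    proof -
      have "M \<le> M ^ 4" using that by (intro self_le_power) auto
      moreover have "M ^ 3 \<le> M ^ 4" using that by (intro power_increasing) auto
      moreover have "40 + (1 + (M * (7 + 13) + 10) + (1 + (M * (7 + 13) + 10) + (a * (20 + 13) + 10))) \<le> 200 * b"
        if "M \<le> b" "a \<le> b" for a b :: nat
        using that \<open>1 \<le> M\<close> by simp
      ultimately show ?thesis by blast
    qed
    from this[of ?N] show ?thesis by simp
  qed
  ultimately show ?thesis
    unfolding init_tables_def by (elim wp_den_Seq[rotated]) simp_all
qed

lemma wp_init_mats:
  assumes b: "base n s" and adj: "\<And>x y. x < n \<Longrightarrow> y < n \<Longrightarrow> 0 < nmem s ''adj'' (x * n + y) \<longleftrightarrow> E x y"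
    and E: "\<And>x y. E x y \<Longrightarrow> x < n \<and> y < n" and g0: "\<And>k. nmem s ''g'' k = 0"
  shows "wp init_mats (\<lambda>s'. (\<forall>x<n. \<forall>y\<le>n. 0 < nmem s' ''g'' (enc n x y) \<longleftrightarrow> E x y) \<and>
    mat n (nmem s' ''h'') (conn E {})) (200 * Suc n ^ 2) s"
proof -
  let ?P = "\<lambda>i j x y. x < i \<or> x = i \<and> y < (j::nat)"
  let ?I = "\<lambda>i j s'. (\<forall>x<n. nmem s' ''g'' (enc n x n) = 0) \<and>
    (\<forall>x<n. \<forall>y<n. ?P i j x y \<longrightarrow> (0 < nmem s' ''g'' (enc n x y) \<longleftrightarrow> E x y) \<and>
       (0 < nmem s' ''h'' (enc n x y) \<longleftrightarrow> x = y \<or> E x y))"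
  let ?c = "Seq (NSet ''g'' (idx (V ''x'') (V ''y'')) (NGet ''adj'' adj_idx))
       (Cond (eq_test (V ''x'') (V ''y'')) (NSet ''h'' (idx (V ''x'') (V ''y'')) (NConst 1))
         (NSet ''h'' (idx (V ''x'') (V ''y'')) (NGet ''adj'' adj_idx)))"
  have loop: "wp init_mats (?I n 0) (n * ((n * (100 + 13) + 10) + 13) + 10) s"
    unfolding init_mats_def
  proof (rule wp_For2[where I = ?I])
    show "nmem s ''n'' 0 = n" using base_n[OF b] .
    show "?I 0 0 s" using g0 by simp
    fix i j s' assume i: "i < n" and j: "j < n" and I: "?I i j s'"
      and x: "nmem s' ''x'' 0 = i" and y: "nmem s' ''y'' 0 = j"
      and fr: "frame (For ''x'' ''n'' (For ''y'' ''n'' ?c)) s s'"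
    have b': "base n s'" using base_frame[OF b fr] by simp
    have eq: "nmem s' ''adj'' = nmem s ''adj''" using frameD(1)[OF fr] by simp
    note [simp] = mul_enc1[OF b']
    have "nmem s' ''mul'' i = enc n i 0" using mul_enc1[OF b', of i 0] i by simp
    then have ai: "nmem s' ''mul'' i - i + j = i * n + j" by (simp add: enc_def)
    let ?a = "nmem s ''adj'' (i * n + j)"
    have den: "den ?c s' = nstore ''h'' (enc n i j) (if i = j then 1 else ?a) (nstore ''g'' (enc n i j) ?a s')"
      using i x y eq ai by auto
    have a: "0 < ?a \<longleftrightarrow> E i j" using adj i j .
    show "wp ?c (?I i (Suc j)) 100 s'"
    proof (rule wp_den)
      show "?I i (Suc j) (den ?c s')"
        unfolding den using I a i j by (auto simp: less_Suc_eq)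
    qed simp_all
  qed (auto simp: less_Suc_eq)
  show ?thesis
  proof (rule wp_conseq[OF loop])
    fix s' assume I: "?I n 0 s'"
    have "0 < nmem s' ''g'' (enc n x y) \<longleftrightarrow> E x y" if "x < n" "y \<le> n" for x y
      using I E[of x y] that by (cases "y = n") auto
    then show "(\<forall>x<n. \<forall>y\<le>n. 0 < nmem s' ''g'' (enc n x y) \<longleftrightarrow> E x y) \<and> mat n (nmem s' ''h'') (conn E {})"
      using I by (auto simp: mat_def)
  qed (use loop2_cost[of n "Suc n" 100 100] in simp)
qed

definition mwis_program :: com where
  "mwis_program = Seq init_tables (Seq init_mats (Seq elim (Seq table recon)))"

lemma wp_mwis_program:
  assumes D: "one_po E D" and irrefl: "\<And>u. \<not> E u u" and E_less: "\<And>u v. E u v \<Longrightarrow> u < n \<and> v < n"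
    and s: "nmem s ''n'' 0 = n" "\<And>x y. x < n \<Longrightarrow> y < n \<Longrightarrow> 0 < nmem s ''adj'' (x * n + y) \<longleftrightarrow> E x y"
    and s0: "\<And>A k. A \<noteq> ''n'' \<Longrightarrow> A \<noteq> ''adj'' \<Longrightarrow> nmem s A k = 0" and w: "qmem s ''w'' = w"
  defines "indep \<equiv> \<lambda>T. \<forall>x\<in>T. \<forall>y\<in>T. \<not> E x y"
  shows "wp mwis_program (\<lambda>s'. indep (output_set n s') \<and>
    (\<forall>T. T \<subseteq> {..<n} \<longrightarrow> indep T \<longrightarrow> sum w T \<le> sum w (output_set n s'))) (20000 * Suc n ^ 5) s"
proof -
  interpret one_po E D by fact
  let ?Q = "\<lambda>s'. indep (output_set n s') \<and>
    (\<forall>T. T \<subseteq> {..<n} \<longrightarrow> indep T \<longrightarrow> sum w T \<le> sum w (output_set n s'))"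
  let ?N = "Suc n"
  have El: "\<And>u v. E u v \<Longrightarrow> v < n" using E_less by blast
  have p5: "1 \<le> ?N ^ 5" "?N \<le> ?N ^ 5" "?N ^ 2 \<le> ?N ^ 5" "?N ^ 4 \<le> ?N ^ 5"
    using power_increasing[of 1 5 ?N] by (auto intro: power_increasing simp del: power_Suc)
  \<comment> \<open>The budgets from the inside out: table and reconstruction, then elimination, the
    matrices and finally the product table, with \<open>q\<close> for the fifth power of
    \<open>n + 1\<close>.\<close>
  have c: "1 + 1000 * q + 1000 * z \<le> 7000 * q" "1 + 4000 * q + 7000 * q \<le> 12000 * q"
    "1 + 200 * z + 12000 * q \<le> 15000 * q" "1 + 200 * z + 15000 * q \<le> 20000 * q"
    if "1 \<le> q" "z \<le> q" for q z :: nat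
    using that by linarith+
  have ne: "''mul'' \<noteq> ''n''" "''mul'' \<noteq> ''adj''" by simp_all
  show ?thesis
    unfolding mwis_program_def
  proof (rule wp_SeqI[OF wp_init_tables[OF s(1) s0[OF ne]], where Bd = "15000 * ?N ^ 5"])
    fix s1 assume f1: "frame init_tables s s1" and b1: "base n s1"
    have e1: "nmem s1 A = nmem s A" if "A \<notin> {''N'', ''N2'', ''N3'', ''x'', ''k'', ''mul''}" for A
      using frameD(1)[OF f1] that by simp
    have w1: "qmem s1 ''w'' = w" using frameD(2)[OF f1] w by simp
    have im: "wp init_mats (\<lambda>s'. (\<forall>x<n. \<forall>y\<le>n. 0 < nmem s' ''g'' (enc n x y) \<longleftrightarrow> E x y) \<and>
      mat n (nmem s' ''h'') (conn E {})) (200 * ?N ^ 2) s1"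
      by (rule wp_init_mats[OF b1 _ E_less]) (use e1 s s0 in auto)
    show "wp (Seq init_mats (Seq elim (Seq table recon))) ?Q (15000 * ?N ^ 5) s1"
    proof (rule wp_SeqI[OF im, where Bd = "12000 * ?N ^ 5"])
      fix s2 assume f2: "frame init_mats s1 s2" and gh: "(\<forall>x<n. \<forall>y\<le>n. 0 < nmem s2 ''g'' (enc n x y) \<longleftrightarrow> E x y) \<and>
        mat n (nmem s2 ''h'') (conn E {})"
      have e2: "nmem s2 A = nmem s A" if "A \<notin> {''N'', ''N2'', ''N3'', ''x'', ''k'', ''mul'', ''y'', ''g'', ''h''}" for A
        using frameD(1)[OF f2, of A] e1[of A] that by simp
      have b2: "base n s2" using base_frame[OF b1 f2] by simp
      have w2: "qmem s2 ''w'' = w" using frameD(2)[OF f2] w1 by simp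
      have i2: "elim_inv E n 0 s2"
        using gh e2 s0 by (simp add: elim_inv_def parents_upto_def)
      show "wp (Seq elim (Seq table recon)) ?Q (12000 * ?N ^ 5) s2"
      proof (rule wp_SeqI[OF wp_elim[OF sym El b2 i2], where Bd = "7000 * ?N ^ 5"])
        fix s3 assume f3: "frame elim s2 s3" and i3: "elim_inv E n n s3"
        define \<sigma> par where "\<sigma> = nmem s3 ''ord''" and "par = nmem s3 ''par''"
        define M where "M = bag_rel E n \<sigma>"
        have b3: "base n s3" using base_frame[OF b2 f3] by simp
        have w3: "qmem s3 ''w'' = w" using frameD(2)[OF f3] w2 by simp
        have inj: "inj_on \<sigma> {..<n}" and im: "\<sigma> ` {..<n} \<subseteq> {..<n}"
          and av: "\<And>j. j < n \<Longrightarrow> avoidable E (bag E n \<sigma> j)"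
          and mb: "\<And>j x. j < n \<Longrightarrow> x < n \<Longrightarrow> 0 < nmem s3 ''m'' (enc n (\<sigma> j) x) \<longleftrightarrow> x \<in> bag E n \<sigma> j"
          and m0: "\<And>x. x < n \<Longrightarrow> nmem s3 ''m'' (enc n x n) = 0"
          and pu: "parents_upto E n \<sigma> par n"
          using i3 unfolding elim_inv_def Let_def \<sigma>_def par_def by auto
        have bij: "bij_betw \<sigma> {..<n} {..<n}"
          using inj im by (simp add: bij_betw_def endo_inj_surj)
        interpret elim_order E D n \<sigma>
          by unfold_locales (use E_less bij av in auto)
        interpret elim_forest E M n pos par
          unfolding M_def by (rule elim_forest[OF irrefl pu])
        have later: "par (\<sigma> j) = 0 \<or> (\<exists>l. j < l \<and> l < n \<and> par (\<sigma> j) = Suc (\<sigma> l))" if "j < n" for j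
          using pu that unfolding parents_upto_def by blast
        have ag: "adj_ok E M n s3"
          unfolding adj_ok_def
        proof (intro allI impI conjI)
          fix v x assume v: "v < n" and x: "x \<le> n"
          show "0 < nmem s3 ''g'' (enc n v x) \<longleftrightarrow> E v x"
            using gh frameD(1)[OF f3, of "''g''"] v x by simp
          obtain j where j: "j < n" "\<sigma> j = v" using \<sigma>_surj[OF v] by blast
          have "M v x \<longleftrightarrow> x \<in> bag E n \<sigma> j"
            unfolding M_def bag_rel_def using j \<sigma>_inj by auto
          then show "0 < nmem s3 ''m'' (enc n v x) \<longleftrightarrow> M v x"
            using mb[OF j(1), of x] m0[OF v] j x by (cases "x = n") (auto simp: bag_def)
        qed
        have tb: "wp table (\<lambda>s'. rows_ok E M n par w s' (\<sigma> ` {..<n} \<times> triples n)) (1000 * ?N ^ 5) s3"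
        proof (rule wp_table[OF b3 ag par_def[symmetric] w3 \<sigma>_def[symmetric] \<sigma>_less])
          fix i j assume "i < n" "j \<le> i"
          then show "par (\<sigma> i) \<noteq> Suc (\<sigma> j)" using later[of i] \<sigma>_inj by auto
        qed
        show "wp (Seq table recon) ?Q (7000 * ?N ^ 5) s3"
        proof (rule wp_SeqI[OF tb, where Bd = "1000 * ?N"])
          fix s4 assume f4: "frame table s3 s4" and rows: "rows_ok E M n par w s4 (\<sigma> ` {..<n} \<times> triples n)"
          define f where "f = tab n (qmem s4 ''F'')"
          define d where "d v t \<longleftrightarrow> 0 < tab n (nmem s4 ''d'') v t" for v t
          have d: "d = (\<lambda>v t. 0 < tab n (nmem s4 ''d'') v t)" by (intro ext) (simp add: d_def)
          have b4: "base n s4" using base_frame[OF b3 f4] by simp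
          have e4: "nmem s4 ''par'' = par" "nmem s4 ''ord'' = \<sigma>" "nmem s4 ''g'' = nmem s3 ''g''" "nmem s4 ''m'' = nmem s3 ''m''"
            using frameD(1)[OF f4] by (simp_all add: par_def \<sigma>_def)
          have ag4: "adj_ok E M n s4" using ag e4 by (simp add: adj_ok_def)
          have ch: "children n par = ch" by (intro ext) (auto simp: children_def ch_def)
          have te: "table_eq E M ch w f d v t" if "v < n" "t \<in> triples n" for v t
          proof -
            have "(v, t) \<in> \<sigma> ` {..<n} \<times> triples n" using \<sigma>_surj[OF that(1)] that(2) by auto
            from bspec[OF rows[unfolded rows_ok_def ch] this] show ?thesis
              unfolding f_def d by simp
          qed
          have dec: "put_slot E M v t \<noteq> None" if "v < n" "t \<in> triples n" "d v t" for v t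
            using te[OF that(1,2)] that(3) by (auto simp: table_eq_def Let_def split: option.splits)
          have rc: "wp recon (\<lambda>s'. post s' 0 = (n, n, n) \<and> (\<forall>v<n. let t = post s' (par v) in
            (0 < nmem s' ''out'' v \<longleftrightarrow> 0 < tab n (nmem s4 ''d'') v t) \<and>
            post s' (Suc v) = (if 0 < tab n (nmem s4 ''d'') v t then the (put_slot E M v t) else t))) (1000 * ?N) s4"
            by (rule wp_recon[OF b4 ag4 e4(1,2) bij later refl]) (use dec in \<open>auto simp: d_def\<close>)
          show "wp recon ?Q (1000 * ?N) s4"
          proof (rule wp_conseq[OF rc])
            fix s5 assume r: "post s5 0 = (n, n, n) \<and> (\<forall>v<n. let t = post s5 (par v) in
              (0 < nmem s5 ''out'' v \<longleftrightarrow> 0 < tab n (nmem s4 ''d'') v t) \<and>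
              post s5 (Suc v) = (if 0 < tab n (nmem s4 ''d'') v t then the (put_slot E M v t) else t))"
            let ?S = "output_set n s5" and ?st = "\<lambda>v. post s5 (par v)"
            have "elim_forest.indep E ?S \<and> (\<forall>T. T \<subseteq> {..<n} \<longrightarrow> elim_forest.indep E T \<longrightarrow> sum w T \<le> sum w ?S)"
            proof (rule solution_optimal[of w f d ?S ?st])
              show "table_eq E M ch w f d v (a, b, c)" if "v < n" "a \<le> n" "b \<le> n" "c \<le> n" for v a b c
                using te that by (simp add: triples_def)
              show "?S \<subseteq> {..<n}" by (auto simp: output_set_def)
              show "v \<in> ?S \<longleftrightarrow> d v (?st v)" if "v < n" for v
                using r that by (simp add: output_set_def d_def Let_def)
              show "?st x = (n, n, n)" if "x \<in> ch 0" for x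
                using r that by (simp add: ch_def)
              show "?st x = (if d v (?st v) then the (put_slot E M v (?st v)) else ?st v)"
                if "v < n" "x \<in> ch (Suc v)" for v x
                using r that by (simp add: ch_def d_def Let_def)
            qed
            then show "?Q s5" by (simp add: indep_def assms(8))
          qed simp
        qed (rule c(1)[OF p5(1,2)])
      qed (assumption | rule c(2)[OF p5(1,1)])+
    qed (rule c(3)[OF p5(1,3)])
  qed (rule c(4)[OF p5(1,4)])
qed

theorem corollary3p17:
  shows "\<exists>(c :: com) (T :: nat \<Rightarrow> nat).
           (\<lambda>n. real (T n)) \<in> O(\<lambda>n. real n ^ 5) \<and>
           solves_MWIS c one_perfectly_orientable T"
proof (intro exI conjI)
  show "(\<lambda>n. real (20000 * Suc n ^ 5)) \<in> O(\<lambda>n. real n ^ 5)"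
  \<comment> \<open>The constant is 20000 times 32, from \<open>Suc n \<le> 2 * n\<close> for
    positive \<open>n\<close>.\<close>
  proof (rule bigoI[where c = 640000])
    show "\<forall>\<^sub>F n in sequentially. norm (real (20000 * Suc n ^ 5)) \<le> 640000 * norm (real n ^ 5)"
    proof (rule eventually_sequentiallyI[of 1])
      fix n :: nat assume "1 \<le> n"
      then have "Suc n ^ 5 \<le> (2 * n) ^ 5" by (intro power_mono) auto
      then have "Suc n ^ 5 \<le> 32 * n ^ 5" by (simp add: power_mult_distrib)
      then have "20000 * Suc n ^ 5 \<le> 640000 * n ^ 5" by linarith
      then have "real (20000 * Suc n ^ 5) \<le> real (640000 * n ^ 5)" by (rule of_nat_mono)
      then show "norm (real (20000 * Suc n ^ 5)) \<le> 640000 * norm (real n ^ 5)" by simp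
    qed
  qed
  show "solves_MWIS mwis_program one_perfectly_orientable (\<lambda>n. 20000 * Suc n ^ 5)"
    unfolding solves_MWIS_def
  proof (intro allI impI)
    fix n :: nat and G :: "nat pair_pre_digraph" and w :: "nat \<Rightarrow> rat"
    assume "one_perfectly_orientable G \<and> pverts G = {..<n} \<and> (\<forall>v\<in>pverts G. 0 \<le> w v)"
    then obtain D where po: "pair_graph G" and Gn: "pverts G = {..<n}" and D: "orientation_of G D"
      and out: "\<not> (\<exists>u v w. (u, v) \<in> D \<and> (u, w) \<in> D \<and> v \<noteq> w \<and> (v, w) \<notin> parcs G)"
      unfolding one_perfectly_orientable_def by blast
    interpret pair_graph G by fact
    \<comment> \<open>The memory holds zeros beyond the given weights, so the program is analysed
      with the weight function extended by zero; on vertex sets both have the same sums.\<close>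
    let ?E = "\<lambda>u v. (u, v) \<in> parcs G" and ?w = "\<lambda>k. if k < n then w k else 0"
    have po': "one_po ?E D"
    proof
      show "symp ?E" using arcs_symmetric by (auto intro: sympI)
    qed (use D out in \<open>auto simp: orientation_of_def\<close>)
    have E_less: "u < n \<and> v < n" if "?E u v" for u v
      using in_arcsD1[OF that] in_arcsD2[OF that] Gn by auto
    let ?s = "input_memory n G w"
    have "wp mwis_program (\<lambda>s'. (\<forall>x\<in>output_set n s'. \<forall>y\<in>output_set n s'. \<not> ?E x y) \<and>
      (\<forall>T. T \<subseteq> {..<n} \<longrightarrow> (\<forall>x\<in>T. \<forall>y\<in>T. \<not> ?E x y) \<longrightarrow> sum ?w T \<le> sum ?w (output_set n s'))) (20000 * Suc n ^ 5) ?s"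
    proof (rule wp_mwis_program[OF po' _ E_less])
      show "\<not> ?E u u" for u using no_loops' by blast
      show "nmem ?s ''n'' 0 = n" by (simp add: input_memory_def)
      show "0 < nmem ?s ''adj'' (x * n + y) \<longleftrightarrow> ?E x y" if "x < n" "y < n" for x y
      proof -
        have "Suc x * n \<le> n * n" using that by (intro mult_le_mono1) simp
        then have "x * n + y < n * n" using that by simp
        then show ?thesis using that by (simp add: input_memory_def)
      qed
      show "nmem ?s A k = 0" if "A \<noteq> ''n''" "A \<noteq> ''adj''" for A k
        using that by (simp add: input_memory_def)
      show "qmem ?s ''w'' = ?w" by (simp add: input_memory_def)
    qed
    then obtain t s' where ex: "exec mwis_program ?s t s'" "t \<le> 20000 * Suc n ^ 5"
      and ind: "\<forall>x\<in>output_set n s'. \<forall>y\<in>output_set n s'. \<not> ?E x y"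
      and opt: "\<And>T. T \<subseteq> {..<n} \<Longrightarrow> \<forall>x\<in>T. \<forall>y\<in>T. \<not> ?E x y \<Longrightarrow> sum ?w T \<le> sum ?w (output_set n s')"
      unfolding wp_def by blast
    have ww: "sum ?w T = sum w T" if "T \<subseteq> {..<n}" for T
      using that by (intro sum.cong) auto
    have "output_set n s' \<subseteq> {..<n}" by (auto simp: output_set_def)
    then have "max_weight_independent_set G w (output_set n s')"
      using ind opt ww unfolding max_weight_independent_set_def independent_set_def Gn by auto
    then show "\<exists>t s. exec mwis_program ?s t s \<and> t \<le> 20000 * Suc n ^ 5 \<and>
        max_weight_independent_set G w (output_set n s)"
      using ex by blast
  qed
qed

end
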